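(* Let $R>0$, $\alpha>0$, $\beta\ge 0$. Let $p:[0,+\infty)\to(0,+\infty)$ be continuous with $P:=\int_R^{+\infty}\frac{1}{p(t)}\,dt<+\infty$. Let $f:[0,+\infty)\times[0,+\infty)\to\mathbb{R}$ be continuous, with $f(t,v)\ge 0$ for $(t,v)\in[0,R]\times[0,+\infty)$ and $f(t,0)=0$ for $t\ge 0$. Suppose there are continuous functions $b_1,b_2:[R,+\infty)\to\mathbb{R}$, $b_2\ge 0$, and nondecreasing $C^1$ functions $F_1,F_2:[0,+\infty)\to[0,+\infty)$ with $F_j(0)=0$, $F_j(v)>0$ for $v>0$, $\limsup_{v\to0^+}F_j(v)/v<+\infty$ ($j=1,2$), such that $b_1(t)F_1(v)\le f(t,v)\le b_2(t)F_2(v)$ for all $(t,v)\in[R,+\infty)\times[0,+\infty)$. With $b_1^-=\max\{0,-b_1\}$, $b_1^+=\max\{0,b_1\}$, suppose $$B_1^-:=\int_R^{+\infty}b_1^-(t)\,dt<+\infty,\qquad \int_R^{+\infty}\frac1{p(t)}\int_R^tb_1^+(s)\,ds\,dt=+\infty.$$ For $d>0$ put $M_j(d):=\sup_{v\in(0,d]}F_j(v)/v$, $j=1,2$. Let $K$, $H$, $B$ and the conditions $(\mathrm I^1_\rho)$, $(\mathrm I^0_\rho)$ be as defined in the context. (a) Suppose there exist $0<\rho_1<\rho_2<+\infty$ such that either [$(\mathrm I^0_{\rho_1})$ and $(\mathrm I^1_{\rho_2})$ hold] or [$(\mathrm I^1_{\rho_1})$ and $(\mathrm I^0_{\rho_2})$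 hold]. If there exists $n>1$ such that, with $d=2\rho_2$, $$B_1^-\le\frac{\log 2}{M_1(d)P},\qquad p(t)\ge t^n\ \text{ and }\ b_2(t)\le\frac{(n-1)^2}{4M_2(d)}\,t^{n-2}\ \text{ for all } t\ge R, \qquad (\ast)$$ then the boundary value problem $$\begin{cases}(p(t)u'(t))'+f(t,u(t))=0,\quad t\ge 0,\\ \alpha u(0)-\beta u'(0)=B[u],\quad u(+\infty)=0,\end{cases}$$ has at least one (non-negative) solution $u_1$, with $u_1(t)\le 2\rho_2$ for all $t\ge 0$. (b) If, in addition, there exists $\rho_3\in(\rho_2,+\infty)$ such that either [$(\mathrm I^0_{\rho_1})$, $(\mathrm I^1_{\rho_2})$ and $(\mathrm I^0_{\rho_3})$ hold] or [$(\mathrm I^1_{\rho_1})$, $(\mathrm I^0_{\rho_2})$ and $(\mathrm I^1_{\rho_3})$ hold], and $(\ast)$ is satisfied (for some $n>1$) with $d=2\rho_3$, then the boundary value problem has an additional (non-negative) solution $u_2$ (distinct from $u_1$), with $u_2(t)\le 2\rho_3$ for all $t\ge0$.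
   Context: $C[0,R]$ carries the norm $\|u\|=\max_{[0,R]}|u|$. Kernel: for $t,s\in[0,R]$, $k(t,s)=\frac1\alpha\left(\frac{\beta}{p(0)}+\alpha\int_0^{\min\{s,t\}}\frac{d\mu}{p(\mu)}\right)$. Let $c(t)=\dfrac{\frac{\beta}{p(0)}+\alpha\int_0^t\frac{d\mu}{p(\mu)}}{\frac{\beta}{p(0)}+\alpha\int_0^R\frac{d\mu}{p(\mu)}}$. Fix a subinterval $[a,b]\subset[0,R]$ ($a<b$), with $a>0$ if $\beta=0$, and let $c=\min_{t\in[a,b]}c(t)$. Cone: $K=\{u\in C[0,R]: u\ge0,\ \min_{t\in[a,b]}u(t)\ge c\|u\|\}$. For $\rho>0$, $K_\rho=\{u\in K:\|u\|<\rho\}$ and $\partial K_\rho=\{u\in K:\|u\|=\rho\}$ (boundary relative to $K$). Functional: $H:K\to[0,+\infty)$ is continuous and maps bounded sets into bounded sets. $B$ has support in $[0,R]$: for $u$ on $[0,\infty)$ whose restriction to $[0,R]$ belongs to $K$, $B[u]=H[u|_{[0,R]}]$. Membership of the restriction in $K$ is part of the meaning of the boundary condition. Constants: $\frac1m=\sup_{t\in[0,R]}\int_0^Rk(t,s)\,ds$, $\frac1M=\inf_{t\in[a,b]}\int_a^bk(t,s)\,ds$. Condition $(\mathrm I^1_\rho)$: $\frac1m\overline f_\rho+\frac1\alpha\overline H_\rho<\rho$, where $\overline f_\rho=\max_{[0,R]\times[0,\rho]}f$ and $\overline H_\rho=\sup_{u\in\partial K_\rho}H[u]$. Condition $(\mathrm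 I^0_\rho)$: $\frac1M\underline f_\rho+\frac1\alpha\underline H_\rho>\rho$, where $\underline f_\rho=\min_{[a,b]\times[c\rho,\rho]}f$ and $\underline H_\rho=\inf_{u\in\partial K_\rho}H[u]$. A solution $u$ is a $C^1$ function on $[0,\infty)$ with values in $[0,\infty)$ (the domain of $f(t,\cdot)$) such that $pu'$ is $C^1$, satisfying the equation pointwise and the stated conditions; $u(+\infty)=0$ means $\lim_{t\to+\infty}u(t)=0$. *)

theory Defs
  imports "HOL-Analysis.Analysis"
begin

text \<open>
  The space \<open>C[0,R]\<close> is rendered as the set of functions that are continuous on \<open>{0..R}\<close> and
  \<open>extensional {0..R}\<close>, so that its elements are determined by their values on \<open>{0..R}\<close> and
  \<open>restrict u {0..R}\<close> is the restriction of a function \<open>u\<close> on the half line.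

  A maximum (minimum) of a continuous function over a compact set is written \<open>SUP\<close> (\<open>INF\<close>).
  All real suprema and infima below are taken over nonempty bounded sets as soon as
  the standing assumptions on the data hold and \<open>\<rho>, d > 0\<close>, so they are genuine.
\<close>

definition C_space :: "real \<Rightarrow> (real \<Rightarrow> real) set" where
  "C_space R = {u \<in> extensional {0..R}. continuous_on {0..R} u}"

definition sup_norm :: "real \<Rightarrow> (real \<Rightarrow> real) \<Rightarrow> real" where
  "sup_norm R u = (SUP t\<in>{0..R}. \<bar>u t\<bar>)"

definition kern :: "real \<Rightarrow> real \<Rightarrow> (real \<Rightarrow> real) \<Rightarrow> real \<Rightarrow> real \<Rightarrow> real" where
  "kern \<alpha> \<beta> p t s = 1 / \<alpha> * (\<beta> / p 0 + \<alpha> * integral {0..min s t} (\<lambda>x. 1 / p x))"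

definition cone_fun :: "real \<Rightarrow> real \<Rightarrow> real \<Rightarrow> (real \<Rightarrow> real) \<Rightarrow> real \<Rightarrow> real" where
  "cone_fun R \<alpha> \<beta> p t =
     (\<beta> / p 0 + \<alpha> * integral {0..t} (\<lambda>x. 1 / p x)) /
     (\<beta> / p 0 + \<alpha> * integral {0..R} (\<lambda>x. 1 / p x))"

definition cone_const :: "real \<Rightarrow> real \<Rightarrow> real \<Rightarrow> (real \<Rightarrow> real) \<Rightarrow> real \<Rightarrow> real \<Rightarrow> real" where
  "cone_const R \<alpha> \<beta> p a b = (INF t\<in>{a..b}. cone_fun R \<alpha> \<beta> p t)"

text \<open>The cone \<open>K\<close> and the relative boundary of \<open>K\<^sub>\<rho>\<close>, for a given constant \<open>c\<close>.\<close>

definition K_cone :: "real \<Rightarrow> real \<Rightarrow> real \<Rightarrow> real \<Rightarrow> (real \<Rightarrow> real) set" where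
  "K_cone R a b c = {u \<in> C_space R.
     (\<forall>t\<in>{0..R}. 0 \<le> u t) \<and> (INF t\<in>{a..b}. u t) \<ge> c * sup_norm R u}"

definition K_sphere :: "real \<Rightarrow> real \<Rightarrow> real \<Rightarrow> real \<Rightarrow> real \<Rightarrow> (real \<Rightarrow> real) set" where
  "K_sphere R a b c \<rho> = {u \<in> K_cone R a b c. sup_norm R u = \<rho>}"

text \<open>
  \<open>H : K \<rightarrow> [0,\<infinity>)\<close> is continuous with respect to the maximum norm and maps bounded sets into
  bounded sets.
\<close>

definition admissible_functional ::
    "real \<Rightarrow> (real \<Rightarrow> real) set \<Rightarrow> ((real \<Rightarrow> real) \<Rightarrow> real) \<Rightarrow> bool" where
  "admissible_functional R K H \<longleftrightarrow>
     (\<forall>u\<in>K. 0 \<le> H u) \<and>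
     (\<forall>u\<in>K. \<forall>\<epsilon>>0. \<exists>\<delta>>0. \<forall>v\<in>K. sup_norm R (\<lambda>t. v t - u t) < \<delta> \<longrightarrow> \<bar>H v - H u\<bar> < \<epsilon>) \<and>
     (\<forall>S\<subseteq>K. (\<exists>r. \<forall>u\<in>S. sup_norm R u \<le> r) \<longrightarrow> bounded (H ` S))"

definition m_const :: "real \<Rightarrow> real \<Rightarrow> real \<Rightarrow> (real \<Rightarrow> real) \<Rightarrow> real" where
  "m_const R \<alpha> \<beta> p = 1 / (SUP t\<in>{0..R}. integral {0..R} (\<lambda>s. kern \<alpha> \<beta> p t s))"

definition M_const :: "real \<Rightarrow> real \<Rightarrow> (real \<Rightarrow> real) \<Rightarrow> real \<Rightarrow> real \<Rightarrow> real" where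
  "M_const \<alpha> \<beta> p a b = 1 / (INF t\<in>{a..b}. integral {a..b} (\<lambda>s. kern \<alpha> \<beta> p t s))"

definition cond_I1 :: "real \<Rightarrow> real \<Rightarrow> real \<Rightarrow> (real \<Rightarrow> real) \<Rightarrow> (real \<Rightarrow> real \<Rightarrow> real) \<Rightarrow>
    ((real \<Rightarrow> real) \<Rightarrow> real) \<Rightarrow> real \<Rightarrow> real \<Rightarrow> real \<Rightarrow> bool" where
  "cond_I1 R \<alpha> \<beta> p f H a b \<rho> \<longleftrightarrow>
     1 / m_const R \<alpha> \<beta> p * (SUP (t, v)\<in>{0..R} \<times> {0..\<rho>}. f t v)
       + 1 / \<alpha> * (SUP u\<in>K_sphere R a b (cone_const R \<alpha> \<beta> p a b) \<rho>. H u) < \<rho>"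

definition cond_I0 :: "real \<Rightarrow> real \<Rightarrow> real \<Rightarrow> (real \<Rightarrow> real) \<Rightarrow> (real \<Rightarrow> real \<Rightarrow> real) \<Rightarrow>
    ((real \<Rightarrow> real) \<Rightarrow> real) \<Rightarrow> real \<Rightarrow> real \<Rightarrow> real \<Rightarrow> bool" where
  "cond_I0 R \<alpha> \<beta> p f H a b \<rho> \<longleftrightarrow>
     1 / M_const \<alpha> \<beta> p a b *
         (INF (t, v)\<in>{a..b} \<times> {cone_const R \<alpha> \<beta> p a b * \<rho>..\<rho>}. f t v)
       + 1 / \<alpha> * (INF u\<in>K_sphere R a b (cone_const R \<alpha> \<beta> p a b) \<rho>. H u) > \<rho>"

text \<open>\<open>g\<close> is of class \<open>C\<^sup>1\<close> on \<open>S\<close> with derivative \<open>g'\<close>, one-sided at end points of \<open>S\<close>.\<close>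

definition C1_deriv :: "real set \<Rightarrow> (real \<Rightarrow> real) \<Rightarrow> (real \<Rightarrow> real) \<Rightarrow> bool" where
  "C1_deriv S g g' \<longleftrightarrow>
     (\<forall>t\<in>S. (g has_real_derivative g' t) (at t within S)) \<and> continuous_on S g'"

definition growth_fun :: "(real \<Rightarrow> real) \<Rightarrow> bool" where
  "growth_fun F \<longleftrightarrow>
     F \<in> {0..} \<rightarrow> {0..} \<and> mono_on {0..} F \<and> (\<exists>F'. C1_deriv {0..} F F') \<and>
     F 0 = 0 \<and> (\<forall>v>0. F v > 0) \<and> Limsup (at_right 0) (\<lambda>v. ereal (F v / v)) < \<infinity>"

definition slope_sup :: "(real \<Rightarrow> real) \<Rightarrow> real \<Rightarrow> real" where
  "slope_sup F d = (SUP v\<in>{0<..d}. F v / v)"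

text \<open>The condition \<open>(\<ast>)\<close> for given \<open>n\<close> and \<open>d\<close>; the exponent \<open>n\<close> is real.\<close>

definition star_cond :: "real \<Rightarrow> (real \<Rightarrow> real) \<Rightarrow> (real \<Rightarrow> real) \<Rightarrow> (real \<Rightarrow> real) \<Rightarrow>
    (real \<Rightarrow> real) \<Rightarrow> (real \<Rightarrow> real) \<Rightarrow> real \<Rightarrow> real \<Rightarrow> bool" where
  "star_cond R p b\<^sub>1 b\<^sub>2 F\<^sub>1 F\<^sub>2 n d \<longleftrightarrow>
     integral {R..} (\<lambda>t. max 0 (- b\<^sub>1 t))
       \<le> ln 2 / (slope_sup F\<^sub>1 d * integral {R..} (\<lambda>t. 1 / p t)) \<and>
     (\<forall>t\<ge>R. p t \<ge> t powr n \<and>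
            b\<^sub>2 t \<le> (n - 1)\<^sup>2 / (4 * slope_sup F\<^sub>2 d) * t powr (n - 2))"

text \<open>
  Non-negative solutions of the boundary value problem. The functions \<open>u'\<close> and \<open>w\<close> are the
  derivatives of \<open>u\<close> and of \<open>p u'\<close>. The condition that the restriction of \<open>u\<close> belongs to \<open>K\<close>
  is part of the boundary condition \<open>\<alpha> u(0) - \<beta> u'(0) = B[u] = H[u|\<^bsub>[0,R]\<^esub>]\<close>.
\<close>

definition bvp_solution :: "real \<Rightarrow> real \<Rightarrow> real \<Rightarrow> (real \<Rightarrow> real) \<Rightarrow> (real \<Rightarrow> real \<Rightarrow> real) \<Rightarrow>
    (real \<Rightarrow> real) set \<Rightarrow> ((real \<Rightarrow> real) \<Rightarrow> real) \<Rightarrow> (real \<Rightarrow> real) \<Rightarrow> bool" where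
  "bvp_solution R \<alpha> \<beta> p f K H u \<longleftrightarrow>
     (\<forall>t\<ge>0. 0 \<le> u t) \<and>
     (\<exists>u' w. C1_deriv {0..} u u' \<and>
             C1_deriv {0..} (\<lambda>t. p t * u' t) w \<and>
             (\<forall>t\<ge>0. w t + f t (u t) = 0) \<and>
             restrict u {0..R} \<in> K \<and>
             \<alpha> * u 0 - \<beta> * u' 0 = H (restrict u {0..R})) \<and>
     (u \<longlongrightarrow> 0) at_top"

end

theory Submission
  imports Defs "HOL-Complex_Analysis.Great_Picard"
begin

text \<open>
  On \<open>[0,R]\<close> the equation with \<open>u'(R) = 0\<close> and the functional boundary condition at \<open>0\<close> is the fixed
  point equation \<open>T u = u\<close> for \<open>T u = H u / \<alpha> + \<integral> k(\<cdot>,s) f(s,u(s)) ds\<close> on the cone \<open>K\<close>. Condition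
  \<open>(I\<^sup>1)\<close> gives \<open>\<parallel>T u\<parallel> < \<parallel>u\<parallel>\<close> and \<open>(I\<^sup>0)\<close> gives \<open>\<parallel>T u\<parallel> > \<parallel>u\<parallel>\<close> on the sphere of radius \<open>\<rho>\<close>,
  so Krasnoselskii's theorem, deduced from Schauder's, yields a fixed point \<open>v\<close> with norm
  strictly between the two radii.
  As \<open>v\<close> is nondecreasing, \<open>v(R) = \<parallel>v\<parallel> > 0\<close>. On \<open>[R,\<infinity>)\<close> one continues with a solution that has the
  initial values \<open>u(R) = v(R)\<close>, \<open>u'(R) = 0\<close>: it stays positive by comparison with an Euler equation
  (bound on \<open>b\<^sub>2\<close>), below \<open>2 v(R)\<close> by Gronwall's argument (bound on \<open>B\<^sub>1\<^sup>-\<close>), and tends to \<open>0\<close> since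
  \<open>\<integral> 1/p \<integral> b\<^sub>1\<^sup>+\<close> diverges. Both pieces have \<open>u'(R) = 0\<close>, hence they fit together.
\<close>

subsection \<open>Fixed points of compact maps in normed spaces\<close>

text \<open>Since \<open>f\<close> is only continuous, the initial value problem at \<open>R\<close>
  may have many solutions and no contraction is at hand; both pieces therefore rest on compactness.
  A continuation could also leave the domain v >= 0 or blow up. For this reason the argument of
  \<open>f\<close> is first cut off to 0 <= v <= d, which makes every continuation global; the
  estimates are proved for the modified equation and then show that the cut-off is inactive. The
  constants in \<open>star_cond\<close> originate here: log 2 turns the growth factor exp(M B P)
  into 2, hence d = 2 \<rho>, and (n - 1)^2 / 4 is the largest value of \<kappa> (n - 1 - \<kappa>),
  the coefficient for which the Euler equation has a positive power as solution. Two solutions are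
  told apart by their values at \<open>R\<close>: the strict inequalities exclude fixed points on
  the spheres, so the common radius of two adjacent annuli separates these values.\<close>

lemma tendsto_coordinatewise:
  fixes f :: "'c \<Rightarrow> 'i \<Rightarrow> 'b::topological_space"
  assumes "\<And>i. ((\<lambda>c. f c i) \<longlongrightarrow> l i) F"
  shows "(f \<longlongrightarrow> l) F"
  using assms limitin_componentwise[of "\<lambda>_. euclidean" UNIV f l F]
  by (simp add: euclidean_product_topology)

text \<open>The cube of dimension \<open>n\<close>, padded with zeros in the product space of real
  sequences. In Schauder's proof the dimension is the size of a finite net, a number found inside
  the proof, so it has to be a term and cannot be carried by a type.\<close>

definition unit_cube :: "nat \<Rightarrow> (nat \<Rightarrow> real) set" where
  "unit_cube n = {x. (\<forall>i<n. 0 \<le> x i \<and> x i \<le> 1) \<and> (\<forall>i\<ge>n. x i = 0)}"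

lemma compact_unit_cube: "compact (unit_cube n)"
proof -
  have "unit_cube n = PiE UNIV (\<lambda>i. if i < n then {0..1} else {0})"
    by (force simp: unit_cube_def PiE_UNIV_domain Pi_iff not_less split: if_splits)
  moreover have "compactin (product_topology (\<lambda>i. euclidean) UNIV)
      (PiE (UNIV :: nat set) (\<lambda>i. if i < n then {0..1::real} else {0}))"
    by (auto simp: compactin_PiE)
  ultimately show ?thesis
    by (simp add: euclidean_product_topology)
qed

text \<open>Kuhn's combinatorial argument: on a grid of mesh \<open>1 / Suc p\<close> a label
  records for each coordinate whether \<open>g\<close> pushes up or down. A cell that shows both
  labels in every coordinate is nearly fixed, and at a limit point of such cells the two
  inequalities become an equality.\<close>

lemma brouwer_unit_cube:
  assumes cont: "continuous_on (unit_cube n) g"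
    and g: "\<And>x. x \<in> unit_cube n \<Longrightarrow> g x \<in> unit_cube n"
  obtains x where "x \<in> unit_cube n" "g x = x"
proof -
  define sc where "sc p x = (\<lambda>i. if i < n then real (x i) / real (Suc p) else 0)" for p and x :: "nat \<Rightarrow> nat"
  have sc: "sc p x \<in> unit_cube n" if "\<forall>i<n. x i \<le> Suc p" for p x
    using that by (auto simp: sc_def unit_cube_def)
  have "\<exists>X. X \<in> unit_cube n \<and> (\<forall>i<n. \<exists>r\<in>unit_cube n. \<exists>s\<in>unit_cube n.
      (\<forall>j. \<bar>r j - X j\<bar> \<le> 1 / Suc p) \<and> (\<forall>j. \<bar>s j - X j\<bar> \<le> 1 / Suc p) \<and>
      r i \<le> g r i \<and> g s i \<le> s i)" for p
  proof -
    \<comment> \<open>Kuhn's lemma prescribes the labels on the faces 0 and \<open>Suc p\<close>;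
      they stay truthful because \<open>g\<close> maps the cube into itself and cannot push outwards
      there.\<close>
    define lab where "lab x i = (if x i = 0 then 0 else if x i = Suc p then 1
        else if sc p x i \<le> g (sc p x) i then 0 else 1 :: nat)" for x :: "nat \<Rightarrow> nat" and i
    have lab0: "sc p x i \<le> g (sc p x) i" if "\<forall>i<n. x i \<le> Suc p" "i < n" "lab x i = 0" for x i
      using that g[OF sc[OF that(1)]]
      by (auto simp: lab_def sc_def unit_cube_def split: if_splits)
    have lab1: "g (sc p x) i \<le> sc p x i" if "\<forall>i<n. x i \<le> Suc p" "i < n" "lab x i \<noteq> 0" for x i
      using that g[OF sc[OF that(1)]]
      by (auto simp: lab_def sc_def unit_cube_def split: if_splits)
    obtain q where q: "\<forall>i<n. q i < Suc p"
      and rs: "\<forall>i<n. \<exists>r s. (\<forall>j<n. q j \<le> r j \<and> r j \<le> q j + 1) \<and>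
        (\<forall>j<n. q j \<le> s j \<and> s j \<le> q j + 1) \<and> lab r i \<noteq> lab s i"
      by (rule kuhn_lemma[of "Suc p" n lab]) (auto simp: lab_def)
    have near: "\<bar>sc p x j - sc p q j\<bar> \<le> 1 / Suc p" if "\<forall>j<n. q j \<le> x j \<and> x j \<le> q j + 1" for x j
    proof (cases "j < n")
      case True
      then have "\<bar>real (x j) - real (q j)\<bar> \<le> 1"
        using that by (metis abs_of_nonneg diff_ge_0_iff_ge diff_le_eq of_nat_1 of_nat_add of_nat_le_iff add.commute)
      then show ?thesis
        using True by (simp add: sc_def diff_divide_distrib[symmetric] divide_right_mono)
    qed (simp add: sc_def)
    have "\<exists>r\<in>unit_cube n. \<exists>s\<in>unit_cube n.
      (\<forall>j. \<bar>r j - sc p q j\<bar> \<le> 1 / Suc p) \<and> (\<forall>j. \<bar>s j - sc p q j\<bar> \<le> 1 / Suc p) \<and>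
      r i \<le> g r i \<and> g s i \<le> s i" if "i < n" for i
    proof -
      obtain r s where r: "\<forall>j<n. q j \<le> r j \<and> r j \<le> q j + 1"
        and s: "\<forall>j<n. q j \<le> s j \<and> s j \<le> q j + 1" and ne: "lab r i \<noteq> lab s i"
        using rs \<open>i < n\<close> by blast
      have r': "\<forall>j<n. r j \<le> Suc p" and s': "\<forall>j<n. s j \<le> Suc p"
        using r s q by (force simp: Suc_le_eq)+
      show ?thesis
      proof (cases "lab r i = 0")
        case True
        then show ?thesis
          using ne near[OF r] near[OF s] sc[OF r'] sc[OF s'] lab0[OF r' \<open>i < n\<close>] lab1[OF s' \<open>i < n\<close>]
          by (intro bexI[of _ "sc p r"] bexI[of _ "sc p s"]) auto
      next
        case False
        then have "lab s i = 0"
          using ne by (auto simp: lab_def split: if_splits)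
        with False show ?thesis
          using near[OF r] near[OF s] sc[OF r'] sc[OF s'] lab0[OF s' \<open>i < n\<close>] lab1[OF r' \<open>i < n\<close>]
          by (intro bexI[of _ "sc p s"] bexI[of _ "sc p r"]) auto
      qed
    qed
    moreover have "sc p q \<in> unit_cube n"
      using q by (intro sc) (auto simp: less_imp_le)
    ultimately show ?thesis by blast
  qed
  then have "\<exists>X. \<forall>p. X p \<in> unit_cube n \<and> (\<forall>i<n. \<exists>r\<in>unit_cube n. \<exists>s\<in>unit_cube n.
      (\<forall>j. \<bar>r j - X p j\<bar> \<le> 1 / Suc p) \<and> (\<forall>j. \<bar>s j - X p j\<bar> \<le> 1 / Suc p) \<and>
      r i \<le> g r i \<and> g s i \<le> s i)"
    by (intro choice) blast
  then obtain X where X: "\<And>p. X p \<in> unit_cube n"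
    and X': "\<And>p i. i < n \<Longrightarrow> \<exists>r\<in>unit_cube n. \<exists>s\<in>unit_cube n.
      (\<forall>j. \<bar>r j - X p j\<bar> \<le> 1 / Suc p) \<and> (\<forall>j. \<bar>s j - X p j\<bar> \<le> 1 / Suc p) \<and>
      r i \<le> g r i \<and> g s i \<le> s i"
    by blast
  obtain x k where x: "x \<in> unit_cube n" and k: "strict_mono (k :: nat \<Rightarrow> nat)" and lim: "(X \<circ> k) \<longlonglongrightarrow> x"
    using compact_imp_seq_compact[OF compact_unit_cube, of n] X unfolding seq_compact_def by metis
  have lim0: "(\<lambda>m. 1 / real (Suc (k m))) \<longlonglongrightarrow> 0"
    using LIMSEQ_subseq_LIMSEQ[OF LIMSEQ_inverse_real_of_nat k]
    unfolding o_def inverse_eq_divide .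
  have coord: "(\<lambda>m. X (k m) j) \<longlonglongrightarrow> x j" for j
    using continuous_on_tendsto_compose[OF continuous_on_product_coordinates lim, of j] by (simp add: o_def)
  \<comment> \<open>The witnesses depend on the coordinate, but all lie within one mesh width of
    \<open>X (k m)\<close>. So they share its limit \<open>x\<close>, and the inequalities
    survive.\<close>
  have perturb: "(\<lambda>m. g (r m) i) \<longlonglongrightarrow> g x i" "(\<lambda>m. r m i) \<longlonglongrightarrow> x i"
    if r: "\<And>m. r m \<in> unit_cube n" "\<And>m j. \<bar>r m j - X (k m) j\<bar> \<le> 1 / Suc (k m)" for r i
  proof -
    have "(\<lambda>m. r m j - X (k m) j) \<longlonglongrightarrow> 0" for j
      by (rule Lim_null_comparison[OF _ lim0]) (use r in auto)
    then have j: "(\<lambda>m. r m j) \<longlonglongrightarrow> x j" for j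
      using tendsto_add[OF _ coord[of j], of "\<lambda>m. r m j - X (k m) j" 0] by simp
    then have "r \<longlonglongrightarrow> x"
      by (rule tendsto_coordinatewise)
    then have "(\<lambda>m. g (r m)) \<longlonglongrightarrow> g x"
      by (rule continuous_on_tendsto_compose[OF cont _ x]) (simp add: r)
    then show "(\<lambda>m. g (r m) i) \<longlonglongrightarrow> g x i"
      using continuous_on_tendsto_compose[OF continuous_on_product_coordinates, of _ "g x" sequentially i] by auto
    show "(\<lambda>m. r m i) \<longlonglongrightarrow> x i" by (rule j)
  qed
  have "g x i = x i" for i
  proof (cases "i < n")
    case True
    have "\<exists>r. \<forall>m. r m \<in> unit_cube n \<and> (\<forall>j. \<bar>r m j - X (k m) j\<bar> \<le> 1 / Suc (k m)) \<and> r m i \<le> g (r m) i"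
      using X'[OF True] by (intro choice) blast
    then obtain r where r: "\<And>m. r m \<in> unit_cube n" "\<And>m j. \<bar>r m j - X (k m) j\<bar> \<le> 1 / Suc (k m)"
      "\<And>m. r m i \<le> g (r m) i"
      by blast
    have "\<exists>s. \<forall>m. s m \<in> unit_cube n \<and> (\<forall>j. \<bar>s m j - X (k m) j\<bar> \<le> 1 / Suc (k m)) \<and> g (s m) i \<le> s m i"
      using X'[OF True] by (intro choice) blast
    then obtain s where s: "\<And>m. s m \<in> unit_cube n" "\<And>m j. \<bar>s m j - X (k m) j\<bar> \<le> 1 / Suc (k m)"
      "\<And>m. g (s m) i \<le> s m i"
      by blast
    have "x i \<le> g x i"
      by (rule LIMSEQ_le[OF perturb(2)[of r] perturb(1)[of r]]) (use r in auto)
    moreover have "g x i \<le> x i"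
      by (rule LIMSEQ_le[OF perturb(1)[of s] perturb(2)[of s]]) (use s in auto)
    ultimately show ?thesis by simp
  next
    case False
    then show ?thesis
      using x g[OF x] by (auto simp: unit_cube_def)
  qed
  with x show ?thesis
    by (intro that) auto
qed

text \<open>Schauder projection onto a finite net of the image. Brouwer's theorem is applied to the
  induced map on the weights of the net points, so that the finite-dimensional problem lives on a
  cube. The compact set \<open>C\<close> only has to contain the image; the cone theorems below
  choose one that leaves \<open>S\<close>.\<close>

theorem schauder:
  fixes T :: "'a::real_normed_vector \<Rightarrow> 'a"
  assumes S: "convex S" "closed S" "S \<noteq> {}" and cont: "continuous_on S T"
    and T: "\<And>x. x \<in> S \<Longrightarrow> T x \<in> S" and C: "compact C" "\<And>x. x \<in> S \<Longrightarrow> T x \<in> C"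
  obtains x where "x \<in> S" "T x = x"
proof -
  have approx: "\<exists>x\<in>S. dist (T x) x \<le> \<epsilon>" if "\<epsilon> > 0" for \<epsilon>
  proof -
    define D where "D = closure (T ` S)"
    have "compact D"
      unfolding D_def using C by (metis closure_minimal compact_Int_closed compact_imp_closed closed_closure image_subsetI inf.absorb_iff2)
    moreover have "D \<subseteq> (\<Union>y\<in>T ` S. ball y \<epsilon>)"
    proof
      fix z assume "z \<in> D"
      then obtain y where "y \<in> T ` S" "dist y z < \<epsilon>"
        unfolding D_def using \<open>\<epsilon> > 0\<close> by (meson closure_approachable)
      then show "z \<in> (\<Union>y\<in>T ` S. ball y \<epsilon>)" by auto
    qed
    ultimately obtain Y where Y: "Y \<subseteq> T ` S" "finite Y" "D \<subseteq> (\<Union>y\<in>Y. ball y \<epsilon>)"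
      using compactE_image[of D "T ` S" "\<lambda>y. ball y \<epsilon>"] by (metis open_ball)
    obtain n y where Yy: "Y = y ` {i. i < (n::nat)}"
      using \<open>finite Y\<close> by (metis finite_imp_nat_seg_image_inj_on)
    have yS: "y i \<in> S" if "i < n" for i
      using Y Yy T that by auto
    obtain y0 where "y0 \<in> S" using S by auto
    \<comment> \<open>Schauder's weights: only net points closer than \<epsilon> to \<open>z\<close>
      count.\<close>
    define m where "m i z = max 0 (\<epsilon> - dist (y i) z)" for i z
    have m0: "m i z \<ge> 0" for i z by (simp add: m_def)
    have mpos: "(\<Sum>i<n. m i (T z)) > 0" if "z \<in> S" for z
    proof -
      have "T z \<in> D" using that closure_subset[of "T ` S"] by (auto simp: D_def)
      then obtain i where "i < n" "dist (y i) (T z) < \<epsilon>" using Y Yy by auto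
      then show ?thesis
        by (intro sum_pos2[of _ i]) (auto simp: m_def)
    qed
    define s where "s x = (\<Sum>i<n. x i)" for x :: "nat \<Rightarrow> real"
    \<comment> \<open>On the cube the weights need not sum to 1. Division by
      \<open>max 1 (s x)\<close> brings the sum to at most 1, and \<open>y0\<close> takes the
      remaining weight; where the sum is exactly 1 this is the plain combination of the net
      points.\<close>
    define E where "E x = (\<Sum>i<n. (x i / max 1 (s x)) *\<^sub>R y i) + (1 - s x / max 1 (s x)) *\<^sub>R y0" for x
    have s0: "s x \<ge> 0" if "x \<in> unit_cube n" for x
      using that by (auto simp: s_def unit_cube_def intro!: sum_nonneg)
    have ES: "E x \<in> S" if x: "x \<in> unit_cube n" for x
    proof -
      define w where "w i = (if i < n then x i / max 1 (s x) else 1 - s x / max 1 (s x))" for i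
      have sw: "(\<Sum>i<n. w i) = s x / max 1 (s x)"
        by (simp add: w_def s_def sum_divide_distrib)
      have "(\<Sum>i\<in>{..<Suc n}. w i *\<^sub>R (if i < n then y i else y0)) \<in> S"
      proof (rule convex_sum)
        show "sum w {..<Suc n} = 1"
          using sw by (simp add: w_def)
        show "0 \<le> w i" if "i \<in> {..<Suc n}" for i
          using x s0[OF x] by (auto simp: w_def unit_cube_def divide_simps)
      qed (use S yS \<open>y0 \<in> S\<close> in auto)
      also have "(\<Sum>i\<in>{..<Suc n}. w i *\<^sub>R (if i < n then y i else y0)) = E x"
        by (simp add: E_def w_def)
      finally show ?thesis .
    qed
    have coordc: "continuous_on A (\<lambda>x. x i)" for A :: "(nat \<Rightarrow> real) set" and i
      by (rule continuous_on_subset[OF continuous_on_product_coordinates]) auto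
    have contE: "continuous_on (unit_cube n) E"
      unfolding E_def s_def by (intro continuous_intros coordc) auto
    have contTE: "continuous_on (unit_cube n) (\<lambda>x. T (E x))"
      by (rule continuous_on_compose2[OF cont contE]) (use ES in auto)
    define g where "g x = (\<lambda>i. if i < n then m i (T (E x)) / (\<Sum>j<n. m j (T (E x))) else 0)" for x
    have gcont: "continuous_on (unit_cube n) g"
    proof (rule continuous_on_coordinatewise_then_product)
      fix i
      show "continuous_on (unit_cube n) (\<lambda>x. g x i)"
      proof (cases "i < n")
        case True
        have "(\<Sum>j<n. m j (T (E x))) \<noteq> 0" if "x \<in> unit_cube n" for x
          using mpos[OF ES[OF that]] by simp
        then show ?thesis
          unfolding g_def m_def using True
          by (simp, intro continuous_intros contTE) auto
      qed (simp add: g_def)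
    qed
    have gsum: "(\<Sum>i<n. g x i) = 1" if "x \<in> unit_cube n" for x
      using mpos[OF ES[OF that]] by (simp add: g_def sum_divide_distrib[symmetric])
    have gcube: "g x \<in> unit_cube n" if "x \<in> unit_cube n" for x
    proof -
      have "0 \<le> g x i" for i
        using mpos[OF ES[OF that]] m0 by (simp add: g_def)
      moreover from this have "g x i \<le> 1" if "i < n" for i
        using gsum[OF \<open>x \<in> unit_cube n\<close>] member_le_sum[of i "{..<n}" "g x"] that by auto
      ultimately show ?thesis
        by (simp add: unit_cube_def) (simp add: g_def)
    qed
    obtain x where x: "x \<in> unit_cube n" "g x = x"
      using brouwer_unit_cube[OF gcont gcube] by blast
    \<comment> \<open>The coordinates of every value of \<open>g\<close> sum to 1, hence so do those
      of the fixed point, and \<open>y0\<close> disappears from \<open>E x\<close>.\<close>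
    have sx: "s x = 1"
      using gsum[OF x(1)] x(2) by (simp add: s_def)
    have Ex: "E x = (\<Sum>i<n. x i *\<^sub>R y i)"
      by (simp add: E_def sx)
    have "E x - T (E x) = (\<Sum>i<n. x i *\<^sub>R (y i - T (E x)))"
      using sx by (simp add: Ex s_def scaleR_diff_right sum_subtractf scaleR_left.sum[symmetric])
    also have "norm \<dots> \<le> (\<Sum>i<n. x i * \<epsilon>)"
    proof (rule sum_norm_le)
      fix i assume "i \<in> {..<n}"
      then have xi: "x i = m i (T (E x)) / (\<Sum>j<n. m j (T (E x)))"
        by (subst x(2)[symmetric]) (simp add: g_def)
      have "0 \<le> x i" using x \<open>i \<in> {..<n}\<close> by (auto simp: unit_cube_def)
      moreover have "norm (y i - T (E x)) \<le> \<epsilon> \<or> x i = 0"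
        using xi by (auto simp: m_def dist_norm max_def)
      ultimately show "norm (x i *\<^sub>R (y i - T (E x))) \<le> x i * \<epsilon>"
        by (auto simp: mult_left_mono)
    qed
    also have "\<dots> = \<epsilon>"
      using sx by (simp add: s_def sum_distrib_right[symmetric])
    finally show ?thesis
      using ES[OF x(1)] by (intro bexI[of _ "E x"]) (auto simp: dist_norm norm_minus_commute)
  qed
  have "\<forall>k. \<exists>x\<in>S. dist (T x) x \<le> inverse (real (Suc k))"
    using approx by simp
  then obtain x where xS: "\<And>k. x k \<in> S" and xd: "\<And>k. dist (T (x k)) (x k) \<le> inverse (real (Suc k))"
    by metis
  obtain z k where "z \<in> C" and k: "strict_mono (k :: nat \<Rightarrow> nat)" and lim: "((\<lambda>j. T (x j)) \<circ> k) \<longlonglongrightarrow> z"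
    using compact_imp_seq_compact[OF C(1)] C(2) xS unfolding seq_compact_def by metis
  \<comment> \<open>Along the subsequence the images converge and their distance to the points tends
    to 0, so the points have the same limit.\<close>
  have "(\<lambda>j. x (k j) - T (x (k j))) \<longlonglongrightarrow> 0"
  proof (rule Lim_null_comparison)
    show "(\<lambda>j. inverse (real (Suc (k j)))) \<longlonglongrightarrow> 0"
      using LIMSEQ_subseq_LIMSEQ[OF LIMSEQ_inverse_real_of_nat k] unfolding o_def .
  qed (use xd in \<open>simp add: dist_norm norm_minus_commute\<close>)
  from tendsto_add[OF this lim[unfolded o_def]] have lx: "(\<lambda>j. x (k j)) \<longlonglongrightarrow> z"
    by simp
  have "z \<in> S"
    by (rule closed_sequentially[OF S(2) _ lx]) (rule xS)
  then have "(\<lambda>j. T (x (k j))) \<longlonglongrightarrow> T z"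
    by (intro continuous_on_tendsto_compose[OF cont lx]) (simp_all add: xS)
  then have "T z = z"
    using LIMSEQ_unique lim[unfolded o_def] by blast
  with \<open>z \<in> S\<close> show ?thesis by (rule that)
qed

text \<open>The annulus is not convex, and a radial retraction onto its inner sphere breaks down at
  0. Instead, small \<open>u\<close> are moved along \<open>e\<close> until the norm is
  \<open>r\<close>; additivity of the norm along \<open>e\<close> makes this exact. Large values of
  \<open>T\<close> are cut back to norm \<open>q\<close>, and Schauder's theorem applies on
  \<open>K \<inter> cball 0 q\<close>. The boundary conditions show that neither modification acts
  at the fixed point.\<close>

lemma krasnoselskii_expansive_inside:
  fixes T :: "'a::real_normed_vector \<Rightarrow> 'a"
  assumes K: "convex K" "closed K" "0 \<in> K" and cone: "\<And>u s. u \<in> K \<Longrightarrow> 0 \<le> s \<Longrightarrow> s *\<^sub>R u \<in> K"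
    and e: "\<And>u s. u \<in> K \<Longrightarrow> 0 \<le> s \<Longrightarrow> u + s *\<^sub>R e \<in> K"
    and norm_e: "\<And>u s. u \<in> K \<Longrightarrow> 0 \<le> s \<Longrightarrow> norm (u + s *\<^sub>R e) = norm u + s"
    and rq: "0 < r" "r < q"
    and cont: "continuous_on {u \<in> K. r \<le> norm u \<and> norm u \<le> q} T"
    and T: "\<And>u. u \<in> K \<Longrightarrow> r \<le> norm u \<Longrightarrow> norm u \<le> q \<Longrightarrow> T u \<in> K"
    and C: "compact C" "\<And>u. u \<in> K \<Longrightarrow> r \<le> norm u \<Longrightarrow> norm u \<le> q \<Longrightarrow> T u \<in> C"
    and inner: "\<And>u. u \<in> K \<Longrightarrow> norm u = r \<Longrightarrow> norm (T u) > r"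
    and outer: "\<And>u. u \<in> K \<Longrightarrow> norm u = q \<Longrightarrow> norm (T u) < q"
  obtains u where "u \<in> K" "r < norm u" "norm u < q" "T u = u"
proof -
  define S where "S = K \<inter> cball 0 q"
  define P where "P u = u + max 0 (r - norm u) *\<^sub>R e" for u
  define \<sigma> where "\<sigma> v = q / max q (norm v)" for v :: 'a
  have P: "P u \<in> K" "r \<le> norm (P u)" "norm (P u) \<le> q" if "u \<in> S" for u
    using that e[of u] norm_e[of u] rq by (auto simp: P_def S_def max_def)
  have \<sigma>: "0 \<le> \<sigma> v" "\<sigma> v \<le> 1" "norm (\<sigma> v *\<^sub>R v) = min q (norm v)" for v
    using rq by (auto simp: \<sigma>_def max_def divide_le_eq)
  have comp: "compact ((\<lambda>(s, v). s *\<^sub>R v) ` ({0..1::real} \<times> C))"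
    by (intro compact_continuous_image compact_Times C) (auto simp: case_prod_unfold intro!: continuous_intros)
  have contS: "continuous_on S (\<lambda>u. \<sigma> (T (P u)) *\<^sub>R T (P u))"
  proof -
    have "continuous_on S P"
      unfolding P_def by (intro continuous_intros)
    then have "continuous_on S (\<lambda>u. T (P u))"
      by (rule continuous_on_compose2[OF cont]) (use P in auto)
    then show ?thesis
      unfolding \<sigma>_def using rq by (intro continuous_intros) auto
  qed
  have S: "convex S" "closed S" "S \<noteq> {}"
    using K rq by (auto simp: S_def convex_Int closed_Int intro!: exI[of _ 0])
  have selfmap: "\<sigma> (T (P u)) *\<^sub>R T (P u) \<in> S" if "u \<in> S" for u
    using P[OF that] \<sigma>[of "T (P u)"] by (auto simp: S_def intro!: cone T)
  have range: "\<sigma> (T (P u)) *\<^sub>R T (P u) \<in> (\<lambda>(s, v). s *\<^sub>R v) ` ({0..1} \<times> C)" if "u \<in> S" for u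
    using P[OF that] C(2) \<sigma>[of "T (P u)"] by (intro image_eqI[of _ _ "(\<sigma> (T (P u)), T (P u))"]) auto
  obtain u where u: "u \<in> S" "\<sigma> (T (P u)) *\<^sub>R T (P u) = u"
    using schauder[OF S contS selfmap comp range] by blast
  then have nu: "norm u = min q (norm (T (P u)))"
    using \<sigma>(3)[of "T (P u)"] by simp
  \<comment> \<open>If \<open>u\<close> had been moved, \<open>P u\<close> would lie on the inner
    sphere, where \<open>T\<close> produces norm above \<open>r\<close>; cutting at
    \<open>q > r\<close> keeps it above \<open>r\<close>.\<close>
  have "r \<le> norm u"
  proof (rule ccontr)
    assume "\<not> r \<le> norm u"
    then have "norm (P u) = r"
      using u norm_e[of u "r - norm u"] by (simp add: P_def S_def)
    then show False
      using inner[OF P(1)[OF u(1)]] nu rq \<open>\<not> r \<le> norm u\<close> by auto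
  qed
  then have Pu: "P u = u"
    by (simp add: P_def)
  have uK: "u \<in> K" "norm u \<le> q"
    using u by (auto simp: S_def)
  \<comment> \<open>A genuine cut would put \<open>u\<close> on the outer sphere, where
    \<open>T u\<close> has norm below \<open>q\<close>.\<close>
  have "norm (T u) \<le> q"
  proof (rule ccontr)
    assume "\<not> norm (T u) \<le> q"
    then show False
      using nu outer[OF uK(1)] by (simp add: Pu)
  qed
  then have "T u = u"
    using u(2) rq by (simp add: Pu \<sigma>_def max_def)
  moreover from this have "norm u \<noteq> r" "norm u \<noteq> q"
    using inner[OF uK(1)] outer[OF uK(1)] by auto
  ultimately show ?thesis
    using uK \<open>r \<le> norm u\<close> by (intro that[of u]) auto
qed

text \<open>
  The inversion \<open>u \<mapsto> ((r + q - \<parallel>u\<parallel>) / \<parallel>u\<parallel>) u\<close> of the annulus exchanges its two boundary spheres, and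
  it turns fixed points of \<open>T\<close> into fixed points of the operator \<open>T'\<close> below.
\<close>

lemma krasnoselskii_compressive_inside:
  fixes T :: "'a::real_normed_vector \<Rightarrow> 'a"
  assumes K: "convex K" "closed K" "0 \<in> K" and cone: "\<And>u s. u \<in> K \<Longrightarrow> 0 \<le> s \<Longrightarrow> s *\<^sub>R u \<in> K"
    and e: "\<And>u s. u \<in> K \<Longrightarrow> 0 \<le> s \<Longrightarrow> u + s *\<^sub>R e \<in> K"
    and norm_e: "\<And>u s. u \<in> K \<Longrightarrow> 0 \<le> s \<Longrightarrow> norm (u + s *\<^sub>R e) = norm u + s"
    and rq: "0 < r" "r < q"
    and cont: "continuous_on {u \<in> K. r \<le> norm u \<and> norm u \<le> q} T"
    and T: "\<And>u. u \<in> K \<Longrightarrow> r \<le> norm u \<Longrightarrow> norm u \<le> q \<Longrightarrow> T u \<in> K"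
    and C: "compact C" "\<And>u. u \<in> K \<Longrightarrow> r \<le> norm u \<Longrightarrow> norm u \<le> q \<Longrightarrow> T u \<in> C"
    and inner: "\<And>u. u \<in> K \<Longrightarrow> norm u = r \<Longrightarrow> norm (T u) < r"
    and outer: "\<And>u. u \<in> K \<Longrightarrow> norm u = q \<Longrightarrow> norm (T u) > q"
  obtains u where "u \<in> K" "r < norm u" "norm u < q" "T u = u"
proof -
  define A where "A = {u \<in> K. r \<le> norm u \<and> norm u \<le> q}"
  define J where "J u = ((r + q - norm u) / norm u) *\<^sub>R u" for u :: 'a
  define T' where "T' u = (norm u / (r + q - norm u)) *\<^sub>R T (J u)" for u
  have norm_J: "norm (J u) = r + q - norm u" if "u \<in> A" for u
    using that rq by (auto simp: J_def A_def)
  have J: "J u \<in> A" if "u \<in> A" for u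
    using that rq norm_J[OF that] by (auto simp: A_def J_def intro!: cone)
  have scal: "0 \<le> norm u / (r + q - norm u)" "norm u / (r + q - norm u) \<le> q / r" if "u \<in> A" for u
    using that rq by (auto simp: A_def intro!: frac_le)
  have contT': "continuous_on A T'"
  proof -
    have "continuous_on A J"
      unfolding J_def by (intro continuous_intros) (use rq in \<open>auto simp: A_def\<close>)
    then have "continuous_on A (\<lambda>u. T (J u))"
      by (rule continuous_on_compose2[OF cont]) (use J in \<open>auto simp: A_def\<close>)
    then show ?thesis
      unfolding T'_def by (intro continuous_intros) (use rq in \<open>auto simp: A_def\<close>)
  qed
  \<comment> \<open>\<open>T'\<close> multiplies values of \<open>T\<close> by factors up to
    \<open>q / r\<close>, so the compact set is enlarged accordingly.\<close>
  have "compact ((\<lambda>(s, v). s *\<^sub>R v) ` ({0..q / r} \<times> C))"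
    by (intro compact_continuous_image compact_Times C) (auto simp: case_prod_unfold intro!: continuous_intros)
  note kr = krasnoselskii_expansive_inside[OF K cone e norm_e rq contT'[unfolded A_def] _ this]
  obtain u where u: "u \<in> K" "r < norm u" "norm u < q" "T' u = u"
  proof (rule kr)
    fix u assume "u \<in> K" "r \<le> norm u" "norm u \<le> q"
    then have uA: "u \<in> A" by (simp add: A_def)
    then show "T' u \<in> K"
      unfolding T'_def using J[OF uA] scal[OF uA] by (intro cone T) (auto simp: A_def)
    show "T' u \<in> (\<lambda>(s, v). s *\<^sub>R v) ` ({0..q / r} \<times> C)"
      unfolding T'_def using J[OF uA] scal[OF uA] C(2)
      by (intro image_eqI[of _ _ "(norm u / (r + q - norm u), T (J u))"]) (auto simp: A_def)
  next
    \<comment> \<open>\<open>J\<close> sends the inner sphere to the outer one, so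
      \<open>T' u\<close> is \<open>r / q\<close> times a vector of norm above
      \<open>q\<close>.\<close>
    fix u assume u: "u \<in> K" "norm u = r"
    then have "u \<in> A" using rq by (simp add: A_def)
    then have "norm (T (J u)) > q"
      using J norm_J u by (intro outer) (auto simp: A_def)
    then show "r < norm (T' u)"
      using u rq by (simp add: T'_def field_simps)
  next
    fix u assume u: "u \<in> K" "norm u = q"
    then have "u \<in> A" using rq by (simp add: A_def)
    then have "norm (T (J u)) < r"
      using J norm_J u by (intro inner) (auto simp: A_def)
    then show "norm (T' u) < q"
      using u rq by (simp add: T'_def field_simps)
  qed
  have uA: "u \<in> A" using u by (simp add: A_def)
  have "u \<noteq> 0" using u(2) rq by auto
  \<comment> \<open>Inserting \<open>u = T' u\<close> in the vector factor alone makes the two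
    scalar quotients cancel.\<close>
  have "J u = ((r + q - norm u) / norm u) *\<^sub>R T' u"
    by (simp only: J_def u(4))
  also have "\<dots> = T (J u)"
    using u(2,3) rq \<open>u \<noteq> 0\<close> by (simp add: T'_def)
  finally have "T (J u) = J u" ..
  then show ?thesis
    using J[OF uA] norm_J[OF uA] u by (intro that[of "J u"]) (auto simp: A_def)
qed

subsection \<open>Global existence for the integral equation on a half line\<close>

text \<open>Arzela-Ascoli inside a Banach space type. The clamp condition makes each function
  constant on either side of \<open>{A..B}\<close>, so the norm over the line is the norm over the
  interval, and the set models Lipschitz functions on \<open>{A..B}\<close>.\<close>

lemma compact_lipschitz_bcontfun:
  fixes A B :: real
  assumes "A \<le> B"
  shows "compact {v :: real \<Rightarrow>\<^sub>C real. (\<forall>x. v x = v (clamp A B x)) \<and>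
    (\<forall>x\<in>{A..B}. \<bar>v x\<bar> \<le> M) \<and> (\<forall>x\<in>{A..B}. \<forall>y\<in>{A..B}. \<bar>v x - v y\<bar> \<le> L * \<bar>x - y\<bar>)}" (is "compact ?S")
proof -
  have "\<exists>l\<in>?S. \<exists>k::nat \<Rightarrow> nat. strict_mono k \<and> (f \<circ> k) \<longlonglongrightarrow> l" if f: "\<And>n. f n \<in> ?S" for f
  proof -
    have L0: "\<bar>f n x - f n y\<bar> \<le> L * \<bar>x - y\<bar>" "\<bar>f n x\<bar> \<le> M" if "x \<in> {A..B}" "y \<in> {A..B}" for n x y
      using f[of n] that by auto
    obtain g k where g: "continuous_on {A..B} g" and k: "strict_mono (k :: nat \<Rightarrow> nat)"
      and lim: "\<And>\<epsilon>. 0 < \<epsilon> \<Longrightarrow> \<exists>N. \<forall>n x. n \<ge> N \<and> x \<in> {A..B} \<longrightarrow> norm (f (k n) x - g x) < \<epsilon>"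
    proof (rule Arzela_Ascoli[of "{A..B}" "\<lambda>n. apply_bcontfun (f n)" M])
      show "norm (f n x) \<le> M" if "x \<in> {A..B}" for n x
        using L0(2)[OF that that] by simp
      fix x \<epsilon> :: real assume x: "x \<in> {A..B}" "0 < \<epsilon>"
      show "\<exists>d>0. \<forall>n y. y \<in> {A..B} \<and> norm (x - y) < d \<longrightarrow> norm (f n x - f n y) < \<epsilon>"
      \<comment> \<open>The denominator is positive even if \<open>L\<close> is zero or
        negative.\<close>
      proof (intro exI[of _ "\<epsilon> / (\<bar>L\<bar> + 1)"] conjI allI impI)
        show "\<epsilon> / (\<bar>L\<bar> + 1) > 0" using x by simp
        fix n y assume y: "y \<in> {A..B} \<and> norm (x - y) < \<epsilon> / (\<bar>L\<bar> + 1)"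
        have "\<bar>f n x - f n y\<bar> \<le> L * \<bar>x - y\<bar>"
          using L0 x y by blast
        also have "\<dots> \<le> (\<bar>L\<bar> + 1) * \<bar>x - y\<bar>"
          by (intro mult_right_mono) auto
        also have "\<dots> < \<epsilon>"
          using y by (simp add: field_simps)
        finally show "norm (f n x - f n y) < \<epsilon>" by simp
      qed
    qed auto
    obtain l where l: "\<And>x. x \<in> cbox A B \<Longrightarrow> apply_bcontfun l x = g x" "\<And>x. apply_bcontfun l x = g (clamp A B x)"
      using continuous_on_cbox_bcontfunE[of A B g] g by auto
    have clamp: "clamp A B x \<in> {A..B}" for x
      using clamp_in_interval[of A B x] assms by auto
    have ul: "uniform_limit UNIV (\<lambda>n. apply_bcontfun (f (k n))) l sequentially"
    proof (rule uniform_limitI)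
      fix \<epsilon> :: real assume "\<epsilon> > 0"
      from lim[OF this] obtain N where N: "\<And>n x. n \<ge> N \<Longrightarrow> x \<in> {A..B} \<Longrightarrow> norm (f (k n) x - g x) < \<epsilon>"
        by blast
      have "dist (f (k n) x) (l x) < \<epsilon>" if "n \<ge> N" for n x
      proof -
        have "f (k n) x = f (k n) (clamp A B x)"
          using f[of "k n"] by blast
        then show ?thesis
          using N[OF that clamp[of x]] l(2)[of x] by (simp add: dist_norm)
      qed
      then show "\<forall>\<^sub>F n in sequentially. \<forall>x\<in>UNIV. dist (f (k n) x) (l x) < \<epsilon>"
        by (auto simp: eventually_sequentially)
    qed
    have pt: "(\<lambda>n. f (k n) x) \<longlonglongrightarrow> l x" for x
      by (rule tendsto_uniform_limitI[OF ul]) simp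
    have "l \<in> ?S"
    proof (intro CollectI conjI allI ballI)
      show "l x = l (clamp A B x)" for x
        using l(1)[of "clamp A B x"] l(2)[of x] clamp[of x] by simp
      show "\<bar>l x\<bar> \<le> M" if "x \<in> {A..B}" for x
        by (rule LIMSEQ_le_const2[OF tendsto_rabs[OF pt]]) (use L0(2)[OF that that] in auto)
      show "\<bar>l x - l y\<bar> \<le> L * \<bar>x - y\<bar>" if "x \<in> {A..B}" "y \<in> {A..B}" for x y
        by (rule LIMSEQ_le_const2[OF tendsto_rabs[OF tendsto_diff[OF pt pt]]]) (use L0(1)[OF that] in auto)
    qed
    moreover have "(f \<circ> k) \<longlonglongrightarrow> l"
      using uniform_limit_tendsto_bcontfun[OF ul] by (simp add: o_def)
    ultimately show ?thesis using k by blast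
  qed
  then show ?thesis
    unfolding compact_eq_seq_compact_metric seq_compact_def by blast
qed

section \<open>Calculus on half lines and the Volterra equation\<close>

lemma at_within_half_line:
  fixes t :: real
  assumes "A \<le> t"
  shows "at t within {A..} = at t within {A..t + 1}"
  by (rule at_within_nhd[of t "{..<t + 1}"]) auto

lemma continuous_on_half_lineI:
  fixes u :: "real \<Rightarrow> 'a::topological_space"
  assumes "\<And>B. continuous_on {A..B} u"
  shows "continuous_on {A..} u"
  using assms by (auto simp: continuous_on_eq_continuous_within at_within_half_line)

lemma integral_half_line_deriv:
  fixes g :: "real \<Rightarrow> real"
  assumes "continuous_on {A..} g" "A \<le> t"
  shows "((\<lambda>x. integral {A..x} g) has_real_derivative g t) (at t within {A..})"
  unfolding at_within_half_line[OF assms(2)]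
  by (rule integral_has_real_derivative) (use assms in \<open>auto intro: continuous_on_subset\<close>)

lemma lipschitz_integral:
  fixes h :: "real \<Rightarrow> real"
  assumes h: "continuous_on {A..B} h" "\<And>x. x \<in> {A..B} \<Longrightarrow> \<bar>h x\<bar> \<le> C" and xy: "x \<in> {A..B}" "y \<in> {A..B}"
  shows "\<bar>integral {A..x} h - integral {A..y} h\<bar> \<le> C * \<bar>x - y\<bar>"
proof -
  have *: "\<bar>integral {A..x} h - integral {A..y} h\<bar> \<le> C * \<bar>x - y\<bar>"
    if "y \<le> x" "x \<in> {A..B}" "y \<in> {A..B}" for x y
  proof -
    have "integral {A..y} h + integral {y..x} h = integral {A..x} h"
      using that h(1) by (intro Henstock_Kurzweil_Integration.integral_combine integrable_continuous_real)
        (auto intro: continuous_on_subset)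
    moreover have "norm (integral {y..x} h) \<le> C * (x - y)"
      using that h by (intro integral_bound) (auto intro: continuous_on_subset)
    ultimately show ?thesis using that by simp
  qed
  show ?thesis
    using *[of x y] *[of y x] xy by (cases "y \<le> x") (auto simp: abs_minus_commute)
qed

lemma uniformly_continuous_second_arg:
  fixes g :: "real \<Rightarrow> real \<Rightarrow> real"
  assumes "continuous_on ({A..B} \<times> {lo..hi}) (\<lambda>(t, v). g t v)" "\<epsilon> > 0"
  obtains \<delta> where "\<delta> > 0" "\<And>t v w. t \<in> {A..B} \<Longrightarrow> v \<in> {lo..hi} \<Longrightarrow> w \<in> {lo..hi} \<Longrightarrow> \<bar>v - w\<bar> < \<delta> \<Longrightarrow>
    \<bar>g t v - g t w\<bar> < \<epsilon>"
proof -
  have "uniformly_continuous_on ({A..B} \<times> {lo..hi}) (\<lambda>(t, v). g t v)"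
    by (intro compact_uniformly_continuous assms compact_Times) auto
  then obtain \<delta> where "\<delta> > 0" and \<delta>: "\<And>x x'. x \<in> {A..B} \<times> {lo..hi} \<Longrightarrow> x' \<in> {A..B} \<times> {lo..hi} \<Longrightarrow>
      dist x' x < \<delta> \<Longrightarrow> dist (case x' of (t, v) \<Rightarrow> g t v) (case x of (t, v) \<Rightarrow> g t v) < \<epsilon>"
    using \<open>\<epsilon> > 0\<close> unfolding uniformly_continuous_on_def by metis
  show ?thesis
  proof (rule that[OF \<open>\<delta> > 0\<close>])
    fix t v w assume "t \<in> {A..B}" "v \<in> {lo..hi}" "w \<in> {lo..hi}" "\<bar>v - w\<bar> < \<delta>"
    then show "\<bar>g t v - g t w\<bar> < \<epsilon>"
      using \<delta>[of "(t, w)" "(t, v)"] by (simp add: dist_Pair_Pair dist_real_def)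
  qed
qed

text \<open>
  The integral operator preserves the set of Lipschitz functions that agree with \<open>u\<close> on \<open>[A,B']\<close>,
  so no gluing of solutions is needed.
\<close>

lemma volterra_extension:
  fixes g :: "real \<Rightarrow> real \<Rightarrow> real"
  assumes AB: "A \<le> B'" "B' \<le> B"
    and w: "continuous_on {A..B} w"
    and g: "continuous_on ({A..B} \<times> UNIV) (\<lambda>(t, v). g t v)"
    and gbound: "\<And>t v. t \<in> {A..B} \<Longrightarrow> \<bar>g t v\<bar> \<le> C"
    and uc: "continuous_on {A..B'} u"
    and uV: "\<And>t. t \<in> {A..B'} \<Longrightarrow> u t = u0 - integral {A..t} (\<lambda>s. w s * integral {A..s} (\<lambda>r. g r (u r)))"
  obtains v where "continuous_on {A..B} v"
    "\<And>t. t \<in> {A..B} \<Longrightarrow> v t = u0 - integral {A..t} (\<lambda>s. w s * integral {A..s} (\<lambda>r. g r (v r)))"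
    "\<And>t. t \<in> {A..B'} \<Longrightarrow> v t = u t"
proof -
  define V where "V u t = u0 - integral {A..t} (\<lambda>s. w s * integral {A..s} (\<lambda>r. g r (u r)))" for u t
  note u = uc uV[folded V_def]
  have "compact (w ` {A..B})"
    by (intro compact_continuous_image w) auto
  then obtain P where P: "\<And>s. s \<in> {A..B} \<Longrightarrow> \<bar>w s\<bar> \<le> P" "P > 0"
    by (metis bounded_pos compact_imp_bounded image_eqI real_norm_def)
  have "C \<ge> 0"
    using gbound[of A 0] AB abs_ge_zero[of "g A 0"] by simp
  \<comment> \<open>\<open>L\<close> bounds the integrand of \<open>V v\<close>, and
    \<open>M\<close> bounds \<open>V v\<close> itself. Both hold for every continuous
    \<open>v\<close> because \<open>g\<close> is bounded, so one compact set contains all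
    images.\<close>
  define L where "L = P * (C * (B - A))"
  define M where "M = \<bar>u0\<bar> + L * (B - A)"
  have gv: "continuous_on {A..B} (\<lambda>r. g r (v r))" if "continuous_on {A..B} v" for v
    using continuous_on_compose2[OF g continuous_on_Pair[OF continuous_on_id that]] by (simp add: image_subset_iff)
  have Gc: "continuous_on {A..B} (\<lambda>s. integral {A..s} (\<lambda>r. g r (v r)))" if "continuous_on {A..B} v" for v
    by (intro indefinite_integral_continuous_1 integrable_continuous_real gv that)
  have wG: "continuous_on {A..B} (\<lambda>s. w s * integral {A..s} (\<lambda>r. g r (v r)))"
    if "continuous_on {A..B} v" for v
    by (intro continuous_on_mult w Gc that)
  have Gb: "\<bar>integral {A..s} h\<bar> \<le> c * (B - A)"
    if "continuous_on {A..B} h" "\<And>r. r \<in> {A..B} \<Longrightarrow> \<bar>h r\<bar> \<le> c" "s \<in> {A..B}" for h s c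
  proof -
    have "c \<ge> 0" using that(2)[OF that(3)] by (meson abs_ge_zero order_trans)
    have "\<bar>integral {A..s} h\<bar> \<le> c * (s - A)"
      using integral_bound[of A s h c] continuous_on_subset[OF that(1), of "{A..s}"] that(2,3) by auto
    also have "\<dots> \<le> c * (B - A)"
      using that(3) \<open>c \<ge> 0\<close> by (intro mult_left_mono) auto
    finally show ?thesis .
  qed
  have wGb: "\<bar>w s * integral {A..s} (\<lambda>r. g r (v r))\<bar> \<le> L"
    if "continuous_on {A..B} v" "s \<in> {A..B}" for v s
    unfolding abs_mult L_def using P(1)[OF that(2)] P(2) Gb[OF gv[OF that(1)] gbound that(2)]
    by (intro mult_mono) auto
  have VL: "\<bar>V v x - V v y\<bar> \<le> L * \<bar>x - y\<bar>"
    if "continuous_on {A..B} v" "x \<in> {A..B}" "y \<in> {A..B}" for v x y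
    using lipschitz_integral[OF wG[OF that(1)] wGb[OF that(1)] that(2,3)]
    by (simp add: V_def abs_minus_commute)
  have VM: "\<bar>V v x\<bar> \<le> M" if "continuous_on {A..B} v" "x \<in> {A..B}" for v x
    using Gb[OF wG[OF that(1)] wGb[OF that(1)] that(2)] by (simp add: V_def M_def)
  have Vc: "continuous_on {A..B} (V v)" if "continuous_on {A..B} v" for v
    unfolding V_def
    by (intro continuous_intros indefinite_integral_continuous_1 integrable_continuous_real wG that)
  \<comment> \<open>Volterra property: the value at \<open>t\<close> sees only the past. As
    \<open>u\<close> solves the equation on \<open>{A..B'}\<close>, agreement with \<open>u\<close>
    there is preserved.\<close>
  have Vlocal: "V v t = V v' t" if "\<And>r. r \<in> {A..t} \<Longrightarrow> v r = v' r" for v v' t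
  proof -
    have "integral {A..s} (\<lambda>r. g r (v r)) = integral {A..s} (\<lambda>r. g r (v' r))" if "s \<in> {A..t}" for s
      by (rule integral_cong) (use that \<open>\<And>r. r \<in> {A..t} \<Longrightarrow> v r = v' r\<close> in auto)
    then show ?thesis
      unfolding V_def by (intro arg_cong2[where f = minus] integral_cong) auto
  qed
  have clamp: "clamp A B x \<in> {A..B}" for x
    using clamp_in_interval[of A B x] AB by auto
  have clamp_id: "clamp A B x = x" if "x \<in> {A..B}" for x
    using that by simp
  have "\<exists>h. \<forall>x. apply_bcontfun h x = V v (clamp A B x)" for v :: "real \<Rightarrow>\<^sub>C real"
  proof -
    have "continuous_on (cbox A B) (V v)"
      using Vc[of v] by simp
    then show ?thesis
      by (rule continuous_on_cbox_bcontfunE) blast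
  qed
  then have "\<exists>T :: (real \<Rightarrow>\<^sub>C real) \<Rightarrow> (real \<Rightarrow>\<^sub>C real). \<forall>v x. apply_bcontfun (T v) x = V (apply_bcontfun v) (clamp A B x)"
    by (intro choice) blast
  then obtain T :: "(real \<Rightarrow>\<^sub>C real) \<Rightarrow> (real \<Rightarrow>\<^sub>C real)"
    where T: "\<And>v x. apply_bcontfun (T v) x = V (apply_bcontfun v) (clamp A B x)"
    by blast
  define S0 where "S0 = {v :: real \<Rightarrow>\<^sub>C real. (\<forall>x. v x = v (clamp A B x)) \<and>
    (\<forall>x\<in>{A..B}. \<bar>v x\<bar> \<le> M) \<and> (\<forall>x\<in>{A..B}. \<forall>y\<in>{A..B}. \<bar>v x - v y\<bar> \<le> L * \<bar>x - y\<bar>)}"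
  define S1 where "S1 = {v :: real \<Rightarrow>\<^sub>C real. \<forall>x\<in>{A..B'}. v x = u x}"
  have S0: "compact S0"
    unfolding S0_def using AB by (intro compact_lipschitz_bcontfun) auto
  have TS0: "T v \<in> S0" for v
    using VL[of v] VM[of v] clamp_id[OF clamp] by (simp add: S0_def T clamp_id)
  have TS1: "T v \<in> S1" if "v \<in> S1" for v
  proof -
    have "V v x = u x" if "x \<in> {A..B'}" for x
      using Vlocal[of x v u] \<open>v \<in> S1\<close> that u(2)[OF that] by (auto simp: S1_def)
    then show ?thesis
      using AB by (auto simp: S1_def T)
  qed
  have "closed S1"
  proof -
    have "S1 = PiC {A..B'} (\<lambda>x. {u x})"
      by (auto simp: S1_def mem_PiC_iff Pi_def)
    then show ?thesis by (simp add: closed_PiC)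
  qed
  moreover have "convex S0"
  proof (rule convexI)
    fix f h :: "real \<Rightarrow>\<^sub>C real" and a b :: real
    assume f: "f \<in> S0" and h: "h \<in> S0" and ab: "0 \<le> a" "0 \<le> b" "a + b = 1"
    show "a *\<^sub>R f + b *\<^sub>R h \<in> S0"
      unfolding S0_def
    proof (intro CollectI conjI allI ballI)
      show "(a *\<^sub>R f + b *\<^sub>R h) x = (a *\<^sub>R f + b *\<^sub>R h) (clamp A B x)" for x
      proof -
        have "f x = f (clamp A B x)" "h x = h (clamp A B x)"
          using f h unfolding S0_def by blast+
        then show ?thesis by simp
      qed
      show "\<bar>(a *\<^sub>R f + b *\<^sub>R h) x\<bar> \<le> M" if "x \<in> {A..B}" for x
      proof -
        have "\<bar>f x\<bar> \<le> M" "\<bar>h x\<bar> \<le> M"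
          using f h that unfolding S0_def by blast+
        then have "a * \<bar>f x\<bar> + b * \<bar>h x\<bar> \<le> a * M + b * M"
          using ab by (intro add_mono mult_left_mono)
        moreover have "\<bar>a * f x + b * h x\<bar> \<le> a * \<bar>f x\<bar> + b * \<bar>h x\<bar>"
          using ab by (metis abs_mult abs_of_nonneg abs_triangle_ineq)
        ultimately show ?thesis
          using ab by (simp add: distrib_right[symmetric])
      qed
      show "\<bar>(a *\<^sub>R f + b *\<^sub>R h) x - (a *\<^sub>R f + b *\<^sub>R h) y\<bar> \<le> L * \<bar>x - y\<bar>"
        if "x \<in> {A..B}" "y \<in> {A..B}" for x y
      proof -
        have "\<bar>f x - f y\<bar> \<le> L * \<bar>x - y\<bar>" "\<bar>h x - h y\<bar> \<le> L * \<bar>x - y\<bar>"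
          using f h that unfolding S0_def by blast+
        then have "a * \<bar>f x - f y\<bar> + b * \<bar>h x - h y\<bar> \<le> a * (L * \<bar>x - y\<bar>) + b * (L * \<bar>x - y\<bar>)"
          using ab by (intro add_mono mult_left_mono)
        moreover have "\<bar>a * (f x - f y) + b * (h x - h y)\<bar> \<le> a * \<bar>f x - f y\<bar> + b * \<bar>h x - h y\<bar>"
          using ab by (metis abs_mult abs_of_nonneg abs_triangle_ineq)
        moreover have "a * (L * \<bar>x - y\<bar>) + b * (L * \<bar>x - y\<bar>) = L * \<bar>x - y\<bar>"
          using ab by (simp add: distrib_right[symmetric])
        moreover have "(a *\<^sub>R f + b *\<^sub>R h) x - (a *\<^sub>R f + b *\<^sub>R h) y = a * (f x - f y) + b * (h x - h y)"
          by (simp add: algebra_simps)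
        ultimately show ?thesis
          by simp
      qed
    qed
  qed
  moreover have "convex S1"
    by (rule convexI) (auto simp: S1_def distrib_right[symmetric])
  \<comment> \<open>Any bounded continuous extension of \<open>u\<close> lies in \<open>S1\<close>,
    and one application of \<open>T\<close> brings it into \<open>S0\<close> as well.\<close>
  moreover have "S0 \<inter> S1 \<noteq> {}"
  proof -
    have "continuous_on (cbox A B') u"
      using u(1) by simp
    then obtain h where "\<And>x. x \<in> cbox A B' \<Longrightarrow> apply_bcontfun h x = u x"
      by (rule continuous_on_cbox_bcontfunE) blast
    then have "h \<in> S1" by (auto simp: S1_def)
    then show ?thesis using TS0 TS1 by blast
  qed
  moreover have "continuous_on (S0 \<inter> S1) T"
    unfolding continuous_on_iff
  proof (intro ballI allI impI)
    fix v and \<epsilon> :: real assume v: "v \<in> S0 \<inter> S1" and "\<epsilon> > 0"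
    \<comment> \<open>Two integrations over \<open>{A..B}\<close> and the bound \<open>P\<close> on
      \<open>w\<close> multiply an error by at most \<open>P * (B - A) * (B - A)\<close>; the
      summand 1 covers the case where this is 0.\<close>
    define \<eta> where "\<eta> = \<epsilon> / (2 * (P * (B - A) * (B - A) + 1))"
    have PB: "P * (B - A) * (B - A) \<ge> 0" using P AB by simp
    have "\<eta> > 0" using \<open>\<epsilon> > 0\<close> PB by (simp add: \<eta>_def)
    have "continuous_on ({A..B} \<times> {- M..M}) (\<lambda>(t, v). g t v)"
      by (rule continuous_on_subset[OF g]) auto
    from uniformly_continuous_second_arg[OF this \<open>\<eta> > 0\<close>]
    obtain \<delta> where "\<delta> > 0" and \<delta>: "\<And>t v w. t \<in> {A..B} \<Longrightarrow> v \<in> {- M..M} \<Longrightarrow> w \<in> {- M..M} \<Longrightarrow> \<bar>v - w\<bar> < \<delta> \<Longrightarrow>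
        \<bar>g t v - g t w\<bar> < \<eta>"
      by blast
    have "dist (T v') (T v) < \<epsilon>" if v': "v' \<in> S0 \<inter> S1" "dist v' v < \<delta>" for v'
    proof -
      have close: "\<bar>g r (v' r) - g r (v r)\<bar> \<le> \<eta>" if "r \<in> {A..B}" for r
      proof -
        have "\<bar>v' r\<bar> \<le> M" "\<bar>v r\<bar> \<le> M"
          using v v' that unfolding S0_def by blast+
        moreover have "\<bar>v' r - v r\<bar> < \<delta>"
          using dist_fun_lt_imp_dist_val_lt[OF v'(2), of r] by (simp add: dist_real_def)
        ultimately show ?thesis
          using that by (intro less_imp_le \<delta>) auto
      qed
      have cv: "continuous_on {A..B} (apply_bcontfun v)" "continuous_on {A..B} (apply_bcontfun v')"
        by auto
      have G: "\<bar>integral {A..s} (\<lambda>r. g r (v' r)) - integral {A..s} (\<lambda>r. g r (v r))\<bar> \<le> \<eta> * (B - A)"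
        if "s \<in> {A..B}" for s
      proof -
        have "integral {A..s} (\<lambda>r. g r (v' r)) - integral {A..s} (\<lambda>r. g r (v r)) =
            integral {A..s} (\<lambda>r. g r (v' r) - g r (v r))"
          using that by (intro integral_diff[symmetric] integrable_continuous_real
            continuous_on_subset[OF gv[OF cv(1)]] continuous_on_subset[OF gv[OF cv(2)]]) auto
        then show ?thesis
          using Gb[OF continuous_on_diff[OF gv[OF cv(2)] gv[OF cv(1)]] close that] by simp
      qed
      have "\<bar>V v' t - V v t\<bar> \<le> P * (\<eta> * (B - A)) * (B - A)" if t: "t \<in> {A..B}" for t
      proof -
        define D where "D = (\<lambda>s. w s * integral {A..s} (\<lambda>r. g r (v' r)) - w s * integral {A..s} (\<lambda>r. g r (v r)))"
        have "V v' t - V v t = - integral {A..t} D"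
          unfolding V_def D_def using t
          by (subst integral_diff) (auto intro!: integrable_continuous_real
            continuous_on_subset[OF wG[OF cv(1)]] continuous_on_subset[OF wG[OF cv(2)]])
        moreover have "\<bar>D s\<bar> \<le> P * (\<eta> * (B - A))" if "s \<in> {A..B}" for s
          unfolding D_def right_diff_distrib[symmetric] abs_mult
          using G[OF that] P(1)[OF that] P(2) by (intro mult_mono) auto
        moreover have "continuous_on {A..B} D"
          unfolding D_def by (intro continuous_on_diff wG cv)
        ultimately show ?thesis
          using Gb[of D _ t] t by simp
      qed
      then have "dist (T v' x) (T v x) \<le> P * (\<eta> * (B - A)) * (B - A)" for x
        using clamp[of x] by (simp add: T dist_real_def)
      then have "dist (T v') (T v) \<le> P * (\<eta> * (B - A)) * (B - A)"
        by (rule dist_bound)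
      also have "\<dots> = (P * (B - A) * (B - A)) * \<eta>"
        by simp
      also have "\<dots> < \<epsilon>"
        unfolding \<eta>_def using \<open>\<epsilon> > 0\<close> PB by (simp add: divide_less_eq)
      finally show ?thesis .
    qed
    then show "\<exists>\<delta>>0. \<forall>v'\<in>S0 \<inter> S1. dist v' v < \<delta> \<longrightarrow> dist (T v') (T v) < \<epsilon>"
      using \<open>\<delta> > 0\<close> by blast
  qed
  ultimately obtain v where v: "v \<in> S0 \<inter> S1" "T v = v"
    using schauder[of "S0 \<inter> S1" T S0] S0 TS0 TS1
    by (metis (no_types, lifting) IntD2 IntI closed_Int compact_imp_closed convex_Int)
  show ?thesis
  proof (rule that[of v])
    show "v t = u0 - integral {A..t} (\<lambda>s. w s * integral {A..s} (\<lambda>r. g r (v r)))" if "t \<in> {A..B}" for t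
      unfolding V_def[symmetric] using T[of v t] v(2) clamp_id[OF that] by simp
    show "v t = u t" if "t \<in> {A..B'}" for t
      using v(1) that by (auto simp: S1_def)
  qed auto
qed

text \<open>Extension by one unit at a time. Solutions need not be unique, so each step has to
  prolong the very solution chosen before, which is why dependent choice is used. The bounds of
  \<open>g\<close> on strips, uniform in \<open>v\<close>, exclude blow-up.\<close>

lemma volterra_half_line:
  fixes g :: "real \<Rightarrow> real \<Rightarrow> real"
  assumes w: "continuous_on {A..} w"
    and g: "continuous_on ({A..} \<times> UNIV) (\<lambda>(t, v). g t v)"
    and gbound: "\<And>B. \<exists>C. \<forall>t\<in>{A..B}. \<forall>v. \<bar>g t v\<bar> \<le> C"
  obtains u where "continuous_on {A..} u"
    "\<And>t. A \<le> t \<Longrightarrow> u t = u0 - integral {A..t} (\<lambda>s. w s * integral {A..s} (\<lambda>r. g r (u r)))"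
proof -
  define V where "V u t = u0 - integral {A..t} (\<lambda>s. w s * integral {A..s} (\<lambda>r. g r (u r)))" for u t
  define Q where "Q n u \<longleftrightarrow> continuous_on {A..A + real n} u \<and> (\<forall>t\<in>{A..A + real n}. u t = V u t)" for n u
  have "\<exists>f. \<forall>n. Q n (f n) \<and> (\<forall>t\<in>{A..A + real n}. f (Suc n) t = f n t)"
  proof (rule dependent_nat_choice)
    show "\<exists>u. Q 0 u"
      by (rule exI[of _ "\<lambda>_. u0"]) (simp add: Q_def V_def)
    fix u n assume Q: "Q n u"
    obtain C where C: "\<forall>t\<in>{A..A + real (Suc n)}. \<forall>v. \<bar>g t v\<bar> \<le> C"
      using gbound by blast
    obtain v where "continuous_on {A..A + real (Suc n)} v" "\<And>t. t \<in> {A..A + real (Suc n)} \<Longrightarrow> v t = V v t"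
      "\<And>t. t \<in> {A..A + real n} \<Longrightarrow> v t = u t"
      unfolding V_def
    proof (rule volterra_extension[of A "A + real n" "A + real (Suc n)" w g C u u0])
      show "continuous_on {A..A + real (Suc n)} w"
        using w by (rule continuous_on_subset) auto
      show "continuous_on ({A..A + real (Suc n)} \<times> UNIV) (\<lambda>(t, v). g t v)"
        using g by (rule continuous_on_subset) auto
    qed (use Q C in \<open>auto simp: Q_def V_def\<close>)
    then show "\<exists>v. Q (Suc n) v \<and> (\<forall>t\<in>{A..A + real n}. v t = u t)"
      by (auto simp: Q_def)
  qed
  then obtain f where f: "\<And>n. Q n (f n)" and step: "\<And>n t. t \<in> {A..A + real n} \<Longrightarrow> f (Suc n) t = f n t"
    by blast
  have agree: "f (n + k) t = f n t" if "t \<in> {A..A + real n}" for n k t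
  proof (induction k)
    case (Suc k)
    then show ?case using step[of t "n + k"] that by simp
  qed simp
  \<comment> \<open>The first stage whose interval reaches \<open>t\<close>; all later stages agree
    with it there.\<close>
  define u where "u t = f (nat \<lceil>t - A\<rceil>) t" for t
  have u: "u t = f n t" if t: "t \<in> {A..A + real n}" for n t
  proof -
    define N where "N = nat \<lceil>t - A\<rceil>"
    have "N \<le> n"
      using t by (simp add: N_def nat_le_iff ceiling_le_iff)
    moreover have "t \<in> {A..A + real N}"
      using t real_nat_ceiling_ge[of "t - A"] unfolding N_def atLeastAtMost_iff by linarith
    ultimately show ?thesis
      using agree[of t N "n - N"] by (simp add: u_def N_def[symmetric])
  qed
  have "continuous_on {A..B} u" for B
  proof -
    have "continuous_on {A..A + real (nat \<lceil>B - A\<rceil>)} u"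
      using f[of "nat \<lceil>B - A\<rceil>"] unfolding Q_def by (subst continuous_on_cong[OF refl u]) auto
    then show ?thesis
    proof (rule continuous_on_subset)
      show "{A..B} \<subseteq> {A..A + real (nat \<lceil>B - A\<rceil>)}"
        using of_nat_ceiling[of "B - A"] by auto
    qed
  qed
  then have "continuous_on {A..} u"
    by (rule continuous_on_half_lineI)
  moreover have "u t = V u t" if "A \<le> t" for t
  proof -
    define n where "n = nat \<lceil>t - A\<rceil>"
    have t: "t \<in> {A..A + real n}"
      using that real_nat_ceiling_ge[of "t - A"] unfolding n_def atLeastAtMost_iff by linarith
    have "V (f n) t = V u t"
    proof -
      have "integral {A..s} (\<lambda>r. g r (f n r)) = integral {A..s} (\<lambda>r. g r (u r))" if "s \<in> {A..t}" for s
        by (rule integral_cong) (use that t u[of _ n] in auto)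
      then show ?thesis
        unfolding V_def by (intro arg_cong2[where f = minus] integral_cong) auto
    qed
    then show ?thesis
      using f[of n] t u[OF t] by (simp add: Q_def)
  qed
  ultimately show ?thesis
    unfolding V_def by (rule that)
qed

subsection \<open>Positive decaying solutions on a half line\<close>

text \<open>Continuous induction: a failure would have a first point \<open>Inf S\<close>, attained
  because the set of failures is closed, and \<open>step\<close> forbids a first failure.\<close>

lemma positive_half_lineI:
  fixes m :: "real \<Rightarrow> real"
  assumes cont: "continuous_on {A..} m" and "m A > 0"
    and step: "\<And>T. A < T \<Longrightarrow> (\<And>s. A \<le> s \<Longrightarrow> s < T \<Longrightarrow> m s > 0) \<Longrightarrow> m T > 0"
    and "A \<le> t"
  shows "m t > 0"
proof (rule ccontr)
  assume t: "\<not> m t > 0"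
  define S where "S = {s \<in> {A..t}. m s \<le> 0}"
  have "closed S"
    unfolding S_def
    by (intro continuous_on_closed_Collect_le continuous_on_const continuous_on_subset[OF cont]) auto
  moreover have "t \<in> S"
    using t \<open>A \<le> t\<close> by (simp add: S_def)
  moreover have "bdd_below S"
    by (rule bdd_belowI[of _ A]) (simp add: S_def)
  ultimately have "Inf S \<in> S"
    by (intro closed_contains_Inf) auto
  moreover have "m s > 0" if "A \<le> s" "s < Inf S" for s
    using cInf_lower[OF _ \<open>bdd_below S\<close>, of s] cInf_lower[OF \<open>t \<in> S\<close> \<open>bdd_below S\<close>] that
      \<open>Inf S \<in> S\<close> by (force simp: S_def not_le)
  moreover have "A \<le> Inf S" "m (Inf S) \<le> 0"
    using \<open>Inf S \<in> S\<close> unfolding S_def by auto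
  ultimately show False
    using step[of "Inf S"] \<open>m A > 0\<close> by (cases "A = Inf S") fastforce+
qed

lemma nondecreasing_half_line:
  fixes h :: "real \<Rightarrow> real"
  assumes h: "\<And>t. A \<le> t \<Longrightarrow> (h has_real_derivative h' t) (at t within {A..})"
    and "A \<le> x" "x \<le> y" and nonneg: "\<And>t. x < t \<Longrightarrow> t < y \<Longrightarrow> 0 \<le> h' t"
  shows "h x \<le> h y"
proof (rule DERIV_nonneg_imp_increasing_open[OF \<open>x \<le> y\<close>])
  fix t assume t: "x < t" "t < y"
  then have "at t within {A..} = at t"
    using \<open>A \<le> x\<close> by (intro at_within_interior) simp
  then show "\<exists>d. (h has_real_derivative d) (at t) \<and> 0 \<le> d"
    using h[of t] nonneg[of t] t \<open>A \<le> x\<close> by fastforce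
next
  have "continuous_on {A..} h"
    using h by (auto simp: continuous_on_eq_continuous_within intro!: DERIV_continuous)
  then show "continuous_on {x..y} h"
    by (rule continuous_on_subset) (use \<open>A \<le> x\<close> in auto)
qed

lemma tendsto_at_top_mono_bounded:
  fixes h :: "real \<Rightarrow> real"
  assumes mono: "\<And>x y. A \<le> x \<Longrightarrow> x \<le> y \<Longrightarrow> h x \<le> h y" and bound: "\<And>x. A \<le> x \<Longrightarrow> h x \<le> C"
  obtains L where "(h \<longlongrightarrow> L) at_top" "\<And>x. A \<le> x \<Longrightarrow> h x \<le> L"
proof -
  have bdd: "bdd_above (h ` {A..})"
    using bound by (auto simp: bdd_above_def)
  define L where "L = (SUP x\<in>{A..}. h x)"
  have le: "h x \<le> L" if "A \<le> x" for x
    unfolding L_def using that by (intro cSUP_upper bdd) auto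
  have "(h \<longlongrightarrow> L) at_top"
  proof (rule order_tendstoI)
    fix a assume "a < L"
    then obtain x where x: "A \<le> x" "a < h x"
      unfolding L_def using less_cSUP_iff[OF _ bdd] by auto
    have "a < h y" if "x \<le> y" for y
      using mono[OF x(1) that] x(2) by simp
    then show "\<forall>\<^sub>F y in at_top. a < h y"
      using eventually_at_top_linorder by blast
  next
    fix a assume "L < a"
    then show "\<forall>\<^sub>F y in at_top. h y < a"
      using le by (intro eventually_mono[OF eventually_ge_at_top[of A]]) (rule le_less_trans)
  qed
  then show ?thesis using le by (rule that)
qed

text \<open>
  Comparison with the solution \<open>t powr (- \<kappa>)\<close> of the Euler equation
  \<open>(t\<^sup>n y')' + \<kappa>\<^sup>2 t\<^bsup>n-2\<^esup> y = 0\<close>: as long as \<open>u\<close> and \<open>h = p u' + \<kappa> t\<^bsup>n-1\<^esup> u\<close> are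
  positive, both \<open>h\<close> and \<open>t\<^sup>\<kappa> u\<close> are nondecreasing.
\<close>

lemma kneser_positive:
  fixes u q p G :: "real \<Rightarrow> real" and n R :: real
  assumes "0 < R" "1 < n" and p: "\<And>t. R \<le> t \<Longrightarrow> p t > 0" "\<And>t. R \<le> t \<Longrightarrow> t powr n \<le> p t"
    and u': "\<And>t. R \<le> t \<Longrightarrow> (u has_real_derivative q t / p t) (at t within {R..})"
    and q': "\<And>t. R \<le> t \<Longrightarrow> (q has_real_derivative - G t) (at t within {R..})"
    and G: "\<And>t. R \<le> t \<Longrightarrow> 0 < u t \<Longrightarrow> G t \<le> (n - 1)\<^sup>2 / 4 * t powr (n - 2) * u t"
    and "0 < u R" "q R = 0" "R \<le> t"
  shows "0 < u t"
proof -
  \<comment> \<open>For the power \<open>t powr (- \<kappa>)\<close> the Euler equation has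
    coefficient \<kappa> (n - 1 - \<kappa>), which is largest for this \<kappa> and then equals
    \<open>\<kappa>\<^sup>2\<close>.\<close>
  define \<kappa> where "\<kappa> = (n - 1) / 2"
  have \<kappa>: "\<kappa> > 0" "(n - 1)\<^sup>2 / 4 = \<kappa>\<^sup>2" "n - 1 = 2 * \<kappa>"
    using \<open>1 < n\<close> by (auto simp: \<kappa>_def power2_eq_square)
  define h where "h t = q t + \<kappa> * t powr (n - 1) * u t" for t
  define y where "y t = t powr \<kappa> * u t" for t
  define h' where "h' t = - G t + (\<kappa> * ((n - 1) * t powr (n - 2)) * u t + \<kappa> * t powr (n - 1) * (q t / p t))" for t
  define y' where "y' t = \<kappa> * t powr (\<kappa> - 1) * u t + t powr \<kappa> * (q t / p t)" for t
  have h': "(h has_real_derivative h' t) (at t within {R..})" if "R \<le> t" for t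
    unfolding h_def h'_def using that \<open>0 < R\<close>
    by (auto intro!: derivative_eq_intros u' q' simp: algebra_simps)
  have y': "(y has_real_derivative y' t) (at t within {R..})" if "R \<le> t" for t
    unfolding y_def y'_def using that \<open>0 < R\<close>
    by (auto intro!: derivative_eq_intros u' simp: algebra_simps)
  have cont: "continuous_on {R..} u" "continuous_on {R..} h"
    using u' h' by (auto simp: continuous_on_eq_continuous_within intro!: DERIV_continuous)
  \<comment> \<open>Positivity of \<open>u\<close> and positivity of \<open>h\<close> need each
    other, so one continuous induction carries both.\<close>
  have "min (u t) (h t) > 0"
  proof (rule positive_half_lineI[OF _ _ _ \<open>R \<le> t\<close>])
    show "continuous_on {R..} (\<lambda>t. min (u t) (h t))"
      by (intro continuous_intros cont)
    show "min (u R) (h R) > 0"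
      using \<open>0 < u R\<close> \<open>q R = 0\<close> \<kappa> \<open>0 < R\<close> by (simp add: h_def)
    fix T assume T: "R < T" and pos: "\<And>s. R \<le> s \<Longrightarrow> s < T \<Longrightarrow> min (u s) (h s) > 0"
    \<comment> \<open>Up to the factor \<open>s powr \<kappa>\<close> this is the derivative of
      \<open>y\<close>. If \<open>q s < 0\<close>, the lower bound on \<open>p\<close> replaces
      \<open>p s\<close> by \<open>s powr n\<close>, and positivity of \<open>h\<close> bounds
      \<open>q s\<close> from below.\<close>
    have key: "\<kappa> * u s / s + q s / p s \<ge> 0" if s: "R \<le> s" "s < T" for s
    proof (cases "q s \<ge> 0")
      case True
      then show ?thesis
        using pos[OF s] p(1)[OF s(1)] s \<open>0 < R\<close> \<kappa> by (intro add_nonneg_nonneg) auto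
    next
      case False
      have "s > 0" using s \<open>0 < R\<close> by simp
      have "q s / s powr n \<le> q s / p s"
        using False p[OF s(1)] \<open>s > 0\<close> by (intro divide_left_mono_neg) auto
      moreover have "- (\<kappa> * u s / s) = - (\<kappa> * s powr (n - 1) * u s) / s powr n"
        using \<open>s > 0\<close> by (simp add: powr_diff)
      moreover have "- (\<kappa> * s powr (n - 1) * u s) / s powr n \<le> q s / s powr n"
        using pos[OF s] by (intro divide_right_mono) (auto simp: h_def)
      ultimately show ?thesis by linarith
    qed
    have "y R \<le> y T"
    proof (rule nondecreasing_half_line[OF y'])
      fix s assume s: "R < s" "s < T"
      then have "s > 0" using \<open>0 < R\<close> by simp
      then have "y' s = s powr \<kappa> * (\<kappa> * u s / s + q s / p s)"
        by (simp add: y'_def powr_diff algebra_simps)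
      then show "0 \<le> y' s"
        using key[of s] s by simp
    qed (use T in auto)
    then have "u T > 0"
      using \<open>0 < u R\<close> \<open>0 < R\<close> T
      by (simp add: y_def) (smt (verit) mult_pos_pos powr_gt_zero zero_less_mult_pos)
    moreover have "h R \<le> h T"
    proof (rule nondecreasing_half_line[OF h'])
      fix s assume s: "R < s" "s < T"
      then have "s > 0" "0 < u s" using \<open>0 < R\<close> pos[of s] by auto
      then have "G s \<le> \<kappa>\<^sup>2 * s powr (n - 2) * u s"
        using G[of s] s \<kappa>(2) by simp
      \<comment> \<open>As \<open>n - 1 = 2 * \<kappa>\<close>, half of the term that comes from
        differentiating the power pays for \<open>G\<close>; the other half joins
        \<open>q / p\<close> to form the quantity of \<open>key\<close>.\<close>
      moreover have "h' s = - G s + (\<kappa>\<^sup>2 * s powr (n - 2) * u s + \<kappa> * s powr (n - 1) * (\<kappa> * u s / s + q s / p s))"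
      proof -
        have "s powr (n - 1) = s powr (n - 2) * s"
          using \<open>s > 0\<close> powr_add[of s "n - 2" 1] by simp
        then show ?thesis
          using \<open>s > 0\<close> unfolding h'_def \<kappa>(3) by (simp add: algebra_simps power2_eq_square)
      qed
      moreover have "\<kappa> * s powr (n - 1) * (\<kappa> * u s / s + q s / p s) \<ge> 0"
        using key[of s] s \<kappa> by simp
      ultimately show "0 \<le> h' s" by linarith
    qed (use T in auto)
    moreover have "h R > 0"
      using \<open>0 < u R\<close> \<open>q R = 0\<close> \<kappa> \<open>0 < R\<close> by (simp add: h_def)
    ultimately show "min (u T) (h T) > 0" by simp
  qed
  then show ?thesis by simp
qed

text \<open>\<open>E\<close> solves E' = M B E / p, the worst case of u' = q / p when q <= M B sup
  u, and the bound on \<open>M * B * P\<close> keeps the exponential below 2. Since \<open>u\<close>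
  may fail to be monotone, the supremum of its past is replaced by the current value of the
  nondecreasing \<open>E\<close>. In the application \<beta> is the negative part of
  \<open>b\<^sub>1\<close>, not the boundary coefficient.\<close>

lemma gronwall_half_line:
  fixes u q p G \<beta> :: "real \<Rightarrow> real" and M B P R :: real
  assumes p: "\<And>t. R \<le> t \<Longrightarrow> p t > 0" "continuous_on {R..} p"
    and u': "\<And>t. R \<le> t \<Longrightarrow> (u has_real_derivative q t / p t) (at t within {R..})"
    and q': "\<And>t. R \<le> t \<Longrightarrow> (q has_real_derivative - G t) (at t within {R..})"
    and G: "\<And>t. R \<le> t \<Longrightarrow> - (M * \<beta> t * u t) \<le> G t"
    and \<beta>: "continuous_on {R..} \<beta>" "\<And>t. R \<le> t \<Longrightarrow> 0 \<le> \<beta> t"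
    and B: "\<And>t. R \<le> t \<Longrightarrow> integral {R..t} \<beta> \<le> B" and P: "\<And>t. R \<le> t \<Longrightarrow> integral {R..t} (\<lambda>s. 1 / p s) \<le> P"
    and M: "0 \<le> M" "M * B * P \<le> ln 2"
    and "0 < u R" "q R = 0" "R \<le> t"
  shows "u t \<le> 2 * u R"
proof -
  define \<Phi> where "\<Phi> t = integral {R..t} (\<lambda>s. 1 / p s)" for t
  define \<Psi> where "\<Psi> t = integral {R..t} \<beta>" for t
  have \<Phi>': "(\<Phi> has_real_derivative 1 / p t) (at t within {R..})" if "R \<le> t" for t
    unfolding \<Phi>_def using p that
    by (intro integral_half_line_deriv continuous_intros) (auto simp: less_imp_neq[symmetric])
  have \<Psi>': "(\<Psi> has_real_derivative \<beta> t) (at t within {R..})" if "R \<le> t" for t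
    unfolding \<Psi>_def by (rule integral_half_line_deriv[OF \<beta>(1) that])
  have "0 \<le> B" using B[of R] by simp
  have \<Phi>mono: "\<Phi> s \<le> \<Phi> t" if "R \<le> s" "s \<le> t" for s t
    by (rule nondecreasing_half_line[OF \<Phi>']) (use that p(1) in \<open>auto simp: less_imp_le\<close>)
  define E where "E t = u R * exp (M * B * \<Phi> t)" for t
  have E': "(E has_real_derivative E t * (M * B) / p t) (at t within {R..})" if "R \<le> t" for t
    unfolding E_def using that by (auto intro!: derivative_eq_intros \<Phi>')
  have "E t \<le> 2 * u R"
  proof -
    have "M * B * \<Phi> t \<le> M * B * P"
      using P[OF \<open>R \<le> t\<close>] M \<open>0 \<le> B\<close> by (intro mult_left_mono) (auto simp: \<Phi>_def)
    then have "exp (M * B * \<Phi> t) \<le> exp (ln 2)"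
      using M by (simp del: exp_ln)
    then show ?thesis
      using \<open>0 < u R\<close> by (simp add: E_def)
  qed
  have E_pos: "0 < E t" for t
    using \<open>0 < u R\<close> by (simp add: E_def)
  \<comment> \<open>The factor \<open>1 + \<epsilon>\<close> makes the comparison strict at
    \<open>R\<close>, as continuous induction requires; afterwards \<epsilon> tends to 0.\<close>
  have less: "u t < (1 + \<epsilon>) * E t" if "\<epsilon> > 0" for \<epsilon>
  proof -
    have m': "((\<lambda>t. (1 + \<epsilon>) * E t - u t) has_real_derivative
        (1 + \<epsilon>) * (E t * (M * B) / p t) - q t / p t) (at t within {R..})" if "R \<le> t" for t
      using that by (auto intro!: derivative_eq_intros E' u')
    have "(1 + \<epsilon>) * E t - u t > 0"
    proof (rule positive_half_lineI[OF _ _ _ \<open>R \<le> t\<close>])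
      show "continuous_on {R..} (\<lambda>t. (1 + \<epsilon>) * E t - u t)"
        using m' by (intro continuous_on_vector_derivative DERIV_continuous_on) auto
      show *: "(1 + \<epsilon>) * E R - u R > 0"
        using \<open>\<epsilon> > 0\<close> \<open>0 < u R\<close> by (simp add: E_def \<Phi>_def algebra_simps)
      fix T assume T: "R < T" and pos: "\<And>s. R \<le> s \<Longrightarrow> s < T \<Longrightarrow> (1 + \<epsilon>) * E s - u s > 0"
      have "(1 + \<epsilon>) * E R - u R \<le> (1 + \<epsilon>) * E T - u T"
      proof (rule nondecreasing_half_line[OF m'])
        fix s assume s: "R < s" "s < T"
        \<comment> \<open>All earlier values of \<open>u\<close> lie below
          \<open>(1 + \<epsilon>) * E s\<close>, so before \<open>s\<close> the term
          \<open>M * \<beta> * u\<close> is at most \<open>c * \<beta>\<close>.\<close>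
        define c where "c = M * ((1 + \<epsilon>) * E s)"
        have "c \<ge> 0" using M E_pos[of s] \<open>\<epsilon> > 0\<close> by (simp add: c_def)
        have c': "((\<lambda>t. c * \<Psi> t - q t) has_real_derivative c * \<beta> t + G t) (at t within {R..})" if "R \<le> t" for t
          using that by (auto intro!: derivative_eq_intros \<Psi>' q')
        have "c * \<Psi> R - q R \<le> c * \<Psi> s - q s"
        proof (rule nondecreasing_half_line[OF c'])
          fix r assume r: "R < r" "r < s"
          have "E r \<le> E s"
            using \<Phi>mono[of r s] r M \<open>0 \<le> B\<close> \<open>0 < u R\<close> by (simp add: E_def mult_left_mono)
          then have "u r \<le> (1 + \<epsilon>) * E s"
            using pos[of r] r s \<open>\<epsilon> > 0\<close>
            by (smt (verit) mult_left_mono)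
          then have "M * \<beta> r * u r \<le> M * \<beta> r * ((1 + \<epsilon>) * E s)"
            using M \<beta>(2)[of r] r by (intro mult_left_mono) auto
          then show "0 \<le> c * \<beta> r + G r"
            using G[of r] r by (simp add: c_def mult_ac)
        qed (use s in auto)
        then have "q s \<le> c * B"
          using B[of s] s \<open>c \<ge> 0\<close> \<open>q R = 0\<close> mult_left_mono[of "\<Psi> s" B c] by (simp add: \<Psi>_def)
        then have "q s / p s \<le> c * B / p s"
          using p(1)[of s] s by (intro divide_right_mono) auto
        moreover have "c * B / p s = (1 + \<epsilon>) * (E s * (M * B) / p s)"
          by (simp add: c_def mult_ac)
        ultimately show "0 \<le> (1 + \<epsilon>) * (E s * (M * B) / p s) - q s / p s"
          by simp
      qed (use T in auto)
      with * show "(1 + \<epsilon>) * E T - u T > 0" by simp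
    qed
    then show ?thesis by simp
  qed
  have "u t \<le> E t"
  proof (rule field_le_epsilon)
    fix e :: real assume "e > 0"
    then show "u t \<le> E t + e"
      using less[of "e / E t"] E_pos[of t] \<open>e > 0\<close> by (simp add: distrib_right less_imp_le)
  qed
  with \<open>E t \<le> 2 * u R\<close> show ?thesis by simp
qed

section \<open>Integrals over the half line and decay at infinity\<close>

lemma nn_integral_half_line_finite:
  fixes h :: "real \<Rightarrow> real"
  assumes h: "continuous_on {R..} h" "\<And>t. R \<le> t \<Longrightarrow> 0 \<le> h t"
    and C: "\<And>t. R \<le> t \<Longrightarrow> integral {R..t} h \<le> C"
  shows "(\<integral>\<^sup>+t\<in>{R..}. ennreal (h t) \<partial>lborel) < \<infinity>"
proof -
  \<comment> \<open>Constant continuation to the left of \<open>R\<close>, with integration starting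
    at \<open>R - 1\<close>, yields a two-sided derivative at \<open>R\<close> itself.\<close>
  define k where "k t = h (max R t)" for t
  have k: "continuous_on UNIV k"
    unfolding k_def by (rule continuous_on_compose2[OF h(1)]) (auto intro!: continuous_intros)
  have k_eq: "k t = h t" if "R \<le> t" for t
    using that by (simp add: k_def max_def)
  define J where "J t = integral {R - 1..t} k" for t
  have J': "(J has_real_derivative k t) (at t)" if "R \<le> t" for t
  proof -
    have "(J has_real_derivative k t) (at t within {R - 1..})"
      unfolding J_def using that k by (intro integral_half_line_deriv) (auto intro: continuous_on_subset)
    moreover have "at t within {R - 1..} = at t"
      using that by (intro at_within_interior) simp
    ultimately show ?thesis by simp
  qed
  have J_split: "J t = J R + integral {R..t} h" if "R \<le> t" for t
  proof -
    have "integral {R - 1..R} k + integral {R..t} k = integral {R - 1..t} k"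
      using that k by (intro Henstock_Kurzweil_Integration.integral_combine integrable_continuous_real)
        (auto intro: continuous_on_subset)
    moreover have "integral {R..t} k = integral {R..t} h"
      by (rule integral_cong) (simp add: k_eq)
    ultimately show ?thesis by (simp add: J_def)
  qed
  have "J x \<le> J y" if "R \<le> x" "x \<le> y" for x y
    using that J' h(2) k_eq
    by (intro DERIV_nonneg_imp_nondecreasing[OF \<open>x \<le> y\<close>]) (metis order_trans)
  moreover have "J x \<le> J R + C" if "R \<le> x" for x
    using J_split[OF that] C[OF that] by simp
  ultimately obtain L where L: "(J \<longlongrightarrow> L) at_top"
    by (rule tendsto_at_top_mono_bounded) auto
  have "(\<integral>\<^sup>+t\<in>{R..}. ennreal (h t) \<partial>lborel) = (\<integral>\<^sup>+t. ennreal (k t) * indicator {R..} t \<partial>lborel)"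
    by (intro nn_integral_cong) (auto simp: indicator_def k_eq)
  also have "\<dots> = L - J R"
    using J' L h(2) k by (intro nn_integral_FTC_atLeast) (auto simp: k_eq intro: borel_measurable_continuous_onI)
  finally show ?thesis by simp
qed

text \<open>Near 0 the finite upper limit bounds F v / v, and from some \<delta> on monotonicity
  gives F v / v <= F d / \<delta>. So the supremum in \<open>slope_sup\<close> is genuine and yields
  a linear bound on \<open>F\<close> up to \<open>d\<close>.\<close>

lemma growth_fun_slope:
  assumes F: "growth_fun F" and "d > 0"
  shows "slope_sup F d > 0" "\<And>v. 0 \<le> v \<Longrightarrow> v \<le> d \<Longrightarrow> F v \<le> slope_sup F d * v"
proof -
  have nonneg: "0 \<le> F v" if "0 \<le> v" for v
    using F that by (auto simp: growth_fun_def)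
  have mono: "F v \<le> F w" if "0 \<le> v" "v \<le> w" for v w
    using F that by (auto simp: growth_fun_def mono_on_def)
  have "Limsup (at_right 0) (\<lambda>v. ereal (F v / v)) < \<infinity>"
    using F by (simp add: growth_fun_def)
  then obtain C where "Limsup (at_right 0) (\<lambda>v. ereal (F v / v)) < ereal C"
    using less_PInf_Ex_of_nat by (metis ereal_dense2 not_le order.strict_trans1 less_imp_le)
  then have "\<forall>\<^sub>F v in at_right 0. ereal (F v / v) < ereal C"
    by (rule Limsup_lessD)
  then obtain \<delta> where "\<delta> > 0" and \<delta>: "\<And>v. 0 < v \<Longrightarrow> v < \<delta> \<Longrightarrow> F v / v < C"
    by (auto simp: eventually_at_right_field)
  have bdd: "bdd_above ((\<lambda>v. F v / v) ` {0<..d})"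
  proof (rule bdd_aboveI2)
    fix v assume v: "v \<in> {0<..d}"
    show "F v / v \<le> max C (F d / \<delta>)"
    proof (cases "v < \<delta>")
      case True
      then show ?thesis using \<delta>[of v] v by auto
    next
      case False
      then have "F v / v \<le> F d / \<delta>"
        using v mono[of v d] nonneg[of d] \<open>\<delta> > 0\<close> by (intro frac_le) auto
      then show ?thesis by simp
    qed
  qed
  have le: "F v / v \<le> slope_sup F d" if "0 < v" "v \<le> d" for v
    unfolding slope_sup_def using that by (intro cSUP_upper bdd) auto
  have "F d / d > 0"
    using F \<open>d > 0\<close> by (simp add: growth_fun_def)
  then show "slope_sup F d > 0"
    using le[of d] \<open>d > 0\<close> by simp
  show "F v \<le> slope_sup F d * v" if "0 \<le> v" "v \<le> d" for v
    using le[of v] that F by (cases "v = 0") (auto simp: growth_fun_def field_simps)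
qed

lemma integral_half_line_le:
  fixes h :: "real \<Rightarrow> real"
  assumes "h integrable_on {R..}" "\<And>t. R \<le> t \<Longrightarrow> 0 \<le> h t" "continuous_on {R..} h" "R \<le> t"
  shows "integral {R..t} h \<le> integral {R..} h"
  by (rule integral_subset_le)
    (use assms in \<open>auto intro!: integrable_continuous_real intro: continuous_on_subset\<close>)

text \<open>
  Since \<open>p u'\<close> is bounded above, \<open>u\<close> has a limit; a positive limit would make
  \<open>u + \<delta> \<integral> 1/p \<integral> b\<^sub>1\<^sup>+\<close> bounded for some \<open>\<delta> > 0\<close>.
\<close>

lemma tendsto_zero_half_line:
  fixes u q p G bm bp F :: "real \<Rightarrow> real" and R D B P :: real
  assumes p: "\<And>t. R \<le> t \<Longrightarrow> p t > 0" "continuous_on {R..} p"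
    and u': "\<And>t. R \<le> t \<Longrightarrow> (u has_real_derivative q t / p t) (at t within {R..})"
    and q': "\<And>t. R \<le> t \<Longrightarrow> (q has_real_derivative - G t) (at t within {R..})"
    and G: "\<And>t. R \<le> t \<Longrightarrow> (bp t - bm t) * F (u t) \<le> G t"
    and bm: "continuous_on {R..} bm" "\<And>t. R \<le> t \<Longrightarrow> 0 \<le> bm t"
    and bp: "continuous_on {R..} bp" "\<And>t. R \<le> t \<Longrightarrow> 0 \<le> bp t"
    and B: "\<And>t. R \<le> t \<Longrightarrow> integral {R..t} bm \<le> B" and P: "\<And>t. R \<le> t \<Longrightarrow> integral {R..t} (\<lambda>s. 1 / p s) \<le> P"
    and div: "(\<integral>\<^sup>+t\<in>{R..}. ennreal (1 / p t * integral {R..t} bp) \<partial>lborel) = \<infinity>"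
    and u: "\<And>t. R \<le> t \<Longrightarrow> 0 \<le> u t" "\<And>t. R \<le> t \<Longrightarrow> u t \<le> D"
    and F: "\<And>v w. 0 \<le> v \<Longrightarrow> v \<le> w \<Longrightarrow> F v \<le> F w" "\<And>v. 0 \<le> v \<Longrightarrow> 0 \<le> F v" "\<And>v. 0 < v \<Longrightarrow> 0 < F v"
  shows "(u \<longlongrightarrow> 0) at_top"
proof -
  define \<Phi> where "\<Phi> t = integral {R..t} (\<lambda>s. 1 / p s)" for t
  define \<Psi> where "\<Psi> t = integral {R..t} bm" for t
  define I where "I t = integral {R..t} bp" for t
  define J where "J t = integral {R..t} (\<lambda>s. 1 / p s * I s)" for t
  have inv_p: "continuous_on {R..} (\<lambda>s. 1 / p s)"
    using p by (intro continuous_intros) (auto simp: less_imp_neq[symmetric])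
  have \<Phi>': "(\<Phi> has_real_derivative 1 / p t) (at t within {R..})" if "R \<le> t" for t
    unfolding \<Phi>_def by (rule integral_half_line_deriv[OF inv_p that])
  have \<Psi>': "(\<Psi> has_real_derivative bm t) (at t within {R..})" if "R \<le> t" for t
    unfolding \<Psi>_def by (rule integral_half_line_deriv[OF bm(1) that])
  have I': "(I has_real_derivative bp t) (at t within {R..})" if "R \<le> t" for t
    unfolding I_def by (rule integral_half_line_deriv[OF bp(1) that])
  have I_cont: "continuous_on {R..} I"
    using I' by (auto simp: continuous_on_eq_continuous_within intro!: DERIV_continuous)
  have J_cont: "continuous_on {R..} (\<lambda>s. 1 / p s * I s)"
    by (intro continuous_on_mult inv_p I_cont)
  have J': "(J has_real_derivative 1 / p t * I t) (at t within {R..})" if "R \<le> t" for t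
    unfolding J_def by (rule integral_half_line_deriv[OF J_cont that])
  have mono: "\<Phi> s \<le> \<Phi> t" "\<Psi> s \<le> \<Psi> t" "I s \<le> I t" if "R \<le> s" "s \<le> t" for s t
    by (rule nondecreasing_half_line[OF \<Phi>'] nondecreasing_half_line[OF \<Psi>'] nondecreasing_half_line[OF I'];
        use that p(1) bm(2) bp(2) in \<open>auto simp: less_imp_le\<close>)+
  have I0: "0 \<le> I t" if "R \<le> t" for t
    using mono(3)[of R t] that by (simp add: I_def)
  have J0: "0 \<le> 1 / p t * I t" if "R \<le> t" for t
    using I0[OF that] p(1)[OF that] by simp
  \<comment> \<open>One monotonicity statement for two uses: \<delta> = 0 produces the limit of
    \<open>u\<close>, a positive \<delta> refutes a positive limit. The difference
    \<open>J t - I T * \<Phi> t\<close> is the integral of \<open>(I - I T) / p\<close> from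
    \<open>R\<close> to \<open>t\<close>.\<close>
  have u_ge: "(\<lambda>t. (q T + c * B) * \<Phi> t - u t - \<delta> * (J t - I T * \<Phi> t)) x \<le>
      (\<lambda>t. (q T + c * B) * \<Phi> t - u t - \<delta> * (J t - I T * \<Phi> t)) y"
    if T: "R \<le> T" "T \<le> x" "x \<le> y" and c: "c = F D" and \<delta>: "0 \<le> \<delta>" "\<And>t. T \<le> t \<Longrightarrow> \<delta> \<le> F (u t)" for T \<delta> c x y
  proof -
    have "c \<ge> 0" using u[of R] F(2)[of D] by (simp add: c)
    \<comment> \<open>The negative part raises \<open>q\<close> by at most \<open>c * B\<close>; the
      positive part lowers it by at least \<delta> times the growth of \<open>I\<close>.\<close>
    have q_le: "q t \<le> q T + c * B - \<delta> * (I t - I T)" if "T \<le> t" for t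
    proof -
      have d: "((\<lambda>t. c * \<Psi> t - \<delta> * I t - q t) has_real_derivative c * bm t - \<delta> * bp t + G t)
          (at t within {R..})" if "R \<le> t" for t
        using that by (auto intro!: derivative_eq_intros \<Psi>' I' q')
      have "c * \<Psi> T - \<delta> * I T - q T \<le> c * \<Psi> t - \<delta> * I t - q t"
      proof (rule nondecreasing_half_line[OF d])
        fix s assume s: "T < s" "s < t"
        then have "R \<le> s" using T by simp
        have "bm s * F (u s) \<le> bm s * c"
          unfolding c using bm(2)[OF \<open>R \<le> s\<close>] u[OF \<open>R \<le> s\<close>] by (intro mult_left_mono F) auto
        moreover have "bp s * \<delta> \<le> bp s * F (u s)"
          using bp(2)[OF \<open>R \<le> s\<close>] \<delta>(2)[of s] s by (intro mult_left_mono) auto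
        ultimately show "0 \<le> c * bm s - \<delta> * bp s + G s"
          using G[OF \<open>R \<le> s\<close>] by (simp add: algebra_simps)
      qed (use T that in auto)
      moreover have "c * (\<Psi> t - \<Psi> T) \<le> c * B"
        using B[of t] mono(2)[of R T] T that \<open>c \<ge> 0\<close> by (intro mult_left_mono) (auto simp: \<Psi>_def)
      ultimately show ?thesis by (simp add: algebra_simps)
    qed
    have d: "((\<lambda>t. (q T + c * B) * \<Phi> t - u t - \<delta> * (J t - I T * \<Phi> t)) has_real_derivative
        (q T + c * B - \<delta> * (I t - I T) - q t) / p t) (at t within {R..})" if "R \<le> t" for t
    proof -
      have "p t \<noteq> 0" using p(1)[OF that] by simp
      then show ?thesis
        using that by (auto intro!: derivative_eq_intros \<Phi>' u' J' simp: field_simps)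
    qed
    show ?thesis
    proof (rule nondecreasing_half_line[OF d])
      fix t assume t: "x < t" "t < y"
      show "0 \<le> (q T + c * B - \<delta> * (I t - I T) - q t) / p t"
        using q_le[of t] p(1)[of t] t T by (intro divide_nonneg_nonneg) auto
    qed (use T in auto)
  qed
  have \<Phi>P: "0 \<le> \<Phi> t" "\<Phi> t \<le> P" if "R \<le> t" for t
    using P[OF that] mono(1)[of R t] that by (simp_all add: \<Phi>_def)
  define c where "c = q R + F D * B"
  \<comment> \<open>Case \<delta> = 0: this combination and \<open>\<Phi>\<close> are both monotone
    and bounded, hence convergent, and so is \<open>u\<close> although it may not be
    monotone.\<close>
  have "c * \<Phi> x - u x \<le> c * \<Phi> y - u y" if "R \<le> x" "x \<le> y" for x y
    using u_ge[of R x y "F D" 0] that u(1) F(2) by (auto simp: c_def)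
  moreover have "c * \<Phi> x - u x \<le> \<bar>c\<bar> * P" if "R \<le> x" for x
  proof -
    have "c * \<Phi> x \<le> \<bar>c\<bar> * P"
      using \<Phi>P[OF that] by (intro mult_mono) auto
    then show ?thesis using u(1)[OF that] by simp
  qed
  ultimately obtain L1 where L1: "((\<lambda>x. c * \<Phi> x - u x) \<longlongrightarrow> L1) at_top"
    by (rule tendsto_at_top_mono_bounded)
  obtain L2 where L2: "(\<Phi> \<longlongrightarrow> L2) at_top"
    using mono(1) \<Phi>P(2) by (rule tendsto_at_top_mono_bounded)
  define L where "L = c * L2 - L1"
  have uL: "(u \<longlongrightarrow> L) at_top"
    using tendsto_diff[OF tendsto_mult[OF tendsto_const[of c] L2] L1] by (simp add: L_def)
  have "L \<ge> 0"
    by (rule tendsto_lowerbound[OF uL]) (use u(1) in \<open>auto intro!: eventually_mono[OF eventually_ge_at_top[of R]]\<close>)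
  moreover have "\<not> L > 0"
  proof
    assume "L > 0"
    then have "\<forall>\<^sub>F t in at_top. L / 2 < u t"
      using order_tendstoD(1)[OF uL, of "L / 2"] by simp
    then obtain T0 where T0: "\<And>t. T0 \<le> t \<Longrightarrow> L / 2 < u t"
      by (auto simp: eventually_at_top_linorder)
    define T where "T = max R T0"
    \<comment> \<open>Beyond \<open>T\<close> the solution exceeds half its limit, so
      \<open>F (u t)\<close> stays above this positive number.\<close>
    define \<delta> where "\<delta> = F (L / 2)"
    have "\<delta> > 0" using F(3) \<open>L > 0\<close> by (simp add: \<delta>_def)
    have \<delta>: "\<delta> \<le> F (u t)" if "T \<le> t" for t
      unfolding \<delta>_def using T0[of t] that \<open>L > 0\<close> by (intro F) (auto simp: T_def)
    define k where "k t = (q T + F D * B) * \<Phi> t - u t - \<delta> * (J t - I T * \<Phi> t)" for t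
    have k: "k T \<le> k t" if "T \<le> t" for t
      using u_ge[of T T t "F D" \<delta>] that \<delta> \<open>\<delta> > 0\<close> by (auto simp: k_def T_def)
    \<comment> \<open>The inequality \<open>k T \<le> k t\<close> solved for \<open>J t\<close>,
      after dropping \<open>- u t \<le> 0\<close> and bounding \<open>\<Phi>\<close> by
      \<open>P\<close>.\<close>
    define C where "C = (\<bar>q T + F D * B\<bar> * P + \<delta> * I T * P - k T) / \<delta>"
    have "J t \<le> C" if "R \<le> t" for t
    proof -
      have "J t \<le> J (max t T)"
        by (rule nondecreasing_half_line[OF J']) (use that J0 in auto)
      also have "\<delta> * J (max t T) \<le> \<delta> * C"
      proof -
        have R: "R \<le> max t T" using that by simp
        have "(q T + F D * B) * \<Phi> (max t T) \<le> \<bar>q T + F D * B\<bar> * P"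
          using \<Phi>P[OF R] by (intro mult_mono) auto
        moreover have "\<delta> * I T * \<Phi> (max t T) \<le> \<delta> * I T * P"
          using \<Phi>P[OF R] \<open>\<delta> > 0\<close> I0[of T] by (intro mult_left_mono) (auto simp: T_def)
        moreover have "k T \<le> k (max t T)" by (intro k) simp
        moreover have "u (max t T) \<ge> 0" using u(1)[OF R] .
        moreover have "\<delta> * C = \<bar>q T + F D * B\<bar> * P + \<delta> * I T * P - k T"
          using \<open>\<delta> > 0\<close> by (simp add: C_def)
        ultimately show ?thesis
          by (simp add: k_def[of "max t T"] algebra_simps)
      qed
      then have "J (max t T) \<le> C" using \<open>\<delta> > 0\<close> by simp
      finally show ?thesis .
    qed
    then have "(\<integral>\<^sup>+t\<in>{R..}. ennreal (1 / p t * I t) \<partial>lborel) < \<infinity>"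
      unfolding J_def using J_cont J0 by (rule nn_integral_half_line_finite[rotated 2])
    then show False using div by (simp add: I_def)
  qed
  ultimately show ?thesis using uL by simp
qed

text \<open>The cut-off \<open>cl\<close> keeps the argument of \<open>f\<close> between 0 and
  \<open>d\<close>, where \<open>f\<close> is bounded on strips and the slopes of
  \<open>F\<^sub>1\<close> and \<open>F\<^sub>2\<close> give linear bounds. The solution of the
  modified equation turns out to be positive and at most \<open>2 * u0 \<le> d\<close>, so it solves
  the original one.\<close>

lemma half_line_solution:
  fixes R u0 n d :: real and p b\<^sub>1 b\<^sub>2 F\<^sub>1 F\<^sub>2 :: "real \<Rightarrow> real" and f :: "real \<Rightarrow> real \<Rightarrow> real"
  assumes "0 < R" and p: "continuous_on {R..} p" "\<And>t. R \<le> t \<Longrightarrow> p t > 0" "(\<lambda>t. 1 / p t) integrable_on {R..}"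
    and f: "continuous_on ({R..} \<times> {0..}) (\<lambda>(t, v). f t v)"
    and b: "continuous_on {R..} b\<^sub>1" "continuous_on {R..} b\<^sub>2" "\<And>t. R \<le> t \<Longrightarrow> b\<^sub>2 t \<ge> 0"
    and F: "growth_fun F\<^sub>1" "growth_fun F\<^sub>2"
    and fb: "\<And>t v. R \<le> t \<Longrightarrow> 0 \<le> v \<Longrightarrow> b\<^sub>1 t * F\<^sub>1 v \<le> f t v" "\<And>t v. R \<le> t \<Longrightarrow> 0 \<le> v \<Longrightarrow> f t v \<le> b\<^sub>2 t * F\<^sub>2 v"
    and bm: "(\<lambda>t. max 0 (- b\<^sub>1 t)) integrable_on {R..}"
    and div: "(\<integral>\<^sup>+t\<in>{R..}. ennreal (1 / p t * integral {R..t} (\<lambda>s. max 0 (b\<^sub>1 s))) \<partial>lborel) = \<infinity>"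
    and star: "1 < n" "star_cond R p b\<^sub>1 b\<^sub>2 F\<^sub>1 F\<^sub>2 n d" and u0: "0 < u0" "2 * u0 \<le> d"
  obtains u where "continuous_on {R..} u"
    "\<And>t. R \<le> t \<Longrightarrow> u t = u0 - integral {R..t} (\<lambda>s. 1 / p s * integral {R..s} (\<lambda>r. f r (u r)))"
    "\<And>t. R \<le> t \<Longrightarrow> 0 < u t" "\<And>t. R \<le> t \<Longrightarrow> u t \<le> 2 * u0" "(u \<longlongrightarrow> 0) at_top"
proof -
  have "d > 0" using u0 by simp
  note slope1 = growth_fun_slope[OF F(1) \<open>d > 0\<close>] and slope2 = growth_fun_slope[OF F(2) \<open>d > 0\<close>]
  define cl where "cl v = max 0 (min v d)" for v
  have cl: "0 \<le> cl v" "cl v \<le> d" "0 < v \<Longrightarrow> cl v \<le> v" for v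
    using \<open>d > 0\<close> by (auto simp: cl_def)
  define g where "g t v = f t (cl v)" for t v
  have g: "continuous_on ({R..} \<times> UNIV) (\<lambda>(t, v). g t v)"
  proof -
    have "continuous_on ({R..} \<times> UNIV) (\<lambda>x. (fst x, cl (snd x)))"
      unfolding cl_def by (intro continuous_intros)
    then have "continuous_on ({R..} \<times> UNIV) (\<lambda>x. (\<lambda>(t, v). f t v) (fst x, cl (snd x)))"
      by (rule continuous_on_compose2[OF f]) (auto simp: cl)
    then show ?thesis by (simp add: g_def case_prod_unfold)
  qed
  have gbound: "\<exists>C. \<forall>t\<in>{R..B}. \<forall>v. \<bar>g t v\<bar> \<le> C" for B
  proof -
    have "compact ((\<lambda>(t, v). f t v) ` ({R..B} \<times> {0..d}))"
      by (intro compact_continuous_image compact_Times continuous_on_subset[OF f]) auto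
    then obtain C where C: "\<And>x. x \<in> (\<lambda>(t, v). f t v) ` ({R..B} \<times> {0..d}) \<Longrightarrow> \<bar>x\<bar> \<le> C"
      by (metis bounded_iff compact_imp_bounded real_norm_def)
    have "\<bar>g t v\<bar> \<le> C" if "t \<in> {R..B}" for t v
      unfolding g_def using that cl by (intro C image_eqI[of _ _ "(t, cl v)"]) auto
    then show ?thesis by blast
  qed
  have inv_p: "continuous_on {R..} (\<lambda>s. 1 / p s)"
    using p by (intro continuous_intros) (auto simp: less_imp_neq[symmetric])
  obtain u where uc: "continuous_on {R..} u"
    and u: "\<And>t. R \<le> t \<Longrightarrow> u t = u0 - integral {R..t} (\<lambda>s. 1 / p s * integral {R..s} (\<lambda>r. g r (u r)))"
    using volterra_half_line[OF inv_p g gbound] by blast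
  define G where "G t = g t (u t)" for t
  define q where "q t = - integral {R..t} G" for t
  have Gc: "continuous_on {R..} G"
    using continuous_on_compose2[OF g continuous_on_Pair[OF continuous_on_id uc]]
    by (simp add: G_def[abs_def] image_subset_iff)
  have q': "(q has_real_derivative - G t) (at t within {R..})" if "R \<le> t" for t
    unfolding q_def by (intro derivative_intros integral_half_line_deriv Gc that)
  have qc: "continuous_on {R..} q"
    using q' by (auto simp: continuous_on_eq_continuous_within intro!: DERIV_continuous)
  have u': "(u has_real_derivative q t / p t) (at t within {R..})" if "R \<le> t" for t
  proof -
    have "((\<lambda>t. u0 - integral {R..t} (\<lambda>s. 1 / p s * (- q s))) has_real_derivative 0 - 1 / p t * (- q t))
        (at t within {R..})"
      by (intro derivative_intros integral_half_line_deriv continuous_intros inv_p qc that)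
    then have "((\<lambda>t. u0 - integral {R..t} (\<lambda>s. 1 / p s * (- q s))) has_real_derivative q t / p t)
        (at t within {R..})"
      by simp
    then show ?thesis
      by (rule has_field_derivative_transform_within[of _ _ _ _ 1])
        (use that u in \<open>auto simp: q_def G_def[abs_def]\<close>)
  qed
  have uR: "u R = u0" "q R = 0"
    using u[of R] by (simp_all add: q_def)
  have M: "slope_sup F\<^sub>1 d > 0" "slope_sup F\<^sub>2 d > 0"
    by (rule slope1 slope2)+
  have p_ge: "t powr n \<le> p t" if "R \<le> t" for t
    using star(2) that by (auto simp: star_cond_def)
  \<comment> \<open>The slope of \<open>F\<^sub>2\<close> cancels against the one in the bound on
    \<open>b\<^sub>2\<close>. The inequality \<open>cl v \<le> v\<close> is available because the
    comparison asks only about times at which \<open>u\<close> is positive.\<close>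
  have pos: "0 < u t" if "R \<le> t" for t
  proof (rule kneser_positive[OF \<open>0 < R\<close> star(1) p(2) p_ge u' q' _ _ _ that])
    fix t assume t: "R \<le> t" "0 < u t"
    have "G t \<le> b\<^sub>2 t * F\<^sub>2 (cl (u t))"
      unfolding G_def g_def by (intro fb t cl)
    also have "\<dots> \<le> b\<^sub>2 t * (slope_sup F\<^sub>2 d * cl (u t))"
      by (intro mult_left_mono slope2 cl b t)
    also have "\<dots> \<le> b\<^sub>2 t * (slope_sup F\<^sub>2 d * u t)"
      using M by (intro mult_left_mono cl b t) auto
    also have "\<dots> \<le> ((n - 1)\<^sup>2 / (4 * slope_sup F\<^sub>2 d) * t powr (n - 2)) * (slope_sup F\<^sub>2 d * u t)"
      using star(2) t M by (intro mult_right_mono) (auto simp: star_cond_def)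
    also have "\<dots> = (n - 1)\<^sup>2 / 4 * t powr (n - 2) * u t"
      using M by simp
    finally show "G t \<le> (n - 1)\<^sup>2 / 4 * t powr (n - 2) * u t" .
  qed (use uR u0 in auto)
  define B where "B = integral {R..} (\<lambda>t. max 0 (- b\<^sub>1 t))"
  define P where "P = integral {R..} (\<lambda>t. 1 / p t)"
  have bmc: "continuous_on {R..} (\<lambda>t. max 0 (- b\<^sub>1 t))" and bpc: "continuous_on {R..} (\<lambda>t. max 0 (b\<^sub>1 t))"
    by (intro continuous_intros b)+
  have B: "integral {R..t} (\<lambda>t. max 0 (- b\<^sub>1 t)) \<le> B" if "R \<le> t" for t
    unfolding B_def by (rule integral_half_line_le[OF bm _ bmc that]) simp
  have P: "integral {R..t} (\<lambda>t. 1 / p t) \<le> P" if "R \<le> t" for t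
    unfolding P_def by (rule integral_half_line_le[OF p(3) _ inv_p that]) (simp add: p(2) less_imp_le)
  have "0 \<le> P" using P[of R] by simp
  have small: "slope_sup F\<^sub>1 d * B * P \<le> ln 2"
  \<comment> \<open>For \<open>P = 0\<close> the product vanishes; otherwise the quotient in
    \<open>star_cond\<close> can be cleared.\<close>
  proof (cases "P = 0")
    case False
    then have "slope_sup F\<^sub>1 d * P > 0" using M \<open>0 \<le> P\<close> by simp
    moreover have "B \<le> ln 2 / (slope_sup F\<^sub>1 d * P)"
      using star(2) by (simp add: star_cond_def B_def P_def)
    ultimately show ?thesis
      by (simp add: pos_le_divide_eq mult_ac)
  qed simp
  have bound: "u t \<le> 2 * u0" if "R \<le> t" for t
  proof -
    have "u t \<le> 2 * u R"
    proof (rule gronwall_half_line[OF p(2,1) u' q' _ bmc _ B P _ small _ _ that])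
      fix t assume t: "R \<le> t"
      \<comment> \<open>Only the negative part of \<open>b\<^sub>1\<close> enters, and passing from
        \<open>cl (u t)\<close> to the larger \<open>u t\<close> weakens the lower bound.\<close>
      have "- (slope_sup F\<^sub>1 d * max 0 (- b\<^sub>1 t) * u t) \<le> - (max 0 (- b\<^sub>1 t) * (slope_sup F\<^sub>1 d * cl (u t)))"
        using mult_left_mono[OF cl(3)[OF pos[OF t]], of "max 0 (- b\<^sub>1 t) * slope_sup F\<^sub>1 d"] M
        by (simp add: mult_ac)
      also have "\<dots> \<le> - (max 0 (- b\<^sub>1 t) * F\<^sub>1 (cl (u t)))"
        using mult_left_mono[OF slope1(2)[OF cl(1,2)], of "max 0 (- b\<^sub>1 t)" "u t"] by simp
      also have "\<dots> \<le> b\<^sub>1 t * F\<^sub>1 (cl (u t))"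
        using F(1) cl(1)[of "u t"] by (auto simp: growth_fun_def max_def mult_nonneg_nonneg Pi_iff)
      also have "\<dots> \<le> G t"
        unfolding G_def g_def by (intro fb t cl)
      finally show "- (slope_sup F\<^sub>1 d * max 0 (- b\<^sub>1 t) * u t) \<le> G t" .
    qed (use uR u0 M in auto)
    then show ?thesis by (simp add: uR)
  qed
  have cl_u: "cl (u t) = u t" if "R \<le> t" for t
    using pos[OF that] bound[OF that] u0 by (simp add: cl_def)
  have "(u \<longlongrightarrow> 0) at_top"
  proof (rule tendsto_zero_half_line[OF p(2,1) u' q' _ bmc _ bpc _ B P div _ bound, of F\<^sub>1])
    show "(max 0 (b\<^sub>1 t) - max 0 (- b\<^sub>1 t)) * F\<^sub>1 (u t) \<le> G t" if "R \<le> t" for t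
    proof -
      have "max 0 (b\<^sub>1 t) - max 0 (- b\<^sub>1 t) = b\<^sub>1 t" by (simp add: max_def)
      then show ?thesis
        using fb(1)[of t "u t"] pos[OF that] that by (simp add: G_def g_def cl_u)
    qed
    show "0 \<le> u t" if "R \<le> t" for t
      using pos[OF that] by simp
    show "F\<^sub>1 v \<le> F\<^sub>1 w" if "0 \<le> v" "v \<le> w" for v w
      using F(1) that by (auto simp: growth_fun_def mono_on_def)
  qed (use F(1) in \<open>auto simp: growth_fun_def\<close>)
  moreover have "u t = u0 - integral {R..t} (\<lambda>s. 1 / p s * integral {R..s} (\<lambda>r. f r (u r)))" if "R \<le> t" for t
  proof -
    have "integral {R..s} (\<lambda>r. g r (u r)) = integral {R..s} (\<lambda>r. f r (u r))" for s
      by (rule integral_cong) (simp add: g_def cl_u)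
    then show ?thesis using u[OF that] by simp
  qed
  ultimately show ?thesis
    using uc pos bound by (intro that) auto
qed

subsection \<open>The problem on the compact interval\<close>

locale interval_kernel =
  fixes R \<alpha> \<beta> a b :: real and p :: "real \<Rightarrow> real"
  assumes R: "0 < R" and \<alpha>: "0 < \<alpha>" and \<beta>: "0 \<le> \<beta>"
    and p_cont: "continuous_on {0..R} p" and p_pos: "\<And>t. t \<in> {0..R} \<Longrightarrow> 0 < p t"
    and ab: "0 \<le> a" "a < b" "b \<le> R"
begin

abbreviation "k \<equiv> kern \<alpha> \<beta> p"
abbreviation "c \<equiv> cone_const R \<alpha> \<beta> p a b"

definition \<Phi> :: "real \<Rightarrow> real" where "\<Phi> t = integral {0..t} (\<lambda>x. 1 / p x)"

text \<open>Green's formula for \<open>- (p u')' = g\<close> with u'(R) = 0 and \<alpha> u(0) -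
  \<beta> u'(0) = h. For \<open>h = H u\<close> and \<open>g s = f s (u s)\<close> it becomes the
  nonlinear operator; the estimates treat \<open>h\<close> and \<open>g\<close> as free
  data.\<close>

definition green :: "real \<Rightarrow> (real \<Rightarrow> real) \<Rightarrow> real \<Rightarrow> real" where
  "green h g t = h / \<alpha> + integral {0..R} (\<lambda>s. k t s * g s)"

lemma inv_p_cont: "continuous_on {0..R} (\<lambda>x. 1 / p x)"
  using p_pos by (intro continuous_intros p_cont) (auto simp: less_imp_neq[symmetric])

lemma \<Phi>_deriv: "t \<in> {0..R} \<Longrightarrow> (\<Phi> has_real_derivative 1 / p t) (at t within {0..R})"
  unfolding \<Phi>_def by (intro integral_has_real_derivative inv_p_cont)

lemma \<Phi>_cont: "continuous_on {0..R} \<Phi>"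
  using \<Phi>_deriv by (rule DERIV_continuous_on)

lemma \<Phi>_0: "\<Phi> 0 = 0"
  by (simp add: \<Phi>_def)

lemma \<Phi>_mono:
  assumes "0 \<le> s" "s \<le> t" "t \<le> R"
  shows "\<Phi> s \<le> \<Phi> t"
  unfolding \<Phi>_def
  by (rule integral_subset_le)
    (use assms p_pos in \<open>auto intro!: integrable_continuous_real continuous_on_subset[OF inv_p_cont] simp: less_imp_le\<close>)

lemma kern_eq: "k t s = \<beta> / (\<alpha> * p 0) + \<Phi> (min s t)"
  using \<alpha> by (simp add: kern_def \<Phi>_def field_simps)

lemma \<beta>_nonneg: "0 \<le> \<beta> / (\<alpha> * p 0)"
  using \<alpha> \<beta> p_pos[of 0] R by simp

lemma kern_nonneg: "t \<in> {0..R} \<Longrightarrow> s \<in> {0..R} \<Longrightarrow> 0 \<le> k t s"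
  using \<beta>_nonneg \<Phi>_mono[of 0 "min s t"] by (auto simp: kern_eq \<Phi>_0)

lemma kern_le: "t \<in> {0..R} \<Longrightarrow> s \<in> {0..R} \<Longrightarrow> k t s \<le> k R s"
  by (auto simp: kern_eq intro!: \<Phi>_mono)

lemma kern_le_RR: "t \<in> {0..R} \<Longrightarrow> s \<in> {0..R} \<Longrightarrow> k t s \<le> k R R"
  by (auto simp: kern_eq intro!: \<Phi>_mono)

lemma kern_cont: "t \<in> {0..R} \<Longrightarrow> continuous_on {0..R} (\<lambda>s. k t s)"
  unfolding kern_eq
  by (intro continuous_on_add continuous_on_const continuous_on_compose2[OF \<Phi>_cont] continuous_intros) auto

lemma cone_fun_eq: "cone_fun R \<alpha> \<beta> p t = (\<beta> / p 0 + \<alpha> * \<Phi> t) / (\<beta> / p 0 + \<alpha> * \<Phi> R)"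
  by (simp add: cone_fun_def \<Phi>_def)

lemma \<phi>_nonneg: "t \<in> {0..R} \<Longrightarrow> 0 \<le> \<beta> / p 0 + \<alpha> * \<Phi> t"
  using \<alpha> \<beta> p_pos[of 0] R \<Phi>_mono[of 0 t] by (auto simp: \<Phi>_0)

lemma cone_fun_bounds:
  assumes "t \<in> {0..R}"
  shows "0 \<le> cone_fun R \<alpha> \<beta> p t" "cone_fun R \<alpha> \<beta> p t \<le> 1"
proof -
  have "\<beta> / p 0 + \<alpha> * \<Phi> t \<le> \<beta> / p 0 + \<alpha> * \<Phi> R"
    using assms \<alpha> \<Phi>_mono[of t R] by simp
  then show "0 \<le> cone_fun R \<alpha> \<beta> p t" "cone_fun R \<alpha> \<beta> p t \<le> 1"
    using \<phi>_nonneg[OF assms] \<phi>_nonneg[of R] R by (auto simp: cone_fun_eq divide_le_eq_1)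
qed

lemma c_le: "t \<in> {a..b} \<Longrightarrow> c \<le> cone_fun R \<alpha> \<beta> p t"
  unfolding cone_const_def using ab cone_fun_bounds(1)
  by (intro cINF_lower bdd_belowI2[of _ 0]) auto

lemma c_bounds: "0 \<le> c" "c \<le> 1"
proof -
  show "0 \<le> c"
    unfolding cone_const_def using ab cone_fun_bounds(1) by (intro cINF_greatest) auto
  show "c \<le> 1"
    using c_le[of a] cone_fun_bounds(2)[of a] ab by simp
qed

text \<open>With \<phi>(t) = \<beta> / p(0) + \<alpha> \<Phi>(t) the kernel is \<phi>(min s t) /
  \<alpha> and the cone function is \<phi>(t) / \<phi>(R), so both cases follow from monotonicity of
  \<phi>. This inequality is what makes the operator preserve the cone.\<close>

lemma cone_fun_kern:
  assumes "t \<in> {0..R}" "s \<in> {0..R}"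
  shows "cone_fun R \<alpha> \<beta> p t * k R s \<le> k t s"
proof (cases "s \<le> t")
  case True
  then have "k R s = k t s" using assms by (simp add: kern_eq min_def)
  then show ?thesis
    using cone_fun_bounds[OF assms(1)] kern_nonneg[OF assms] mult_right_mono[of _ 1 "k t s"] by simp
next
  case False
  have k: "k R s = (\<beta> / p 0 + \<alpha> * \<Phi> s) / \<alpha>" "k t s = (\<beta> / p 0 + \<alpha> * \<Phi> t) / \<alpha>"
    using False assms \<alpha> by (auto simp: kern_eq add_divide_distrib min_def)
  define x where "x = \<beta> / p 0 + \<alpha> * \<Phi> t"
  define y where "y = \<beta> / p 0 + \<alpha> * \<Phi> s"
  define z where "z = \<beta> / p 0 + \<alpha> * \<Phi> R"
  have xyz: "0 \<le> x" "0 \<le> y" "y \<le> z"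
    using \<phi>_nonneg assms \<Phi>_mono[of s R] \<alpha> by (auto simp: x_def y_def z_def)
  then have "y / z \<le> 1" by (auto simp: divide_le_eq_1)
  then have "x * (y / z) \<le> x" using xyz mult_left_mono[of "y / z" 1 x] by simp
  then have "x / z * (y / \<alpha>) \<le> x / \<alpha>"
    using \<alpha> divide_right_mono[of "x * (y / z)" x \<alpha>] by simp
  then show ?thesis
    by (simp add: k cone_fun_eq x_def y_def z_def)
qed

text \<open>The right-hand side is the twice integrated equation, from which the derivative and its
  zero at \<open>R\<close> can be read off. The two forms are compared by differentiating in
  \<open>t\<close>, without exchanging integrals.\<close>

lemma kern_integral:
  assumes g: "continuous_on {0..R} g" and t: "t \<in> {0..R}"
  shows "integral {0..R} (\<lambda>s. k t s * g s) = \<beta> / (\<alpha> * p 0) * integral {0..R} g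
    + integral {0..t} (\<lambda>s. 1 / p s * (integral {0..R} g - integral {0..s} g))"
proof -
  define F where "F t = integral {0..t} g" for t
  have F': "(F has_real_derivative g x) (at x within {0..R})" if "x \<in> {0..R}" for x
    unfolding F_def by (rule integral_has_real_derivative[OF g that])
  have F_cont: "continuous_on {0..R} F"
    using F' by (rule DERIV_continuous_on)
  \<comment> \<open>\<open>X\<close> is the kernel integral of \<open>\<Phi> (min s t)\<close> split
    at \<open>s = t\<close>; it vanishes at 0 like \<open>Y\<close> and has the same
    derivative.\<close>
  define X where "X t = integral {0..t} (\<lambda>s. \<Phi> s * g s) + \<Phi> t * (F R - F t)" for t
  define Y where "Y t = integral {0..t} (\<lambda>s. 1 / p s * (F R - F s))" for t
  have XY: "((\<lambda>t. X t - Y t) has_real_derivative 0) (at x within {0..R})" if x: "x \<in> {0..R}" for x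
  proof -
    have "(X has_real_derivative \<Phi> x * g x + (1 / p x * (F R - F x) + (0 - g x) * \<Phi> x)) (at x within {0..R})"
      unfolding X_def
      by (intro derivative_intros DERIV_mult integral_has_real_derivative continuous_intros \<Phi>_cont g \<Phi>_deriv F' x)
    moreover have "(Y has_real_derivative 1 / p x * (F R - F x)) (at x within {0..R})"
      unfolding Y_def
      by (intro integral_has_real_derivative continuous_intros inv_p_cont F_cont x)
    ultimately show ?thesis
      by (rule DERIV_diff[THEN DERIV_cong]) simp
  qed
  have "X t - Y t = X 0 - Y 0"
    using has_field_derivative_zero_constant[of "{0..R}" "\<lambda>t. X t - Y t"] XY t R by force
  then have XeqY: "X t = Y t"
    by (simp add: X_def Y_def \<Phi>_0)
  have int: "h integrable_on {x..y}" if "continuous_on {0..R} h" "0 \<le> x" "y \<le> R" for h :: "real \<Rightarrow> real" and x y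
    using that by (intro integrable_continuous_real) (auto intro: continuous_on_subset)
  have \<Phi>min: "continuous_on {0..R} (\<lambda>s. \<Phi> (min s t))"
    by (intro continuous_on_compose2[OF \<Phi>_cont] continuous_intros) (use t in auto)
  have "integral {0..R} (\<lambda>s. \<Phi> (min s t) * g s) =
      integral {0..t} (\<lambda>s. \<Phi> (min s t) * g s) + integral {t..R} (\<lambda>s. \<Phi> (min s t) * g s)"
    using t by (intro Henstock_Kurzweil_Integration.integral_combine[symmetric] int continuous_on_mult \<Phi>min g) auto
  also have "integral {0..t} (\<lambda>s. \<Phi> (min s t) * g s) = integral {0..t} (\<lambda>s. \<Phi> s * g s)"
    by (rule integral_cong) simp
  also have "integral {t..R} (\<lambda>s. \<Phi> (min s t) * g s) = integral {t..R} (\<lambda>s. \<Phi> t * g s)"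
    by (rule integral_cong) simp
  also have "\<dots> = \<Phi> t * (F R - F t)"
    using Henstock_Kurzweil_Integration.integral_combine[of 0 t R g] int[OF g] t by (simp add: F_def)
  finally have "integral {0..R} (\<lambda>s. \<Phi> (min s t) * g s) = X t"
    by (simp add: X_def)
  moreover have "integral {0..R} (\<lambda>s. k t s * g s) =
      \<beta> / (\<alpha> * p 0) * integral {0..R} g + integral {0..R} (\<lambda>s. \<Phi> (min s t) * g s)"
    unfolding kern_eq distrib_right
    by (subst integral_add) (simp_all only: integral_mult_right, (intro int continuous_intros \<Phi>min g; simp)+)
  ultimately show ?thesis
    by (simp add: XeqY Y_def F_def)
qed

lemma green_eq:
  assumes "continuous_on {0..R} g" "t \<in> {0..R}"
  shows "green h g t = h / \<alpha> + \<beta> / (\<alpha> * p 0) * integral {0..R} g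
    + integral {0..t} (\<lambda>s. 1 / p s * (integral {0..R} g - integral {0..s} g))"
  by (simp add: green_def kern_integral[OF assms])

lemma kern_mult_integrable:
  assumes "continuous_on {0..R} g" "t \<in> {0..R}" "0 \<le> x" "y \<le> R"
  shows "(\<lambda>s. k t s * g s) integrable_on {x..y}"
  by (intro integrable_continuous_real
      continuous_on_subset[OF continuous_on_mult[OF kern_cont[OF assms(2)] assms(1)]]) (use assms in auto)

lemma green_mono_R:
  assumes g: "continuous_on {0..R} g" "\<And>s. s \<in> {0..R} \<Longrightarrow> 0 \<le> g s" and t: "t \<in> {0..R}"
  shows "green h g t \<le> green h g R"
  unfolding green_def
  by (intro add_left_mono integral_le kern_mult_integrable g mult_right_mono kern_le t) (use R in auto)

lemma green_nonneg:
  assumes g: "continuous_on {0..R} g" "\<And>s. s \<in> {0..R} \<Longrightarrow> 0 \<le> g s" and t: "t \<in> {0..R}" and h: "0 \<le> h"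
  shows "0 \<le> green h g t"
  unfolding green_def using \<alpha> h
  by (intro add_nonneg_nonneg integral_nonneg kern_mult_integrable g mult_nonneg_nonneg kern_nonneg t) (use R in auto)

text \<open>The kernel inequality integrated against \<open>g\<close>. By
  \<open>green_mono_R\<close> the value at \<open>R\<close> is the maximum, so this is the cone
  condition; the constant term is covered by \<open>c \<le> 1\<close>.\<close>

lemma green_cone:
  assumes g: "continuous_on {0..R} g" "\<And>s. s \<in> {0..R} \<Longrightarrow> 0 \<le> g s" and t: "t \<in> {a..b}" and h: "0 \<le> h"
  shows "c * green h g R \<le> green h g t"
proof -
  have t': "t \<in> {0..R}" using t ab by auto
  have RR: "R \<in> {0..R}" using R by simp
  have "c * (h / \<alpha>) \<le> h / \<alpha>"
    using c_bounds h \<alpha> mult_right_mono[of c 1 "h / \<alpha>"] by simp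
  moreover have "c * integral {0..R} (\<lambda>s. k R s * g s) \<le> integral {0..R} (\<lambda>s. k t s * g s)"
  proof -
    have "c * integral {0..R} (\<lambda>s. k R s * g s) = integral {0..R} (\<lambda>s. c * (k R s * g s))"
      by simp
    also have "\<dots> \<le> integral {0..R} (\<lambda>s. k t s * g s)"
    proof (intro integral_le kern_mult_integrable g t')
      show "(\<lambda>s. c * (k R s * g s)) integrable_on {0..R}"
        by (intro integrable_on_mult_right kern_mult_integrable g RR) auto
      fix s assume s: "s \<in> {0..R}"
      have "c * k R s \<le> cone_fun R \<alpha> \<beta> p t * k R s"
        by (intro mult_right_mono c_le t kern_nonneg RR s)
      also have "\<dots> \<le> k t s"
        by (rule cone_fun_kern[OF t' s])
      finally show "c * (k R s * g s) \<le> k t s * g s"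
        using g(2)[OF s] mult_right_mono[of "c * k R s" "k t s" "g s"] by (simp add: mult.assoc)
    qed auto
    finally show ?thesis .
  qed
  ultimately show ?thesis
    by (simp add: green_def distrib_left)
qed

text \<open>The value \<open>h\<close> only shifts the function by a constant, so equicontinuity
  follows from a bound on \<open>g\<close> alone.\<close>

lemma green_lipschitz:
  assumes g: "continuous_on {0..R} g" "\<And>s. s \<in> {0..R} \<Longrightarrow> \<bar>g s\<bar> \<le> C"
    and P: "\<And>s. s \<in> {0..R} \<Longrightarrow> \<bar>1 / p s\<bar> \<le> P" and xy: "x \<in> {0..R}" "y \<in> {0..R}"
  shows "\<bar>green h g x - green h g y\<bar> \<le> P * (C * R) * \<bar>x - y\<bar>"
proof -
  define F where "F = (\<lambda>t. integral {0..t} g)"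
  have F_cont: "continuous_on {0..R} F"
    unfolding F_def by (intro indefinite_integral_continuous_1 integrable_continuous_real g)
  have "\<bar>integral {0..x} (\<lambda>s. 1 / p s * (F R - F s)) - integral {0..y} (\<lambda>s. 1 / p s * (F R - F s))\<bar>
      \<le> P * (C * R) * \<bar>x - y\<bar>"
  proof (rule lipschitz_integral[OF _ _ xy])
    show "continuous_on {0..R} (\<lambda>s. 1 / p s * (F R - F s))"
      by (intro continuous_on_mult continuous_on_diff continuous_on_const inv_p_cont F_cont)
    fix s assume s: "s \<in> {0..R}"
    have C: "0 \<le> C" using g(2)[OF s] by (meson abs_ge_zero order_trans)
    have "\<bar>F R - F s\<bar> \<le> C * \<bar>R - s\<bar>"
      unfolding F_def by (rule lipschitz_integral[OF g]) (use s R in auto)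
    also have "\<dots> \<le> C * R"
      using s C by (intro mult_left_mono) auto
    finally show "\<bar>1 / p s * (F R - F s)\<bar> \<le> P * (C * R)"
      unfolding abs_mult using order_trans[OF abs_ge_zero P[OF s]] by (intro mult_mono P s) auto
  qed
  then show ?thesis
    by (simp add: green_eq[OF g(1) xy(1)] green_eq[OF g(1) xy(2)] F_def)
qed

lemma green_cont:
  assumes "continuous_on {0..R} g"
  shows "continuous_on {0..R} (green h g)"
proof -
  have "continuous_on {0..R} (\<lambda>t. h / \<alpha> + \<beta> / (\<alpha> * p 0) * integral {0..R} g
    + integral {0..t} (\<lambda>s. 1 / p s * (integral {0..R} g - integral {0..s} g)))"
    by (intro continuous_on_add continuous_on_const indefinite_integral_continuous_1 integrable_continuous_real
        continuous_on_mult continuous_on_diff inv_p_cont assms)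
  then show ?thesis
    by (subst continuous_on_cong[OF refl green_eq[OF assms]]) auto
qed

lemma green_diff:
  assumes g: "continuous_on {0..R} g" "continuous_on {0..R} g'"
    and diff: "\<And>s. s \<in> {0..R} \<Longrightarrow> \<bar>g' s - g s\<bar> \<le> \<eta>" and t: "t \<in> {0..R}"
  shows "\<bar>green h' g' t - green h g t\<bar> \<le> \<bar>h' - h\<bar> / \<alpha> + k R R * \<eta> * R"
proof -
  have "\<bar>integral {0..R} (\<lambda>s. k t s * (g' s - g s))\<bar> \<le> k R R * \<eta> * (R - 0)"
  proof (rule integral_bound[where 'a = real, unfolded real_norm_def])
    show "continuous_on {0..R} (\<lambda>s. k t s * (g' s - g s))"
      by (intro continuous_on_mult continuous_on_diff g kern_cont t)
    fix s assume s: "s \<in> {0..R}"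
    show "\<bar>k t s * (g' s - g s)\<bar> \<le> k R R * \<eta>"
      unfolding abs_mult using kern_nonneg[OF t s] kern_le_RR[OF t s] diff[OF s]
      by (intro mult_mono) auto
  qed (use R in auto)
  moreover have "integral {0..R} (\<lambda>s. k t s * (g' s - g s)) =
      integral {0..R} (\<lambda>s. k t s * g' s) - integral {0..R} (\<lambda>s. k t s * g s)"
    unfolding right_diff_distrib by (intro integral_diff kern_mult_integrable g t) auto
  moreover have "\<bar>h' / \<alpha> - h / \<alpha>\<bar> = \<bar>h' - h\<bar> / \<alpha>"
    using \<alpha> by (simp add: diff_divide_distrib[symmetric])
  ultimately show ?thesis
    by (simp add: green_def)
qed

end

locale interval_bvp = interval_kernel +
  fixes f :: "real \<Rightarrow> real \<Rightarrow> real" and H :: "(real \<Rightarrow> real) \<Rightarrow> real"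
  assumes f_cont: "continuous_on ({0..R} \<times> {0..}) (\<lambda>(t, v). f t v)"
    and f_nonneg: "\<And>t v. t \<in> {0..R} \<Longrightarrow> 0 \<le> v \<Longrightarrow> 0 \<le> f t v"
    and H: "admissible_functional R (K_cone R a b (cone_const R \<alpha> \<beta> p a b)) H"
begin

abbreviation "K \<equiv> K_cone R a b c"

abbreviation res :: "(real \<Rightarrow>\<^sub>C real) \<Rightarrow> real \<Rightarrow> real" where
  "res v \<equiv> restrict (apply_bcontfun v) {0..R}"

text \<open>The cone \<open>K\<close> transported to the Banach space of bounded continuous functions on the line.\<close>

definition KC :: "(real \<Rightarrow>\<^sub>C real) set" where
  "KC = {v. (\<forall>x. apply_bcontfun v x = apply_bcontfun v (clamp 0 R x)) \<and> (\<forall>x. 0 \<le> apply_bcontfun v x) \<and>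
    (\<forall>x\<in>{a..b}. c * norm v \<le> apply_bcontfun v x)}"

section \<open>The cone and the operator among bounded continuous functions\<close>

lemma clamp: "clamp 0 R x \<in> {0..R}"
  using clamp_in_interval[of 0 R x] R by auto

lemma KC_D:
  assumes "v \<in> KC"
  shows "v x = v (clamp 0 R x)" "0 \<le> v x" "x \<in> {a..b} \<Longrightarrow> c * norm v \<le> v x" "v x \<le> norm v"
  using assms norm_bounded[of v x] unfolding KC_def by blast+ (use norm_bounded[of v x] in auto)

lemma sup_norm_res:
  assumes "v \<in> KC"
  shows "sup_norm R (res v) = norm v"
proof -
  have bdd: "bdd_above ((\<lambda>t. \<bar>v t\<bar>) ` {0..R})"
    using norm_bounded[of v] by (intro bdd_aboveI2[of _ _ "norm v"]) simp
  have "sup_norm R (res v) = (SUP t\<in>{0..R}. \<bar>v t\<bar>)"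
    by (simp add: sup_norm_def)
  also have "\<dots> = norm v"
  proof (rule antisym)
    show "(SUP t\<in>{0..R}. \<bar>v t\<bar>) \<le> norm v"
      using norm_bounded[of v] R by (intro cSUP_least) auto
    show "norm v \<le> (SUP t\<in>{0..R}. \<bar>v t\<bar>)"
    proof (rule norm_bound)
      fix x
      have "v x = v (clamp 0 R x)" by (rule KC_D(1)[OF assms])
      then show "norm (v x) \<le> (SUP t\<in>{0..R}. \<bar>v t\<bar>)"
        using cSUP_upper[OF clamp bdd, of x] by simp
    qed
  qed
  finally show ?thesis .
qed

lemma res_in_K:
  assumes "v \<in> KC"
  shows "res v \<in> K"
proof -
  have "continuous_on {0..R} (res v)"
    by (subst continuous_on_cong[OF refl, of _ _ v]) auto
  moreover have "(INF t\<in>{a..b}. res v t) \<ge> c * sup_norm R (res v)"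
    unfolding sup_norm_res[OF assms] using KC_D(3)[OF assms] ab by (intro cINF_greatest) auto
  ultimately show ?thesis
    using KC_D(2)[OF assms] by (auto simp: K_cone_def C_space_def)
qed

lemma KC_I:
  fixes v :: "real \<Rightarrow>\<^sub>C real"
  assumes "\<And>x. v x = v (clamp 0 R x)" "\<And>x. 0 \<le> v x" "\<And>x. x \<in> {a..b} \<Longrightarrow> c * norm v \<le> v x"
  shows "v \<in> KC"
  unfolding KC_def using assms by blast

lemma closed_KC: "closed KC"
  unfolding closed_sequential_limits
proof (intro allI impI, elim conjE)
  fix v :: "nat \<Rightarrow> real \<Rightarrow>\<^sub>C real" and l assume v: "\<forall>n. v n \<in> KC" and lim: "v \<longlonglongrightarrow> l"
  have pt: "(\<lambda>n. v n x) \<longlonglongrightarrow> l x" for x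
    by (rule tendsto_uniform_limitI[OF tendsto_bcontfun_uniform_limit[OF lim]]) simp
  show "l \<in> KC"
  proof (rule KC_I)
    fix x
    have "(\<lambda>n. v n x) = (\<lambda>n. v n (clamp 0 R x))"
      using KC_D(1) v by blast
    then show "l x = l (clamp 0 R x)"
      using pt[of x] pt[of "clamp 0 R x"] LIMSEQ_unique by metis
    show "0 \<le> l x"
      by (rule LIMSEQ_le_const[OF pt]) (use KC_D(2) v in auto)
    assume "x \<in> {a..b}"
    then show "c * norm l \<le> l x"
      by (intro LIMSEQ_le[OF tendsto_mult[OF tendsto_const tendsto_norm[OF lim]] pt])
        (use KC_D(3) v in auto)
  qed
qed

lemma KC_scale:
  assumes "v \<in> KC" "0 \<le> s"
  shows "s *\<^sub>R v \<in> KC"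
proof (rule KC_I)
  fix x
  show "(s *\<^sub>R v) x = (s *\<^sub>R v) (clamp 0 R x)"
    using KC_D(1)[OF assms(1), of x] by simp
  show "0 \<le> (s *\<^sub>R v) x"
    using KC_D(2)[OF assms(1), of x] assms(2) by simp
  show "c * norm (s *\<^sub>R v) \<le> (s *\<^sub>R v) x" if "x \<in> {a..b}"
    using mult_left_mono[OF KC_D(3)[OF assms(1) that] assms(2)] assms(2) by (simp add: mult_ac)
qed

lemma KC_add:
  assumes "v \<in> KC" "w \<in> KC"
  shows "v + w \<in> KC"
proof (rule KC_I)
  fix x
  show "(v + w) x = (v + w) (clamp 0 R x)"
    using KC_D(1)[OF assms(1), of x] KC_D(1)[OF assms(2), of x] by simp
  show "0 \<le> (v + w) x"
    using KC_D(2)[OF assms(1), of x] KC_D(2)[OF assms(2), of x] by simp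
  assume x: "x \<in> {a..b}"
  have "c * norm (v + w) \<le> c * norm v + c * norm w"
    using mult_left_mono[OF norm_triangle_ineq[of v w] c_bounds(1)] by (simp add: distrib_left)
  then show "c * norm (v + w) \<le> (v + w) x"
    using KC_D(3)[OF assms(1) x] KC_D(3)[OF assms(2) x] by simp
qed

lemma KC_const: "const_bcontfun 1 \<in> KC" "0 \<in> KC"
proof -
  have "norm (const_bcontfun 1 :: real \<Rightarrow>\<^sub>C real) \<le> 1"
    by (rule norm_bound) (simp add: const_bcontfun.rep_eq)
  then have "c * norm (const_bcontfun 1 :: real \<Rightarrow>\<^sub>C real) \<le> 1"
    using c_bounds mult_mono[of c 1 "norm (const_bcontfun 1 :: real \<Rightarrow>\<^sub>C real)" 1] by simp
  then show "const_bcontfun 1 \<in> KC"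
    by (intro KC_I) (auto simp: const_bcontfun.rep_eq)
  show "0 \<in> KC"
    by (rule KC_I) auto
qed

lemma convex_KC: "convex KC"
  by (rule convexI) (auto intro: KC_add KC_scale)

text \<open>A positive constant raises the supremum of a nonnegative function by exactly its value;
  the constant function 1 thus serves as the direction \<open>e\<close> of the cone fixed point
  theorems.\<close>

lemma norm_add_const:
  assumes "v \<in> KC" "0 \<le> s"
  shows "norm (v + s *\<^sub>R const_bcontfun 1) = norm v + s"
proof (rule antisym)
  have "norm (const_bcontfun 1 :: real \<Rightarrow>\<^sub>C real) \<le> 1"
    by (rule norm_bound) (simp add: const_bcontfun.rep_eq)
  then show "norm (v + s *\<^sub>R const_bcontfun 1) \<le> norm v + s"
    using norm_triangle_ineq[of v "s *\<^sub>R const_bcontfun 1"] assms(2)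
      mult_left_mono[of "norm (const_bcontfun 1 :: real \<Rightarrow>\<^sub>C real)" 1 s] by simp
  have "norm v \<le> norm (v + s *\<^sub>R const_bcontfun 1) - s"
  proof (rule norm_bound)
    fix x
    show "norm (v x) \<le> norm (v + s *\<^sub>R const_bcontfun 1) - s"
      using norm_bounded[of "v + s *\<^sub>R const_bcontfun 1" x] KC_D(2)[OF assms(1), of x] assms(2)
      by (simp add: const_bcontfun.rep_eq)
  qed
  then show "norm v + s \<le> norm (v + s *\<^sub>R const_bcontfun 1)" by simp
qed

text \<open>\<open>SOME\<close> picks the bounded continuous function that continues Green's formula
  constantly beyond \<open>{0..R}\<close>. Its existence is established for
  \<open>v \<in> KC\<close>, and only there is the value of \<open>T\<close> known.\<close>

definition T :: "(real \<Rightarrow>\<^sub>C real) \<Rightarrow> (real \<Rightarrow>\<^sub>C real)" where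
  "T v = (SOME w. \<forall>x. apply_bcontfun w x = green (H (res v)) (\<lambda>s. f s (v s)) (clamp 0 R x))"

lemma f_comp_cont:
  assumes "v \<in> KC"
  shows "continuous_on {0..R} (\<lambda>s. f s (apply_bcontfun v s))"
proof -
  have "continuous_on {0..R} (\<lambda>s. (\<lambda>(t, v). f t v) (s, apply_bcontfun v s))"
    by (rule continuous_on_compose2[OF f_cont]) (auto intro!: continuous_intros simp: KC_D(2)[OF assms])
  then show ?thesis by simp
qed

lemma f_comp_nonneg: "v \<in> KC \<Longrightarrow> s \<in> {0..R} \<Longrightarrow> 0 \<le> f s (apply_bcontfun v s)"
  by (intro f_nonneg KC_D(2))

lemma H_nonneg: "v \<in> KC \<Longrightarrow> 0 \<le> H (res v)"
  using H res_in_K by (auto simp: admissible_functional_def)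

lemma T_apply:
  assumes "v \<in> KC"
  shows "T v x = green (H (res v)) (\<lambda>s. f s (v s)) (clamp 0 R x)"
proof -
  have "continuous_on (cbox 0 R) (green (H (res v)) (\<lambda>s. f s (v s)))"
    using green_cont[OF f_comp_cont[OF assms]] by simp
  then have "\<exists>w. \<forall>x. apply_bcontfun w x = green (H (res v)) (\<lambda>s. f s (v s)) (clamp 0 R x)"
    by (rule continuous_on_cbox_bcontfunE) blast
  then have "\<forall>x. T v x = green (H (res v)) (\<lambda>s. f s (v s)) (clamp 0 R x)"
    unfolding T_def by (rule someI_ex)
  then show ?thesis by blast
qed

lemma T_apply_in:
  assumes "v \<in> KC" "x \<in> {0..R}"
  shows "T v x = green (H (res v)) (\<lambda>s. f s (v s)) x"
  using T_apply[OF assms(1), of x] assms(2) by simp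

lemma T_nonneg:
  assumes "v \<in> KC"
  shows "0 \<le> T v x"
  unfolding T_apply[OF assms] by (intro green_nonneg f_comp_cont f_comp_nonneg H_nonneg assms clamp)

text \<open>The kernel is nondecreasing in \<open>t\<close>, so the maximum sits at
  \<open>R\<close>. A fixed point therefore has its norm as end value, which becomes the initial
  value of the continuation.\<close>

lemma norm_T:
  assumes "v \<in> KC"
  shows "norm (T v) = T v R"
proof (rule antisym)
  have RR: "R \<in> {0..R}" using R by simp
  show "norm (T v) \<le> T v R"
  proof (rule norm_bound)
    fix x
    have "T v x \<le> T v R"
      unfolding T_apply_in[OF assms RR] T_apply[OF assms, of x]
      by (intro green_mono_R f_comp_cont f_comp_nonneg assms clamp)
    then show "norm (T v x) \<le> T v R"
      using T_nonneg[OF assms, of x] by simp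
  qed
  show "T v R \<le> norm (T v)"
    using norm_bounded[of "T v" R] by simp
qed

lemma T_KC:
  assumes "v \<in> KC"
  shows "T v \<in> KC"
proof (rule KC_I)
  have RR: "R \<in> {0..R}" using R by simp
  fix x
  show "T v x = T v (clamp 0 R x)"
    using T_apply[OF assms, of x] T_apply_in[OF assms clamp, of x] by simp
  show "0 \<le> T v x" by (rule T_nonneg[OF assms])
  assume x: "x \<in> {a..b}"
  then have "x \<in> {0..R}" using ab by auto
  then show "c * norm (T v) \<le> T v x"
    unfolding norm_T[OF assms] T_apply_in[OF assms RR] T_apply_in[OF assms \<open>x \<in> {0..R}\<close>]
    by (intro green_cone f_comp_cont f_comp_nonneg H_nonneg assms x)
qed

lemma f_bounded:
  obtains C where "\<And>s v. s \<in> {0..R} \<Longrightarrow> 0 \<le> v \<Longrightarrow> v \<le> q \<Longrightarrow> f s v \<le> C"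
proof -
  have "compact ((\<lambda>(t, v). f t v) ` ({0..R} \<times> {0..q}))"
    by (intro compact_continuous_image compact_Times continuous_on_subset[OF f_cont]) auto
  then obtain C where C: "\<And>x. x \<in> (\<lambda>(t, v). f t v) ` ({0..R} \<times> {0..q}) \<Longrightarrow> \<bar>x\<bar> \<le> C"
    by (metis bounded_iff compact_imp_bounded real_norm_def)
  have "f s v \<le> C" if "s \<in> {0..R}" "0 \<le> v" "v \<le> q" for s v
  proof -
    have "\<bar>f s v\<bar> \<le> C"
      using that by (intro C image_eqI[of _ _ "(s, v)"]) auto
    then show ?thesis by simp
  qed
  then show ?thesis by (rule that)
qed

lemma H_bounded:
  obtains C where "\<And>v. v \<in> K \<Longrightarrow> sup_norm R v \<le> q \<Longrightarrow> H v \<le> C"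
proof -
  have "\<forall>S\<subseteq>K. (\<exists>r. \<forall>u\<in>S. sup_norm R u \<le> r) \<longrightarrow> bounded (H ` S)"
    using H unfolding admissible_functional_def by (elim conjE)
  then have "bounded (H ` {v \<in> K. sup_norm R v \<le> q})"
    by (elim allE[of _ "{v \<in> K. sup_norm R v \<le> q}"] impE) auto
  then have "bdd_above (H ` {v \<in> K. sup_norm R v \<le> q})"
    by (rule bounded_imp_bdd_above)
  then have "H v \<le> (SUP v\<in>{v \<in> K. sup_norm R v \<le> q}. H v)" if "v \<in> K" "sup_norm R v \<le> q" for v
    using that by (intro cSUP_upper) auto
  then show ?thesis by (rule that)
qed

lemma T_compact:
  obtains C where "compact C" "\<And>v. v \<in> KC \<Longrightarrow> norm v \<le> q \<Longrightarrow> T v \<in> C"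
proof -
  obtain Cf where Cf: "\<And>s v. s \<in> {0..R} \<Longrightarrow> 0 \<le> v \<Longrightarrow> v \<le> q \<Longrightarrow> f s v \<le> Cf"
    using f_bounded[of q] by blast
  obtain CH where CH: "\<And>v. v \<in> K \<Longrightarrow> sup_norm R v \<le> q \<Longrightarrow> H v \<le> CH"
    using H_bounded[of q] by blast
  have "compact ((\<lambda>s. 1 / p s) ` {0..R})"
    by (intro compact_continuous_image inv_p_cont) auto
  then obtain P where P: "\<And>s. s \<in> {0..R} \<Longrightarrow> \<bar>1 / p s\<bar> \<le> P"
    by (metis bounded_iff compact_imp_bounded image_eqI real_norm_def)
  define M where "M = CH / \<alpha> + k R R * Cf * R"
  define C where "C = {v :: real \<Rightarrow>\<^sub>C real. (\<forall>x. v x = v (clamp 0 R x)) \<and> (\<forall>x\<in>{0..R}. \<bar>v x\<bar> \<le> M) \<and>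
    (\<forall>x\<in>{0..R}. \<forall>y\<in>{0..R}. \<bar>v x - v y\<bar> \<le> P * (Cf * R) * \<bar>x - y\<bar>)}"
  have "compact C"
    unfolding C_def using R by (intro compact_lipschitz_bcontfun) simp
  moreover have "T v \<in> C" if v: "v \<in> KC" "norm v \<le> q" for v
  proof -
    have fC: "\<bar>f s (v s)\<bar> \<le> Cf" if "s \<in> {0..R}" for s
      using Cf[OF that KC_D(2)[OF v(1)], of s] f_comp_nonneg[OF v(1) that] KC_D(4)[OF v(1), of s] v(2) by simp
    have "\<bar>T v x\<bar> \<le> M" if x: "x \<in> {0..R}" for x
    proof -
      \<comment> \<open>Comparison with zero data turns the difference estimate into a
        bound.\<close>
      have "\<bar>green (H (res v)) (\<lambda>s. f s (v s)) x - green 0 (\<lambda>_. 0) x\<bar> \<le> \<bar>H (res v) - 0\<bar> / \<alpha> + k R R * Cf * R"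
        using fC by (intro green_diff f_comp_cont v x) auto
      moreover have "H (res v) / \<alpha> \<le> CH / \<alpha>"
        using CH[OF res_in_K[OF v(1)]] \<alpha> v by (intro divide_right_mono) (auto simp: sup_norm_res)
      ultimately show ?thesis
        using H_nonneg[OF v(1)] by (simp add: T_apply_in[OF v(1) x] green_def[of 0] M_def)
    qed
    moreover have "\<bar>T v x - T v y\<bar> \<le> P * (Cf * R) * \<bar>x - y\<bar>" if "x \<in> {0..R}" "y \<in> {0..R}" for x y
      unfolding T_apply_in[OF v(1) that(1)] T_apply_in[OF v(1) that(2)]
      by (rule green_lipschitz[OF f_comp_cont[OF v(1)] fC P that])
    ultimately show ?thesis
      unfolding C_def using KC_D(1)[OF T_KC[OF v(1)]] by blast
  qed
  ultimately show ?thesis by (rule that)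
qed

lemma T_cont: "continuous_on KC T"
  unfolding continuous_on_iff
proof (intro ballI allI impI)
  fix v and \<epsilon> :: real assume v: "v \<in> KC" and "0 < \<epsilon>"
  define q where "q = norm v + 1"
  have kRR: "0 \<le> k R R" using kern_nonneg[of R R] R by simp
  \<comment> \<open>The error from \<open>f\<close> gets a share below \<epsilon>/4, and so does the
    one from \<open>H\<close> after division by \<alpha>; the summand 1 covers
    \<open>k R R * R = 0\<close>.\<close>
  define \<eta> where "\<eta> = \<epsilon> / (4 * (k R R * R + 1))"
  have X: "0 \<le> k R R * R" using kRR R by simp
  then have "0 < \<eta>" using \<open>0 < \<epsilon>\<close> by (simp add: \<eta>_def)
  have "k R R * \<eta> * R < (k R R * R + 1) * \<eta>"
    using \<open>0 < \<eta>\<close> by (simp add: algebra_simps)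
  also have "\<dots> = \<epsilon> / 4"
    using X by (simp add: \<eta>_def divide_eq_eq)
  finally have "k R R * \<eta> * R < \<epsilon> / 2"
    using \<open>0 < \<epsilon>\<close> by simp
  have "continuous_on ({0..R} \<times> {0..q}) (\<lambda>(t, v). f t v)"
    by (rule continuous_on_subset[OF f_cont]) auto
  from uniformly_continuous_second_arg[OF this \<open>0 < \<eta>\<close>]
  obtain \<delta>1 where "\<delta>1 > 0" and \<delta>1: "\<And>t v w. t \<in> {0..R} \<Longrightarrow> v \<in> {0..q} \<Longrightarrow> w \<in> {0..q} \<Longrightarrow> \<bar>v - w\<bar> < \<delta>1 \<Longrightarrow>
      \<bar>f t v - f t w\<bar> < \<eta>"
    by blast
  have "\<alpha> * \<epsilon> / 4 > 0" using \<alpha> \<open>0 < \<epsilon>\<close> by simp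
  then obtain \<delta>2 where "\<delta>2 > 0" and \<delta>2: "\<And>w. w \<in> K \<Longrightarrow> sup_norm R (\<lambda>t. w t - res v t) < \<delta>2 \<Longrightarrow>
      \<bar>H w - H (res v)\<bar> < \<alpha> * \<epsilon> / 4"
  proof -
    have "\<forall>u\<in>K. \<forall>\<epsilon>>0. \<exists>\<delta>>0. \<forall>w\<in>K. sup_norm R (\<lambda>t. w t - u t) < \<delta> \<longrightarrow> \<bar>H w - H u\<bar> < \<epsilon>"
      using H unfolding admissible_functional_def by (elim conjE)
    from this[rule_format, OF res_in_K[OF v] \<open>\<alpha> * \<epsilon> / 4 > 0\<close>] show ?thesis
      using that by blast
  qed
  have "dist (T w) (T v) < \<epsilon>" if w: "w \<in> KC" and d: "dist w v < min (min \<delta>1 \<delta>2) 1" for w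
  proof -
    have wv: "\<bar>w x - v x\<bar> \<le> dist w v" for x
      using dist_bounded[of w x v] by (simp add: dist_real_def)
    have nw: "norm w \<le> q"
      using norm_triangle_ineq2[of w v] d by (simp add: q_def dist_norm)
    have "sup_norm R (\<lambda>t. res w t - res v t) \<le> dist w v"
      unfolding sup_norm_def using wv R by (intro cSUP_least) auto
    then have "\<bar>H (res w) - H (res v)\<bar> < \<alpha> * \<epsilon> / 4"
      using d by (intro \<delta>2 res_in_K w) simp
    then have Hd: "\<bar>H (res w) - H (res v)\<bar> / \<alpha> \<le> \<epsilon> / 4"
      using \<alpha> by (simp add: field_simps)
    have fd: "\<bar>f s (w s) - f s (v s)\<bar> \<le> \<eta>" if "s \<in> {0..R}" for s
    proof (intro less_imp_le \<delta>1 that)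
      show "w s \<in> {0..q}" "v s \<in> {0..q}"
        using KC_D(2)[OF w, of s] KC_D(2)[OF v, of s] KC_D(4)[OF w, of s] KC_D(4)[OF v, of s] nw
        by (auto simp: q_def)
      show "\<bar>w s - v s\<bar> < \<delta>1"
        using wv[of s] d by simp
    qed
    have "dist (T w x) (T v x) \<le> \<epsilon> / 4 + k R R * \<eta> * R" for x
      using green_diff[where h = "H (res v)" and h' = "H (res w)",
          OF f_comp_cont[OF v] f_comp_cont[OF w] fd clamp, of x] Hd
      unfolding dist_real_def T_apply[OF w, of x] T_apply[OF v, of x] by linarith
    then have "dist (T w) (T v) \<le> \<epsilon> / 4 + k R R * \<eta> * R"
      by (rule dist_bound)
    then show ?thesis
      using \<open>k R R * \<eta> * R < \<epsilon> / 2\<close> \<open>0 < \<epsilon>\<close> by simp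
  qed
  then show "\<exists>d>0. \<forall>w\<in>KC. dist w v < d \<longrightarrow> dist (T w) (T v) < \<epsilon>"
    using \<open>\<delta>1 > 0\<close> \<open>\<delta>2 > 0\<close> by (intro exI[of _ "min (min \<delta>1 \<delta>2) 1"]) auto
qed

section \<open>Compression and expansion on spheres of the cone\<close>

lemma sphere_H_bdd: "bdd_above (H ` K_sphere R a b c \<rho>)" "bdd_below (H ` K_sphere R a b c \<rho>)"
proof -
  obtain C where "\<And>v. v \<in> K \<Longrightarrow> sup_norm R v \<le> \<rho> \<Longrightarrow> H v \<le> C"
    using H_bounded[of \<rho>] by blast
  then show "bdd_above (H ` K_sphere R a b c \<rho>)"
    by (intro bdd_aboveI2[of _ _ C]) (simp add: K_sphere_def)
  show "bdd_below (H ` K_sphere R a b c \<rho>)"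
    using H by (intro bdd_belowI2[of _ 0]) (simp add: K_sphere_def admissible_functional_def)
qed

text \<open>The norm of \<open>T v\<close> is its value at \<open>R\<close>. There the kernel
  integral is at most its supremum 1/m, while \<open>f\<close> and \<open>H\<close> are bounded by
  their suprema over what a \<open>v\<close> of norm \<rho> can reach.\<close>

lemma I1_compression:
  assumes I1: "cond_I1 R \<alpha> \<beta> p f H a b \<rho>" and v: "v \<in> KC" "norm v = \<rho>"
  shows "norm (T v) < \<rho>"
proof -
  have RR: "R \<in> {0..R}" using R by simp
  define fs where "fs = (SUP (t, v)\<in>{0..R} \<times> {0..\<rho>}. f t v)"
  define Hs where "Hs = (SUP u\<in>K_sphere R a b c \<rho>. H u)"
  define ks where "ks = (SUP t\<in>{0..R}. integral {0..R} (k t))"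
  have sphere: "res v \<in> K_sphere R a b c \<rho>"
    using res_in_K sup_norm_res v by (simp add: K_sphere_def)
  have Hle: "H (res v) \<le> Hs"
    unfolding Hs_def by (intro cSUP_upper sphere sphere_H_bdd)
  have fle: "f s (v s) \<le> fs" if "s \<in> {0..R}" for s
  proof -
    obtain C where C: "\<And>s v. s \<in> {0..R} \<Longrightarrow> 0 \<le> v \<Longrightarrow> v \<le> \<rho> \<Longrightarrow> f s v \<le> C"
      using f_bounded[of \<rho>] by blast
    have "bdd_above ((\<lambda>(t, v). f t v) ` ({0..R} \<times> {0..\<rho>}))"
      by (intro bdd_aboveI2[of _ _ C]) (auto intro: C)
    from cSUP_upper[OF _ this, of "(s, v s)"] show ?thesis
      using that KC_D(2)[OF v(1), of s] KC_D(4)[OF v(1), of s] v(2) by (simp add: fs_def)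
  qed
  have "0 \<le> fs" using fle[OF RR] f_comp_nonneg[OF v(1) RR] by simp
  have kint: "k t integrable_on {0..R}" if "t \<in> {0..R}" for t
    using kern_cont[OF that] by (rule integrable_continuous_real)
  have kle: "integral {0..R} (k R) \<le> ks"
    unfolding ks_def
  proof (rule cSUP_upper[OF RR])
    show "bdd_above ((\<lambda>t. integral {0..R} (k t)) ` {0..R})"
      by (intro bdd_aboveI2[of _ _ "integral {0..R} (k R)"] integral_le kint kern_le RR)
  qed
  have "norm (T v) = H (res v) / \<alpha> + integral {0..R} (\<lambda>s. k R s * f s (v s))"
    by (simp add: norm_T[OF v(1)] T_apply_in[OF v(1) RR] green_def)
  also have "integral {0..R} (\<lambda>s. k R s * f s (v s)) \<le> integral {0..R} (\<lambda>s. k R s * fs)"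
    by (intro integral_le kern_mult_integrable f_comp_cont v mult_left_mono fle kern_nonneg RR) auto
  also have "integral {0..R} (\<lambda>s. k R s * fs) = integral {0..R} (k R) * fs"
    by simp
  also have "\<dots> \<le> ks * fs"
    by (intro mult_right_mono kle \<open>0 \<le> fs\<close>)
  also have "H (res v) / \<alpha> + ks * fs \<le> Hs / \<alpha> + ks * fs"
    using Hle \<alpha> by (simp add: divide_right_mono)
  also have "\<dots> < \<rho>"
    using I1 by (simp add: cond_I1_def m_const_def fs_def[symmetric] Hs_def[symmetric] ks_def[symmetric] add.commute)
  finally show ?thesis by simp
qed

text \<open>A lower bound at the single point \<open>b\<close> suffices. On \<open>{a..b}\<close>
  the cone condition confines \<open>v\<close> to \<open>{c * \<rho>..\<rho>}\<close>, and
  nonnegativity of \<open>f\<close> and of the kernel allows the integral over the rest of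
  \<open>{0..R}\<close> to be dropped.\<close>

lemma I0_expansion:
  assumes I0: "cond_I0 R \<alpha> \<beta> p f H a b \<rho>" and v: "v \<in> KC" "norm v = \<rho>"
  shows "\<rho> < norm (T v)"
proof -
  have bb: "b \<in> {0..R}" "b \<in> {a..b}" using ab by auto
  have "0 \<le> \<rho>" using v(2) norm_ge_zero by blast
  then have c\<rho>: "0 \<le> c * \<rho>" "c * \<rho> \<le> \<rho>"
    using c_bounds mult_right_mono[of c 1 \<rho>] by auto
  define fi where "fi = (INF (t, v)\<in>{a..b} \<times> {c * \<rho>..\<rho>}. f t v)"
  define Hi where "Hi = (INF u\<in>K_sphere R a b c \<rho>. H u)"
  define ki where "ki = (INF t\<in>{a..b}. integral {a..b} (k t))"
  have sphere: "res v \<in> K_sphere R a b c \<rho>"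
    using res_in_K sup_norm_res v by (simp add: K_sphere_def)
  have Hge: "Hi \<le> H (res v)"
    unfolding Hi_def by (intro cINF_lower sphere sphere_H_bdd)
  have fnn: "0 \<le> f t w" if "t \<in> {a..b}" "w \<in> {c * \<rho>..\<rho>}" for t w
    using that ab c\<rho> by (intro f_nonneg) auto
  have fge: "fi \<le> f s (v s)" if "s \<in> {a..b}" for s
  proof -
    have "bdd_below ((\<lambda>(t, v). f t v) ` ({a..b} \<times> {c * \<rho>..\<rho>}))"
      using fnn by (intro bdd_belowI2[of _ 0]) auto
    from cINF_lower[OF this, of "(s, v s)"] show ?thesis
      using that KC_D(3)[OF v(1) that] KC_D(4)[OF v(1), of s] v(2) by (simp add: fi_def)
  qed
  have "0 \<le> fi"
    unfolding fi_def using ab c\<rho> fnn by (intro cINF_greatest) auto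
  have kint: "k t integrable_on {a..b}" if "t \<in> {0..R}" for t
    using kern_cont[OF that] ab by (intro integrable_continuous_real) (auto intro: continuous_on_subset)
  have kge: "ki \<le> integral {a..b} (k b)"
    unfolding ki_def
  proof (rule cINF_lower[OF _ bb(2)])
    show "bdd_below ((\<lambda>t. integral {a..b} (k t)) ` {a..b})"
      using ab by (intro bdd_belowI2[of _ 0] integral_nonneg kint kern_nonneg) auto
  qed
  have "\<rho> < Hi / \<alpha> + ki * fi"
    using I0 by (simp add: cond_I0_def M_const_def fi_def[symmetric] Hi_def[symmetric] ki_def[symmetric] add.commute)
  also have "\<dots> \<le> H (res v) / \<alpha> + integral {a..b} (k b) * fi"
    using Hge \<alpha> kge \<open>0 \<le> fi\<close> by (intro add_mono divide_right_mono mult_right_mono) auto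
  also have "integral {a..b} (k b) * fi = integral {a..b} (\<lambda>s. k b s * fi)"
    by simp
  also have "\<dots> \<le> integral {a..b} (\<lambda>s. k b s * f s (v s))"
    using ab by (intro integral_le kern_mult_integrable f_comp_cont v mult_left_mono fge kern_nonneg bb) auto
  also have "\<dots> \<le> integral {0..R} (\<lambda>s. k b s * f s (v s))"
    using ab by (intro integral_subset_le kern_mult_integrable f_comp_cont v bb)
      (auto intro!: mult_nonneg_nonneg kern_nonneg f_comp_nonneg v)
  also have "H (res v) / \<alpha> + integral {0..R} (\<lambda>s. k b s * f s (v s)) = T v b"
    by (simp add: T_apply_in[OF v(1) bb(1)] green_def)
  also have "\<dots> \<le> norm (T v)"
    by (rule KC_D(4)[OF T_KC[OF v(1)]])
  finally show ?thesis by simp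
qed

text \<open>The strict bounds on \<open>v R\<close> serve two purposes: a positive initial value for
  the continuation, and the separation of two solutions whose annuli share a sphere.\<close>

lemma interval_solution:
  assumes \<rho>: "0 < \<rho>1" "\<rho>1 < \<rho>2"
    and cond: "cond_I0 R \<alpha> \<beta> p f H a b \<rho>1 \<and> cond_I1 R \<alpha> \<beta> p f H a b \<rho>2 \<or>
      cond_I1 R \<alpha> \<beta> p f H a b \<rho>1 \<and> cond_I0 R \<alpha> \<beta> p f H a b \<rho>2"
  obtains v where "v \<in> K" "\<rho>1 < v R" "v R < \<rho>2" "sup_norm R v = v R"
    "\<And>t. t \<in> {0..R} \<Longrightarrow> v t = H v / \<alpha> + \<beta> / (\<alpha> * p 0) * integral {0..R} (\<lambda>s. f s (v s))
      + integral {0..t} (\<lambda>s. 1 / p s * (integral {0..R} (\<lambda>s. f s (v s)) - integral {0..s} (\<lambda>s. f s (v s))))"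
proof -
  obtain C where C: "compact C" "\<And>v. v \<in> KC \<Longrightarrow> norm v \<le> \<rho>2 \<Longrightarrow> T v \<in> C"
    using T_compact[of \<rho>2] by blast
  have cont: "continuous_on {v \<in> KC. \<rho>1 \<le> norm v \<and> norm v \<le> \<rho>2} T"
    by (rule continuous_on_subset[OF T_cont]) auto
  have e: "v + s *\<^sub>R const_bcontfun 1 \<in> KC" if "v \<in> KC" "0 \<le> s" for v s
    using that by (intro KC_add KC_scale KC_const)
  obtain v where v: "v \<in> KC" "\<rho>1 < norm v" "norm v < \<rho>2" "T v = v"
    using cond
  proof (elim disjE conjE)
    assume *: "cond_I0 R \<alpha> \<beta> p f H a b \<rho>1" "cond_I1 R \<alpha> \<beta> p f H a b \<rho>2"
    show ?thesis
      by (rule krasnoselskii_expansive_inside[OF convex_KC closed_KC KC_const(2) KC_scale e norm_add_const \<rho>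
            cont T_KC C(1) C(2) I0_expansion[OF *(1)] I1_compression[OF *(2)]])
        (auto intro: that)
  next
    assume *: "cond_I1 R \<alpha> \<beta> p f H a b \<rho>1" "cond_I0 R \<alpha> \<beta> p f H a b \<rho>2"
    show ?thesis
      by (rule krasnoselskii_compressive_inside[OF convex_KC closed_KC KC_const(2) KC_scale e norm_add_const \<rho>
            cont T_KC C(1) C(2) I1_compression[OF *(1)] I0_expansion[OF *(2)]])
        (auto intro: that)
  qed
  have vR: "norm v = v R"
    using norm_T[OF v(1)] by (simp add: v(4))
  have int: "integral {0..t} (\<lambda>s. f s (res v s)) = integral {0..t} (\<lambda>s. f s (v s))" if "t \<in> {0..R}" for t
    by (rule integral_cong) (use that in auto)
  have RR: "R \<in> {0..R}" using R by simp
  show ?thesis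
  proof (rule that[of "res v"])
    fix t assume t: "t \<in> {0..R}"
    have "res v t = green (H (res v)) (\<lambda>s. f s (v s)) t"
      using T_apply_in[OF v(1) t] t by (simp add: v(4))
    also have "\<dots> = H (res v) / \<alpha> + \<beta> / (\<alpha> * p 0) * integral {0..R} (\<lambda>s. f s (v s))
      + integral {0..t} (\<lambda>s. 1 / p s * (integral {0..R} (\<lambda>s. f s (v s)) - integral {0..s} (\<lambda>s. f s (v s))))"
      by (rule green_eq[OF f_comp_cont[OF v(1)] t])
    also have "integral {0..t} (\<lambda>s. 1 / p s * (integral {0..R} (\<lambda>s. f s (v s)) - integral {0..s} (\<lambda>s. f s (v s))))
      = integral {0..t} (\<lambda>s. 1 / p s * (integral {0..R} (\<lambda>s. f s (res v s)) - integral {0..s} (\<lambda>s. f s (res v s))))"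
      by (rule integral_cong) (use t int RR in auto)
    also have "integral {0..R} (\<lambda>s. f s (v s)) = integral {0..R} (\<lambda>s. f s (res v s))"
      by (rule int[OF RR, symmetric])
    finally show "res v t = H (res v) / \<alpha> + \<beta> / (\<alpha> * p 0) * integral {0..R} (\<lambda>s. f s (res v s))
      + integral {0..t} (\<lambda>s. 1 / p s * (integral {0..R} (\<lambda>s. f s (res v s)) - integral {0..s} (\<lambda>s. f s (res v s))))" .
  qed (use v vR RR res_in_K sup_norm_res in auto)
qed

end

subsection \<open>Solutions on the whole half line\<close>

text \<open>No derivatives are matched at \<open>R\<close>. One function \<open>q\<close>, the
  oriented integral of \<open>f\<close> along \<open>u\<close> from \<open>t\<close> to
  \<open>R\<close>, plays the role of \<open>p u'\<close> on the whole half line; both integral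
  equations become \<open>u = u 0 + \<integral> q / p\<close>, which makes \<open>u\<close> smooth
  across \<open>R\<close>.\<close>

lemma glued_solution:
  fixes R \<alpha> \<beta> \<rho> :: real and p v x :: "real \<Rightarrow> real" and f :: "real \<Rightarrow> real \<Rightarrow> real"
  assumes R: "0 < R" and \<alpha>: "0 < \<alpha>"
    and p: "continuous_on {0..} p" "\<And>t. 0 \<le> t \<Longrightarrow> 0 < p t"
    and f: "continuous_on ({0..} \<times> {0..}) (\<lambda>(t, v). f t v)"
    and vK: "v \<in> K_cone R a b c" and norm: "sup_norm R v = v R"
    and v: "\<And>t. t \<in> {0..R} \<Longrightarrow> v t = H v / \<alpha> + \<beta> / (\<alpha> * p 0) * integral {0..R} (\<lambda>s. f s (v s))
      + integral {0..t} (\<lambda>s. 1 / p s * (integral {0..R} (\<lambda>s. f s (v s)) - integral {0..s} (\<lambda>s. f s (v s))))"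
    and xc: "continuous_on {R..} x"
    and x: "\<And>t. R \<le> t \<Longrightarrow> x t = v R - integral {R..t} (\<lambda>s. 1 / p s * integral {R..s} (\<lambda>r. f r (x r)))"
    and xpos: "\<And>t. R \<le> t \<Longrightarrow> 0 < x t" and x0: "(x \<longlongrightarrow> 0) at_top"
  defines "u \<equiv> \<lambda>t. if t \<le> R then v t else x t"
  shows "bvp_solution R \<alpha> \<beta> p f (K_cone R a b c) H u" "\<And>t. t \<in> {0..R} \<Longrightarrow> u t \<le> v R"
proof -
  have xR: "x R = v R" using x[of R] by simp
  have u_eq: "u t = v t" if "t \<le> R" for t
    using that by (simp add: u_def)
  have u_eq': "u t = x t" if "R \<le> t" for t
    using that xR by (cases "t = R") (auto simp: u_def)
  have vc: "continuous_on {0..R} v" and v_ext: "v \<in> extensional {0..R}" and v_nonneg: "\<And>t. t \<in> {0..R} \<Longrightarrow> 0 \<le> v t"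
    using vK by (auto simp: K_cone_def C_space_def)
  have v_le: "v t \<le> v R" if "t \<in> {0..R}" for t
  proof -
    have "compact ((\<lambda>t. \<bar>v t\<bar>) ` {0..R})"
      by (intro compact_continuous_image continuous_intros vc) auto
    then have "\<bar>v t\<bar> \<le> sup_norm R v"
      unfolding sup_norm_def using that
      by (intro cSUP_upper bounded_imp_bdd_above compact_imp_bounded)
    then show ?thesis by (simp add: norm)
  qed
  then show "u t \<le> v R" if "t \<in> {0..R}" for t
    using that by (simp add: u_def)
  have u_nonneg: "0 \<le> u t" if "0 \<le> t" for t
    using that v_nonneg[of t] xpos[of t] by (cases "t \<le> R") (auto simp: u_def)
  have uc: "continuous_on {0..} u"
  proof -
    have "continuous_on {0..R} u \<longleftrightarrow> continuous_on {0..R} v" "continuous_on {R..} u \<longleftrightarrow> continuous_on {R..} x"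
      by (rule continuous_on_cong; simp add: u_eq u_eq')+
    moreover have "{0..} = {0..R} \<union> {R..}" using R by auto
    ultimately show ?thesis
      using vc xc by (simp add: continuous_on_closed_Un)
  qed
  define g where "g t = f t (u t)" for t
  define F where "F t = integral {0..t} g" for t
  define q where "q t = F R - F t" for t
  have gc: "continuous_on {0..} g"
  proof -
    have "continuous_on {0..} (\<lambda>s. (\<lambda>(t, v). f t v) (s, u s))"
      by (rule continuous_on_compose2[OF f]) (auto intro!: continuous_intros uc simp: u_nonneg)
    then show ?thesis by (simp add: g_def)
  qed
  have F': "(F has_real_derivative g t) (at t within {0..})" if "0 \<le> t" for t
    unfolding F_def by (rule integral_half_line_deriv[OF gc that])
  have q': "(q has_real_derivative - g t) (at t within {0..})" if "0 \<le> t" for t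
    unfolding q_def using F'[OF that] by (auto intro!: derivative_eq_intros)
  have qc: "continuous_on {0..} q"
    using q' by (auto simp: continuous_on_eq_continuous_within intro!: DERIV_continuous)
  have qpc: "continuous_on {0..} (\<lambda>s. q s / p s)"
    using p by (intro continuous_intros qc) (auto simp: less_imp_neq[symmetric])
  have combine: "integral {0..R} h + integral {R..t} h = integral {0..t} h"
    if "continuous_on {0..} h" "R \<le> t" for h :: "real \<Rightarrow> real" and t
    using that R by (intro Henstock_Kurzweil_Integration.integral_combine integrable_continuous_real)
      (auto intro: continuous_on_subset)
  have Fv: "integral {0..t} (\<lambda>s. f s (v s)) = F t" if "t \<le> R" for t
    unfolding F_def g_def by (rule integral_cong) (use that in \<open>simp add: u_eq\<close>)
  \<comment> \<open>Past \<open>R\<close> the inner integral of the continuation is the same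
    \<open>q\<close> with opposite sign.\<close>
  have Fx: "integral {R..t} (\<lambda>s. f s (x s)) = - q t" if "R \<le> t" for t
  proof -
    have "integral {R..t} (\<lambda>s. f s (x s)) = integral {R..t} g"
      unfolding g_def by (rule integral_cong) (simp add: u_eq')
    then show ?thesis
      using combine[OF gc that] by (simp add: q_def F_def)
  qed
  have v': "v t = H v / \<alpha> + \<beta> / (\<alpha> * p 0) * F R + integral {0..t} (\<lambda>s. q s / p s)" if "t \<in> {0..R}" for t
  proof -
    have "integral {0..t} (\<lambda>s. 1 / p s * (F R - integral {0..s} (\<lambda>s. f s (v s)))) = integral {0..t} (\<lambda>s. q s / p s)"
      by (rule integral_cong) (use that in \<open>simp add: Fv q_def\<close>)
    then show ?thesis
      using v[OF that] by (simp add: Fv)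
  qed
  have u0: "u 0 = H v / \<alpha> + \<beta> / (\<alpha> * p 0) * F R"
    using v'[of 0] R by (simp add: u_def)
  have u: "u t = u 0 + integral {0..t} (\<lambda>s. q s / p s)" if "0 \<le> t" for t
  proof (cases "t \<le> R")
    case True
    then show ?thesis
      using that v'[of t] by (simp add: u0 u_eq)
  next
    case False
    have "integral {R..t} (\<lambda>s. 1 / p s * integral {R..s} (\<lambda>r. f r (x r))) = integral {R..t} (\<lambda>s. - (q s / p s))"
      by (rule integral_cong) (simp add: Fx)
    then have "x t = v R + integral {R..t} (\<lambda>s. q s / p s)"
      using x[of t] False by simp
    then show ?thesis
      using combine[OF qpc, of t] v'[of R] R False by (simp add: u0 u_eq')
  qed
  have u': "(u has_real_derivative q t / p t) (at t within {0..})" if "0 \<le> t" for t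
  proof -
    have "((\<lambda>t. u 0 + integral {0..t} (\<lambda>s. q s / p s)) has_real_derivative 0 + q t / p t) (at t within {0..})"
      by (intro derivative_intros integral_half_line_deriv qpc that)
    then have "((\<lambda>t. u 0 + integral {0..t} (\<lambda>s. q s / p s)) has_real_derivative q t / p t) (at t within {0..})"
      by simp
    then show ?thesis
      by (rule has_field_derivative_transform_within[of _ _ _ _ 1])
        (simp, simp add: that, rule u[symmetric], simp)
  qed
  \<comment> \<open>Extensionality makes the restriction of \<open>u\<close> equal to
    \<open>v\<close> as a function, so \<open>H\<close> has the same value on both.\<close>
  have res: "restrict u {0..R} = v"
    using v_ext by (auto simp: restrict_def extensional_def u_def)
  show "bvp_solution R \<alpha> \<beta> p f (K_cone R a b c) H u"
    unfolding bvp_solution_def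
  proof (intro conjI exI allI impI)
    show "C1_deriv {0..} u (\<lambda>t. q t / p t)"
      using u' qpc by (simp add: C1_deriv_def)
    have "((\<lambda>t. p t * (q t / p t)) has_real_derivative - g t) (at t within {0..})" if "0 \<le> t" for t
      by (rule has_field_derivative_transform_within[OF q'[OF that], of 1])
        (use that p(2) in \<open>auto simp: less_imp_neq[symmetric]\<close>)
    then show "C1_deriv {0..} (\<lambda>t. p t * (q t / p t)) (\<lambda>t. - g t)"
      using gc by (auto simp: C1_deriv_def intro: continuous_on_minus)
    show "- g t + f t (u t) = 0" for t
      by (simp add: g_def)
    show "restrict u {0..R} \<in> K_cone R a b c"
      using vK by (simp add: res)
    \<comment> \<open>Hence \<open>q 0 = F R\<close>, and the term with \<beta> in
      \<open>u 0\<close> cancels in the boundary condition.\<close>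
    have "F 0 = 0" by (simp add: F_def)
    then show "\<alpha> * u 0 - \<beta> * (q 0 / p 0) = H (restrict u {0..R})"
      using \<alpha> p(2)[of 0] by (simp add: res u0 q_def field_simps)
    have "\<forall>\<^sub>F t in at_top. u t = x t"
      using eventually_ge_at_top[of R] by (rule eventually_mono) (rule u_eq')
    then show "(u \<longlongrightarrow> 0) at_top"
      using x0 by (simp add: tendsto_cong)
  qed (rule u_nonneg)
qed

theorem theorem4p2:
  fixes R \<alpha> \<beta> a b :: real
    and p b\<^sub>1 b\<^sub>2 F\<^sub>1 F\<^sub>2 :: "real \<Rightarrow> real"
    and f :: "real \<Rightarrow> real \<Rightarrow> real"
    and K :: "(real \<Rightarrow> real) set"
    and H :: "(real \<Rightarrow> real) \<Rightarrow> real"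
  assumes "R > 0" and "\<alpha> > 0" and "\<beta> \<ge> 0"
    and "continuous_on {0..} p" and "\<forall>t\<ge>0. p t > 0"
    and "(\<lambda>t. 1 / p t) integrable_on {R..}"
    and "continuous_on ({0..} \<times> {0..}) (\<lambda>(t, v). f t v)"
    and "\<forall>t\<in>{0..R}. \<forall>v\<ge>0. f t v \<ge> 0"
    and "\<forall>t\<ge>0. f t 0 = 0"
    and "continuous_on {R..} b\<^sub>1" and "continuous_on {R..} b\<^sub>2" and "\<forall>t\<ge>R. b\<^sub>2 t \<ge> 0"
    and "growth_fun F\<^sub>1" and "growth_fun F\<^sub>2"
    and "\<forall>t\<ge>R. \<forall>v\<ge>0. b\<^sub>1 t * F\<^sub>1 v \<le> f t v \<and> f t v \<le> b\<^sub>2 t * F\<^sub>2 v"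
    and "(\<lambda>t. max 0 (- b\<^sub>1 t)) integrable_on {R..}"
    and "(\<integral>\<^sup>+t\<in>{R..}. ennreal (1 / p t * integral {R..t} (\<lambda>s. max 0 (b\<^sub>1 s))) \<partial>lborel) = \<infinity>"
    and "0 \<le> a" and "a < b" and "b \<le> R" and "\<beta> = 0 \<longrightarrow> a > 0"
    and K_def: "K = K_cone R a b (cone_const R \<alpha> \<beta> p a b)"
    and "admissible_functional R K H"
  shows
    "(\<forall>\<rho>\<^sub>1 \<rho>\<^sub>2. 0 < \<rho>\<^sub>1 \<and> \<rho>\<^sub>1 < \<rho>\<^sub>2 \<and>
        ((cond_I0 R \<alpha> \<beta> p f H a b \<rho>\<^sub>1 \<and> cond_I1 R \<alpha> \<beta> p f H a b \<rho>\<^sub>2) \<or>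
         (cond_I1 R \<alpha> \<beta> p f H a b \<rho>\<^sub>1 \<and> cond_I0 R \<alpha> \<beta> p f H a b \<rho>\<^sub>2)) \<and>
        (\<exists>n>1. star_cond R p b\<^sub>1 b\<^sub>2 F\<^sub>1 F\<^sub>2 n (2 * \<rho>\<^sub>2)) \<longrightarrow>
        (\<exists>u\<^sub>1. bvp_solution R \<alpha> \<beta> p f K H u\<^sub>1 \<and> (\<forall>t\<ge>0. u\<^sub>1 t \<le> 2 * \<rho>\<^sub>2)))
     \<and>
     (\<forall>\<rho>\<^sub>1 \<rho>\<^sub>2 \<rho>\<^sub>3. 0 < \<rho>\<^sub>1 \<and> \<rho>\<^sub>1 < \<rho>\<^sub>2 \<and> \<rho>\<^sub>2 < \<rho>\<^sub>3 \<and>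
        ((cond_I0 R \<alpha> \<beta> p f H a b \<rho>\<^sub>1 \<and> cond_I1 R \<alpha> \<beta> p f H a b \<rho>\<^sub>2 \<and>
            cond_I0 R \<alpha> \<beta> p f H a b \<rho>\<^sub>3) \<or>
         (cond_I1 R \<alpha> \<beta> p f H a b \<rho>\<^sub>1 \<and> cond_I0 R \<alpha> \<beta> p f H a b \<rho>\<^sub>2 \<and>
            cond_I1 R \<alpha> \<beta> p f H a b \<rho>\<^sub>3)) \<and>
        (\<exists>n>1. star_cond R p b\<^sub>1 b\<^sub>2 F\<^sub>1 F\<^sub>2 n (2 * \<rho>\<^sub>3)) \<longrightarrow>
        (\<exists>u\<^sub>1 u\<^sub>2. bvp_solution R \<alpha> \<beta> p f K H u\<^sub>1 \<and> (\<forall>t\<ge>0. u\<^sub>1 t \<le> 2 * \<rho>\<^sub>2) \<and>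
                 bvp_solution R \<alpha> \<beta> p f K H u\<^sub>2 \<and> (\<forall>t\<ge>0. u\<^sub>2 t \<le> 2 * \<rho>\<^sub>3) \<and>
                 (\<exists>t\<ge>0. u\<^sub>1 t \<noteq> u\<^sub>2 t)))"
proof -
  \<comment> \<open>The bounds on \<open>u R\<close> are recorded in order to tell solutions apart.
    The number \<open>d\<close> is separate from \<open>2 * \<rho>2\<close> because in the second
    part both annuli work with the condition for \<open>2 * \<rho>\<^sub>3\<close>.\<close>
  have solve: "\<exists>u. bvp_solution R \<alpha> \<beta> p f K H u \<and> (\<forall>t\<ge>0. u t \<le> 2 * \<rho>2) \<and> \<rho>1 < u R \<and> u R < \<rho>2"
    if \<rho>: "0 < \<rho>1" "\<rho>1 < \<rho>2"
      and cond: "cond_I0 R \<alpha> \<beta> p f H a b \<rho>1 \<and> cond_I1 R \<alpha> \<beta> p f H a b \<rho>2 \<or>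
        cond_I1 R \<alpha> \<beta> p f H a b \<rho>1 \<and> cond_I0 R \<alpha> \<beta> p f H a b \<rho>2"
      and star: "1 < n" "star_cond R p b\<^sub>1 b\<^sub>2 F\<^sub>1 F\<^sub>2 n d" and d: "2 * \<rho>2 \<le> d" for \<rho>1 \<rho>2 n d
  proof -
    interpret interval_bvp R \<alpha> \<beta> a b p f H
    proof
      show "continuous_on {0..R} p"
        using assms(4) by (rule continuous_on_subset) auto
      show "continuous_on ({0..R} \<times> {0..}) (\<lambda>(t, v). f t v)"
        using assms(7) by (rule continuous_on_subset) auto
    qed (use assms in auto)
    obtain v where v: "v \<in> K_cone R a b (cone_const R \<alpha> \<beta> p a b)" "\<rho>1 < v R" "v R < \<rho>2" "sup_norm R v = v R"
      and v_eq: "\<And>t. t \<in> {0..R} \<Longrightarrow> v t = H v / \<alpha> + \<beta> / (\<alpha> * p 0) * integral {0..R} (\<lambda>s. f s (v s))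
        + integral {0..t} (\<lambda>s. 1 / p s * (integral {0..R} (\<lambda>s. f s (v s)) - integral {0..s} (\<lambda>s. f s (v s))))"
      using interval_solution[OF \<rho> cond] by blast
    obtain x where x: "continuous_on {R..} x"
      "\<And>t. R \<le> t \<Longrightarrow> x t = v R - integral {R..t} (\<lambda>s. 1 / p s * integral {R..s} (\<lambda>r. f r (x r)))"
      "\<And>t. R \<le> t \<Longrightarrow> 0 < x t" "\<And>t. R \<le> t \<Longrightarrow> x t \<le> 2 * v R" "(x \<longlongrightarrow> 0) at_top"
    proof (rule half_line_solution[where ?u0.0 = "v R" and d = d and f = f and p = p])
      show "continuous_on {R..} p"
        using assms(4) \<open>R > 0\<close> by (auto intro: continuous_on_subset)
      show "continuous_on ({R..} \<times> {0..}) (\<lambda>(t, v). f t v)"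
        using assms(7) by (rule continuous_on_subset) (use \<open>R > 0\<close> in auto)
      show "star_cond R p b\<^sub>1 b\<^sub>2 F\<^sub>1 F\<^sub>2 n d" by (rule star)
    qed (use assms star(1) \<rho> v(2,3) d in auto)
    define u where "u = (\<lambda>t. if t \<le> R then v t else x t)"
    have sol: "bvp_solution R \<alpha> \<beta> p f K H u" and le: "\<And>t. t \<in> {0..R} \<Longrightarrow> u t \<le> v R"
      unfolding u_def K_def
      using glued_solution[where f = f and p = p and v = v and x = x and H = H and \<alpha> = \<alpha> and \<beta> = \<beta>,
          OF assms(1,2,4) _ assms(7) v(1,4) v_eq x(1,2,3,5)] assms(5) by blast+
    have "u t \<le> 2 * \<rho>2" if "0 \<le> t" for t
      using le[of t] x(4)[of t] that v(2,3) \<rho> by (cases "t \<le> R") (auto simp: u_def)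
    moreover have "u R = v R" by (simp add: u_def)
    ultimately show ?thesis
      using sol v(2,3) by auto
  qed
  show ?thesis
  proof (intro conjI allI impI; elim conjE exE)
    fix \<rho>1 \<rho>2 n
    assume "0 < \<rho>1" "\<rho>1 < \<rho>2" "cond_I0 R \<alpha> \<beta> p f H a b \<rho>1 \<and> cond_I1 R \<alpha> \<beta> p f H a b \<rho>2 \<or>
        cond_I1 R \<alpha> \<beta> p f H a b \<rho>1 \<and> cond_I0 R \<alpha> \<beta> p f H a b \<rho>2"
      "1 < n" "star_cond R p b\<^sub>1 b\<^sub>2 F\<^sub>1 F\<^sub>2 n (2 * \<rho>2)"
    from solve[OF this] show "\<exists>u. bvp_solution R \<alpha> \<beta> p f K H u \<and> (\<forall>t\<ge>0. u t \<le> 2 * \<rho>2)"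
      by blast
  next
    fix \<rho>1 \<rho>2 \<rho>3 n
    assume \<rho>: "0 < \<rho>1" "\<rho>1 < \<rho>2" "\<rho>2 < \<rho>3"
      and cond: "cond_I0 R \<alpha> \<beta> p f H a b \<rho>1 \<and> cond_I1 R \<alpha> \<beta> p f H a b \<rho>2 \<and> cond_I0 R \<alpha> \<beta> p f H a b \<rho>3 \<or>
        cond_I1 R \<alpha> \<beta> p f H a b \<rho>1 \<and> cond_I0 R \<alpha> \<beta> p f H a b \<rho>2 \<and> cond_I1 R \<alpha> \<beta> p f H a b \<rho>3"
      and star: "1 < n" "star_cond R p b\<^sub>1 b\<^sub>2 F\<^sub>1 F\<^sub>2 n (2 * \<rho>3)"
    obtain u\<^sub>1 where u\<^sub>1: "bvp_solution R \<alpha> \<beta> p f K H u\<^sub>1" "\<forall>t\<ge>0. u\<^sub>1 t \<le> 2 * \<rho>2" "u\<^sub>1 R < \<rho>2"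
      using solve[OF \<rho>(1,2) _ star] cond \<rho> by auto
    have "0 < \<rho>2" using \<rho> by simp
    then obtain u\<^sub>2 where u\<^sub>2: "bvp_solution R \<alpha> \<beta> p f K H u\<^sub>2" "\<forall>t\<ge>0. u\<^sub>2 t \<le> 2 * \<rho>3" "\<rho>2 < u\<^sub>2 R"
      using solve[OF _ \<rho>(3) _ star] cond \<rho> by auto
    \<comment> \<open>The values at \<open>R\<close> lie on opposite sides of \<rho>2.\<close>
    have "\<exists>t\<ge>0. u\<^sub>1 t \<noteq> u\<^sub>2 t"
      using u\<^sub>1(3) u\<^sub>2(3) \<open>R > 0\<close> by (intro exI[of _ R]) auto
    with u\<^sub>1 u\<^sub>2 show "\<exists>u\<^sub>1 u\<^sub>2. bvp_solution R \<alpha> \<beta> p f K H u\<^sub>1 \<and> (\<forall>t\<ge>0. u\<^sub>1 t \<le> 2 * \<rho>2) \<and>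
        bvp_solution R \<alpha> \<beta> p f K H u\<^sub>2 \<and> (\<forall>t\<ge>0. u\<^sub>2 t \<le> 2 * \<rho>3) \<and> (\<exists>t\<ge>0. u\<^sub>1 t \<noteq> u\<^sub>2 t)"
      by blast
  qed
qed

end
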